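(* Let $q\geq 4$ be a power of $2$. There are exactly $6$ equivalence classes of $\mathbb{F}_q$-linear complete symmetric rank-distance (CSRD) codes in $M_{3\times 3}(\mathbb{F}_q)$ of minimum distance $2$, and exactly $3$ of these classes consist of MSRD codes.
   Context: Let $\mathrm{Sym}_3(\mathbb{F}_q)$ denote the $6$-dimensional $\mathbb{F}_q$-space of symmetric $3\times 3$ matrices over $\mathbb{F}_q$. An $\mathbb{F}_q$-linear symmetric rank-distance (SRD) code is an $\mathbb{F}_q$-subspace $C\subseteq \mathrm{Sym}_3(\mathbb{F}_q)$ with $|C|\ge 2$; its minimum distance is $d=\min\{\mathrm{rank}(X-Y): X,Y\in C, X\neq Y\}$, i.e. the minimum rank of a nonzero element of $C$. For $3\times 3$ matrices, an $\mathbb{F}_q$-linear SRD code of minimum distance $2$ has dimension at most $4$, and it is called an MSRD code if its dimension equals $4$. An $\mathbb{F}_q$-linear SRD code of minimum distance $d$ is complete (CSRD) if it is not contained in a strictly larger $\mathbb{F}_q$-linear SRD code in $\mathrm{Sym}_3(\mathbb{F}_q)$ of minimum distance $d$. Two codes $C,C'$ are equivalent if $C'=\{AXB: X\in C\}$ for some $A,B\in \mathrm{GL}(3,q)$. *)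

theory Defs
  imports "HOL-Analysis.Analysis"
begin

definition mat_scale :: "'a::field \<Rightarrow> 'a^'n^'m \<Rightarrow> 'a^'n^'m"
  where "mat_scale c X = (\<chi> i j. c * X $ i $ j)"

interpretation matsp: vector_space "mat_scale :: 'a::field \<Rightarrow> 'a^'n^'m \<Rightarrow> 'a^'n^'m"
  by unfold_locales (simp_all add: mat_scale_def vec_eq_iff algebra_simps)

definition Sym3 :: "('a::field^3^3) set"
  where "Sym3 = {X. transpose X = X}"

definition srd_code :: "('a::{field,finite}^3^3) set \<Rightarrow> bool"
  where "srd_code C \<longleftrightarrow> matsp.subspace C \<and> C \<subseteq> Sym3 \<and> card C \<ge> 2"

definition min_distance :: "('a::{field,finite}^3^3) set \<Rightarrow> nat"
  where "min_distance C = Min {rank (X - Y) | X Y. X \<in> C \<and> Y \<in> C \<and> X \<noteq> Y}"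

definition csrd_code :: "('a::{field,finite}^3^3) set \<Rightarrow> bool"
  where "csrd_code C \<longleftrightarrow> srd_code C \<and>
    \<not> (\<exists>D. srd_code D \<and> C \<subset> D \<and> min_distance D = min_distance C)"

text \<open>Maximality is specific to minimum distance 2: the largest dimension of a linear SRD code
  of minimum distance 2 in the symmetric \<open>3 \<times> 3\<close> matrices is 4.\<close>

definition msrd_code_dist2 :: "('a::{field,finite}^3^3) set \<Rightarrow> bool"
  where "msrd_code_dist2 C \<longleftrightarrow> srd_code C \<and> min_distance C = 2 \<and> matsp.dim C = 4"

definition code_equivalent :: "('a::{field,finite}^3^3) set \<Rightarrow> ('a^3^3) set \<Rightarrow> bool"
  where "code_equivalent C C' \<longleftrightarrow>
    (\<exists>A B :: 'a^3^3. invertible A \<and> invertible B \<and> C' = {A ** X ** B | X. X \<in> C})"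

definition csrd_codes :: "nat \<Rightarrow> ('a::{field,finite}^3^3) set set"
  where "csrd_codes d = {C. csrd_code C \<and> min_distance C = d}"

definition csrd_equiv :: "nat \<Rightarrow> (('a::{field,finite}^3^3) set \<times> ('a^3^3) set) set"
  where "csrd_equiv d =
    {(C, C'). C \<in> csrd_codes d \<and> C' \<in> csrd_codes d \<and> code_equivalent C C'}"

lemma code_equivalent_refl: "code_equivalent C C"
  unfolding code_equivalent_def
  by (rule exI[of _ "mat 1"], rule exI[of _ "mat 1"])
    (auto simp: invertible_def intro!: exI[of _ "mat 1"])

lemma code_equivalent_sym:
  assumes "code_equivalent C D" shows "code_equivalent D C"
proof -
  obtain A B where "invertible A" "invertible B" and D: "D = {A ** X ** B | X. X \<in> C}"
    using assms unfolding code_equivalent_def by blast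
  then obtain A' B' where A': "A ** A' = mat 1" "A' ** A = mat 1"
    and B': "B ** B' = mat 1" "B' ** B = mat 1"
    unfolding invertible_def by blast
  have cancel: "A' ** (A ** X ** B) ** B' = X" for X
  proof -
    have "A' ** (A ** X ** B) ** B' = (A' ** A) ** X ** (B ** B')"
      by (simp only: matrix_mul_assoc)
    then show ?thesis by (simp add: A' B')
  qed
  have "invertible A'" "invertible B'"
    using A' B' unfolding invertible_def by blast+
  moreover have "C = {A' ** Y ** B' | Y. Y \<in> D}"
    unfolding D Setcompr_eq_image image_image by (simp add: cancel)
  ultimately show ?thesis
    unfolding code_equivalent_def by blast
qed

lemma code_equivalent_trans:
  assumes "code_equivalent C D" "code_equivalent D E" shows "code_equivalent C E"
proof -
  obtain A B A' B' where inv: "invertible A" "invertible B" "invertible A'" "invertible B'"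
    and D: "D = {A ** X ** B | X. X \<in> C}" and E: "E = {A' ** X ** B' | X. X \<in> D}"
    using assms unfolding code_equivalent_def by blast
  have "E = {(A' ** A) ** X ** (B ** B') | X. X \<in> C}"
    unfolding E D Setcompr_eq_image image_image by (simp add: matrix_mul_assoc)
  then show ?thesis
    unfolding code_equivalent_def using inv by (blast intro: invertible_mult)
qed

lemma equiv_csrd_equiv: "equiv (csrd_codes d) (csrd_equiv d)"
  by (rule equivI)
    (auto simp: csrd_equiv_def refl_on_def sym_def trans_def
      intro: code_equivalent_refl code_equivalent_sym code_equivalent_trans)

end

theory Submission
  imports Defs "HOL-Algebra.Algebraic_Closure_Type"
begin

text \<open>
  In characteristic two every symmetric matrix of rank one over a finite field is \<open>v v\<^sup>T\<close>. Hence a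
  complete code \<open>C\<close> of minimum distance 2 is a space of symmetric matrices that contains no nonzero
  \<open>v v\<^sup>T\<close>, contains a nonzero singular matrix, and has the property that every symmetric
  matrix is a sum of an element of \<open>C\<close> and some \<open>v v\<^sup>T\<close>; therefore \<open>|C| \<ge> q\<^sup>3\<close>.

  If \<open>|C| = q\<^sup>3\<close>, these sums represent every symmetric matrix exactly once, which
  says that all singular matrices in \<open>C\<close> are alternating. According to the dimension 3, 2 or 1 of its
  alternating part, \<open>C\<close> consists of all alternating matrices, is congruent to one fixed code, or is
  determined by a binary cubic form without zeros; all such forms are equivalent because the group of
  fractional linear maps is transitive on the elements of degree 3 over the field.

  If \<open>|C| \<ge> q\<^sup>4\<close>, then \<open>C\<close> contains a code of dimension 4, which is the annihilator of a pencil of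
  ternary quadratic forms without common zeros; as every ternary form has a zero, such a code already
  covers everything and equals \<open>C\<close>. By counting zeros the pencil contains a form that is
  anisotropic in two variables, and the other form has three normal forms relative to it.

  The six resulting codes are told apart by their size and their number of singular matrices.
\<close>

text \<open>Equivalence allows independent factors on the two sides, but every normal form is
  reached by a congruence \<open>A ** X ** transpose A\<close>, which preserves symmetry and sends
  \<open>outer v\<close> to \<open>outer (A *v v)\<close>. Nothing has to be shown about other
  equivalences, since the separating numbers are invariant under all of them. Completeness enters
  through a covering property: if \<open>Y\<close> is outside \<open>C\<close>, the span of
  \<open>C\<close> and \<open>Y\<close> must contain a matrix of rank one, and scaling it gives
  \<open>Y + outer v\<close> in \<open>C\<close>. Counting pairs gives |C| q^3 \<ge> q^6. Equality
  makes the cover injective, so \<open>C\<close> contains no \<open>outer v + outer w\<close> with v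
  \<noteq> w; these sums are exactly the singular matrices with nonzero diagonal. Quadratic forms
  cannot be diagonalised in characteristic two. The substitute for ternary forms is the nucleus, a
  vector orthogonal to everything under the polar form; the class of c modulo the values u^2 + u
  replaces the discriminant of a binary form. The bound on q enters where a binary cubic form is
  recovered from its values, which fails over the field with two elements.\<close>

no_notation Polynomials.var (\<open>X\<index>\<close>)

section \<open>Symmetric matrices of order 3\<close>

text \<open>The diagonal comes before the entries at (1,2), (1,3), (2,3). Coefficients of quadratic
  forms are listed in the same order, so that the pairing \<open>lf\<close> is
  coordinatewise.\<close>

definition sm :: "'a \<Rightarrow> 'a \<Rightarrow> 'a \<Rightarrow> 'a \<Rightarrow> 'a \<Rightarrow> 'a \<Rightarrow> 'a::field^3^3" where
  "sm a b c d e f = vector [vector [a, d, e], vector [d, b, f], vector [e, f, c]]"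

definition m3 :: "'a \<Rightarrow> 'a \<Rightarrow> 'a \<Rightarrow> 'a \<Rightarrow> 'a \<Rightarrow> 'a \<Rightarrow> 'a \<Rightarrow> 'a \<Rightarrow> 'a \<Rightarrow> 'a::field^3^3" where
  "m3 a b c d e f g h i = vector [vector [a, b, c], vector [d, e, f], vector [g, h, i]]"

definition outer :: "'a::field^'n \<Rightarrow> 'a^'n^'n" where
  "outer v = (\<chi> i j. v $ i * v $ j)"

lemma sm_nth [simp]:
  "sm a b c d e f $ 1 $ 1 = a" "sm a b c d e f $ 2 $ 2 = b" "sm a b c d e f $ 3 $ 3 = c"
  "sm a b c d e f $ 1 $ 2 = d" "sm a b c d e f $ 2 $ 1 = d"
  "sm a b c d e f $ 1 $ 3 = e" "sm a b c d e f $ 3 $ 1 = e"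
  "sm a b c d e f $ 2 $ 3 = f" "sm a b c d e f $ 3 $ 2 = f"
  by (simp_all add: sm_def)

lemma sm_eq_iff [simp]:
  "sm a b c d e f = sm a' b' c' d' e' f' \<longleftrightarrow>
    a = a' \<and> b = b' \<and> c = c' \<and> d = d' \<and> e = e' \<and> f = f'"
  by (auto simp: vec_eq_iff forall_3)

lemma sm_in_Sym3 [simp]: "sm a b c d e f \<in> Sym3"
  by (simp add: Sym3_def vec_eq_iff forall_3 transpose_def)

lemma Sym3_eq_sm:
  assumes "X \<in> Sym3"
  shows "X = sm (X$1$1) (X$2$2) (X$3$3) (X$1$2) (X$1$3) (X$2$3)"
proof -
  have "X $ i $ j = X $ j $ i" for i j
    using assms by (auto simp: Sym3_def transpose_def vec_eq_iff)
  then show ?thesis by (simp add: vec_eq_iff forall_3)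
qed

lemma Sym3_cases:
  assumes "X \<in> Sym3"
  obtains a b c d e f where "X = sm a b c d e f"
  using Sym3_eq_sm[OF assms] by blast

lemma sm_add [simp]:
  "sm a b c d e f + sm a' b' c' d' e' f' = sm (a+a') (b+b') (c+c') (d+d') (e+e') (f+f')"
  by (simp add: vec_eq_iff forall_3)

lemma sm_scale [simp]:
  "mat_scale r (sm a b c d e f) = sm (r*a) (r*b) (r*c) (r*d) (r*e) (r*f)"
  by (simp add: vec_eq_iff forall_3 mat_scale_def)

lemma sm_zero: "0 = sm 0 0 0 0 0 0"
  by (simp add: vec_eq_iff forall_3)

lemma sm_eq_0_iff [simp]:
  "sm a b c d e f = 0 \<longleftrightarrow> a = 0 \<and> b = 0 \<and> c = 0 \<and> d = 0 \<and> e = 0 \<and> f = 0"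
  by (simp add: sm_zero)

lemma outer_sm: "outer v =
    sm (v$1 * v$1) (v$2 * v$2) (v$3 * v$3) (v$1 * v$2) (v$1 * v$3) (v$2 * v$3)"
  by (simp add: vec_eq_iff forall_3 outer_def mult.commute)

lemma outer_in_Sym3 [simp]: "outer v \<in> Sym3"
  by (simp add: outer_sm)

lemma subspace_Sym3: "matsp.subspace (Sym3 :: ('a::field^3^3) set)"
  by (auto simp: matsp.subspace_def Sym3_def transpose_def vec_eq_iff mat_scale_def)

lemma card_Sym3: "card (Sym3 :: ('a::{field,finite}^3^3) set) = CARD('a) ^ 6"
proof -
  let ?g = "\<lambda>(a::'a, b, c, d, e, f). sm a b c d e f"
  have "bij_betw ?g UNIV Sym3"
    unfolding bij_betw_def
  proof
    show "inj ?g" by (rule injI) (simp split: prod.splits)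
    show "range ?g = Sym3" using Sym3_eq_sm by (force simp: image_iff)
  qed
  then have "card (Sym3 :: ('a^3^3) set) = CARD('a \<times> 'a \<times> 'a \<times> 'a \<times> 'a \<times> 'a)"
    using bij_betw_same_card by fastforce
  then show ?thesis by (simp add: eval_nat_numeral)
qed

section \<open>Cardinalities of subspaces\<close>

lemma card_span_insert:
  fixes S :: "('a::{field,finite}^'n^'m) set"
  assumes S: "matsp.subspace S" and Y: "Y \<notin> S"
  shows "card (matsp.span (insert Y S)) = CARD('a) * card S"
proof -
  let ?g = "\<lambda>(r, X). X + mat_scale r Y"
  have inj: "inj_on ?g (UNIV \<times> S)"
  proof (rule inj_onI, clarify)
    fix r r' X X' assume XX: "X \<in> S" "X' \<in> S" and eq: "X + mat_scale r Y = X' + mat_scale r' Y"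
    have "mat_scale (r - r') Y = X' - X"
      using eq by (simp add: matsp.scale_left_diff_distrib algebra_simps)
    then have mem: "mat_scale (r - r') Y \<in> S"
      using S XX by (simp add: matsp.subspace_diff)
    have "r = r'"
    proof (rule ccontr)
      assume "r \<noteq> r'"
      then have "mat_scale (inverse (r - r')) (mat_scale (r - r') Y) = Y" by simp
      then show False using Y matsp.subspace_scale[OF S mem] by metis
    qed
    then show "r = r' \<and> X = X'" using eq by simp
  qed
  have "matsp.span (insert Y S) = ?g ` (UNIV \<times> S)"
    unfolding matsp.span_insert matsp.span_eq_iff[THEN iffD2, OF S]
  proof (intro equalityI subsetI)
    fix Z assume "Z \<in> {x. \<exists>k. x - mat_scale k Y \<in> S}"
    then obtain k where "Z - mat_scale k Y \<in> S" by blast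
    then show "Z \<in> ?g ` (UNIV \<times> S)"
      by (intro image_eqI[of _ _ "(k, Z - mat_scale k Y)"]) auto
  qed (auto, metis add_diff_cancel_right')
  then show ?thesis using card_image[OF inj] by (simp add: card_cartesian_product)
qed

lemma card_subspace:
  fixes S :: "('a::{field,finite}^'n^'m) set"
  assumes S: "matsp.subspace S"
  shows "card S = CARD('a) ^ matsp.dim S"
proof -
  have indep: "finite B \<Longrightarrow> \<not> matsp.dependent B \<Longrightarrow> card (matsp.span B) = CARD('a) ^ card B"
    for B :: "('a^'n^'m) set"
  proof (induction B rule: finite_induct)
    case (insert x B)
    then have "x \<notin> matsp.span B" and "\<not> matsp.dependent B"
      by (auto simp: matsp.independent_insert)
    with insert card_span_insert[of "matsp.span B" x] show ?case
      by (simp add: matsp.subspace_span matsp.span_insert matsp.span_span)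
  qed simp
  obtain B where "B \<subseteq> S" "\<not> matsp.dependent B" "S \<subseteq> matsp.span B" "card B = matsp.dim S"
    using matsp.basis_exists[of S] by blast
  then show ?thesis
    using indep[of B] matsp.span_minimal[of B S] S by (metis finite subset_antisym)
qed

text \<open>Adjoining one element of \<open>S\<close> at a time multiplies the size by
  \<open>CARD('a)\<close>, so every smaller power occurs. This cuts a code of dimension 4 out of a
  complete code that might be larger.\<close>

lemma subspace_with_card:
  fixes S :: "('a::{field,finite}^'n^'m) set"
  assumes S: "matsp.subspace S" and k: "CARD('a) ^ k \<le> card S" and q: "CARD('a) > 1"
  shows "\<exists>T\<subseteq>S. matsp.subspace T \<and> card T = CARD('a) ^ k"
  using k
proof (induction k)
  case 0
  then show ?case
    using S by (intro exI[of _ "{0}"]) (auto simp: matsp.subspace_0)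
next
  case (Suc k)
  have lt: "CARD('a) ^ k < CARD('a) ^ Suc k" using q by simp
  with Suc obtain T where T: "T \<subseteq> S" "matsp.subspace T" "card T = CARD('a) ^ k" by auto
  with lt Suc.prems have "T \<noteq> S" by auto
  with T obtain Y where "Y \<in> S" "Y \<notin> T" by blast
  with T S show ?case
    by (intro exI[of _ "matsp.span (insert Y T)"])
      (use matsp.span_minimal[of "insert Y T" S] in \<open>auto simp: card_span_insert\<close>)
qed

section \<open>Equivalence and congruence\<close>

lemma invertible_transpose_field: "invertible (A::'a::field^'n^'n) \<Longrightarrow> invertible (transpose A)"
  by (simp add: invertible_det_nz det_transpose)

definition congr :: "'a::field^3^3 \<Rightarrow> ('a^3^3) set \<Rightarrow> ('a^3^3) set" where
  "congr A C = (\<lambda>X. A ** X ** transpose A) ` C"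

lemma code_equivalent_congr:
  "invertible A \<Longrightarrow> code_equivalent C (congr A C)"
  unfolding code_equivalent_def congr_def
  using invertible_transpose_field[of A] by (intro exI[of _ A] exI[of _ "transpose A"]) auto

lemma code_equivalent_inj:
  fixes A B :: "'a::field^3^3"
  assumes "invertible A" "invertible B"
  shows "inj (\<lambda>X. A ** X ** B)"
proof (rule injI)
  fix X Y assume eq: "A ** X ** B = A ** Y ** B"
  obtain A' B' where A': "A' ** A = mat 1" and B': "B ** B' = mat 1"
    using assms unfolding invertible_def by blast
  have "A' ** (A ** Z ** B) ** B' = Z" for Z
  proof -
    have "A' ** (A ** Z ** B) ** B' = (A' ** A) ** Z ** (B ** B')"
      by (simp only: matrix_mul_assoc)
    then show ?thesis by (simp add: A' B')
  qed
  then show "X = Y" using eq by metis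
qed

text \<open>Multiplication by invertible factors is injective and preserves the vanishing of
  \<open>det\<close>. These two numbers separate the six classes.\<close>

lemma code_equivalent_card:
  assumes "code_equivalent C D"
  shows "card D = card C" and "card {X \<in> D. det X = 0} = card {X \<in> C. det X = 0}"
proof -
  obtain A B where AB: "invertible A" "invertible B" and D: "D = {A ** X ** B | X. X \<in> C}"
    using assms unfolding code_equivalent_def by blast
  have inj: "inj_on (\<lambda>X. A ** X ** B) S" for S
    using code_equivalent_inj[OF AB] inj_on_subset by blast
  have det: "det (A ** X ** B) = 0 \<longleftrightarrow> det X = 0" for X
    using AB by (simp add: det_mul invertible_det_nz)
  have "D = (\<lambda>X. A ** X ** B) ` C" "{X \<in> D. det X = 0} = (\<lambda>X. A ** X ** B) ` {X \<in> C. det X = 0}"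
    using D det by auto
  then show "card D = card C" "card {X \<in> D. det X = 0} = card {X \<in> C. det X = 0}"
    by (simp_all only: card_image[OF inj])
qed

lemma matrix_mul_add_rdistrib: "(A + B) ** C = A ** C + B ** (C::'a::field^3^3)"
  by (simp add: vec_eq_iff matrix_matrix_mult_def sum.distrib algebra_simps)

lemma congr_add:
  "A ** (X + Y) ** B = A ** X ** B + A ** Y ** (B::'a::field^3^3)"
  by (simp add: matrix_add_ldistrib matrix_mul_add_rdistrib)

lemma congr_scale:
  "A ** mat_scale r X ** B = mat_scale r (A ** X ** (B::'a::field^3^3))"
  by (simp add: vec_eq_iff matrix_matrix_mult_def mat_scale_def sum_distrib_left algebra_simps)

lemma subspace_congr:
  assumes "matsp.subspace C" shows "matsp.subspace (congr A C)"
  unfolding matsp.subspace_def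
proof (intro conjI ballI allI)
  show "0 \<in> congr A C"
    using matsp.subspace_0[OF assms] by (force simp: congr_def)
  fix X Y r assume "X \<in> congr A C"
  then obtain X' where X': "X' \<in> C" "X = A ** X' ** transpose A" by (auto simp: congr_def)
  then show "mat_scale r X \<in> congr A C"
    using matsp.subspace_scale[OF assms] by (auto simp: congr_def congr_scale[symmetric])
  assume "Y \<in> congr A C"
  then obtain Y' where Y': "Y' \<in> C" "Y = A ** Y' ** transpose A" by (auto simp: congr_def)
  then show "X + Y \<in> congr A C"
    using X' matsp.subspace_add[OF assms] by (auto simp: congr_def congr_add[symmetric])
qed

lemma congr_Sym3: "X \<in> Sym3 \<Longrightarrow> A ** X ** transpose A \<in> Sym3"
  by (simp add: Sym3_def matrix_transpose_mul matrix_mul_assoc)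

lemma congr_subset_Sym3: "C \<subseteq> Sym3 \<Longrightarrow> congr A C \<subseteq> Sym3"
  by (auto simp: congr_def congr_Sym3)

lemma congr_outer: "A ** outer v ** transpose A = outer ((A::'a::field^3^3) *v v)"
  by (simp add: vec_eq_iff matrix_matrix_mult_def matrix_vector_mult_def outer_def transpose_def
      sum_3 algebra_simps)

lemma card_congr: "invertible A \<Longrightarrow> card (congr A C) = card C"
  unfolding congr_def
  by (intro card_image inj_on_subset[OF code_equivalent_inj]) (auto simp: invertible_transpose_field)

lemma invertible_m3:
  "invertible (m3 a b c d e f g h i) \<longleftrightarrow>
    a*e*i + b*f*g + c*d*h - a*f*h - b*d*i - c*e*g \<noteq> 0"
  by (simp add: invertible_det_nz det_3 m3_def)

lemma congr_m3_sm:
  "m3 a11 a12 a13 a21 a22 a23 a31 a32 a33 ** sm a b c d e f ** transpose (m3 a11 a12 a13 a21 a22 a23 a31 a32 a33)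
   = (let B = (\<lambda>x y z x' y' z'. a*x*x' + b*y*y' + c*z*z' + d*(x*y' + y*x') + e*(x*z' + z*x') + f*(y*z' + z*y'))
      in sm (B a11 a12 a13 a11 a12 a13) (B a21 a22 a23 a21 a22 a23) (B a31 a32 a33 a31 a32 a33)
        (B a11 a12 a13 a21 a22 a23) (B a11 a12 a13 a31 a32 a33) (B a21 a22 a23 a31 a32 a33))"
  by (simp add: vec_eq_iff forall_3 m3_def matrix_matrix_mult_def sum_3 transpose_def Let_def distrib_left distrib_right ac_simps)

section \<open>Rank\<close>

lemma rank_less_iff_det: "rank (X::'a::field^'n^'n) < CARD('n) \<longleftrightarrow> det X = 0"
proof -
  have "rank X = CARD('n) \<longleftrightarrow> vec.span (rows X) = UNIV"
    unfolding row_rank_def_gen vec.dim_eq_full[symmetric] by (simp add: vec.dimension_def card_cart_basis)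
  also have "\<dots> \<longleftrightarrow> det X \<noteq> 0"
    by (simp add: matrix_left_invertible_span_rows_gen[symmetric] invertible_left_inverse[symmetric]
        invertible_det_nz)
  finally show ?thesis
    using dim_subset_UNIV_cart_gen[of "rows X"] by (auto simp: row_rank_def_gen)
qed

lemma rank_outer_le: "rank (outer v) \<le> 1"
proof -
  have "rows (outer v) \<subseteq> vec.span {v}"
    by (auto simp: rows_def row_def outer_def vec.span_singleton vec_eq_iff)
  then have "rank (outer v) \<le> card {v}"
    unfolding row_rank_def_gen by (intro vec.dim_le_card) auto
  then show ?thesis by simp
qed

text \<open>All rows are multiples \<open>u i *s w\<close> of one vector. Symmetry gives u_i w_j =
  u_j w_i, so an index j with w_j nonzero shows that u is proportional to w.\<close>

lemma Sym3_rank_le_1: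
  assumes X: "X \<in> Sym3" and r: "rank X \<le> 1"
  obtains k v where "X = mat_scale k (outer v)"
proof -
  obtain B where B0: "B \<subseteq> rows X" "vec.independent B" "rows X \<subseteq> vec.span B" "card B = vec.dim (rows X)"
    by (rule vec.basis_exists)
  have B: "rows X \<subseteq> vec.span B" "card B \<le> 1" "vec.independent B"
    using B0(2,3,4) r unfolding row_rank_def_gen by simp_all
  have "finite B" using B(3) vec.finiteI_independent by blast
  then have "\<forall>x\<in>B. \<forall>y\<in>B. x = y" using B(2) card_le_Suc0_iff_eq[of B] by simp
  then obtain w where "B \<subseteq> {w}" by (cases "B = {}") blast+
  then have "rows X \<subseteq> vec.span {w}"
    using B(1) vec.span_mono[of B "{w}"] by blast
  then have "\<forall>i. \<exists>u. row i X = u *s w"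
    unfolding rows_def vec.span_singleton by blast
  then obtain u where u: "\<And>i. row i X = u i *s w" by metis
  then have X_ij: "X $ i $ j = u i * w $ j" for i j
    using u[of i] by (auto simp: row_def vec_eq_iff)
  have sym: "u i * w $ j = u j * w $ i" for i j
    using X unfolding X_ij[symmetric] by (auto simp: Sym3_def transpose_def vec_eq_iff)
  show thesis
  proof (cases "w = 0")
    case True
    then have "X = mat_scale 0 (outer w)"
      by (simp add: vec_eq_iff X_ij mat_scale_def)
    then show thesis by (rule that)
  next
    case False
    then obtain j where j: "w $ j \<noteq> 0" by (auto simp: vec_eq_iff)
    have "X $ i $ k = u j / w $ j * (w $ i * w $ k)" for i k
      using sym[of i j] j by (simp add: X_ij field_simps)
    then have "X = mat_scale (u j / w $ j) (outer w)"
      by (simp add: vec_eq_iff mat_scale_def outer_def)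
    then show thesis by (rule that)
  qed
qed

section \<open>Finite fields of characteristic two\<close>

text \<open>Characteristic two is an assumption on the type. The simplification rules turn
  differences into sums, and \<open>add_eq_0\<close> turns the vanishing of a sum into an
  equation.\<close>

locale char2_field =
  fixes F :: "'a::{field,finite} itself"
  assumes char2: "(1::'a) + 1 = 0"
begin

lemma add_self [simp]: "x + x = (0::'a)"
proof -
  have "x + x = x * (1 + 1)" by (simp only: distrib_left mult_1_right)
  then show ?thesis by (simp only: char2 mult_zero_right)
qed

lemma two_eq_0 [simp]: "(2::'a) = 0"
  using add_self[of 1] by (simp only: one_add_one)

lemma add_self_left [simp]: "x + (x + y) = (y::'a)"
  by (simp add: add.assoc[symmetric])

lemma uminus_eq [simp]: "- x = (x::'a)"
  using add_self[of x] by (simp only: add_eq_0_iff)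

lemma diff_eq_add [simp]: "x - y = x + (y::'a)"
  by (simp only: diff_conv_add_uminus uminus_eq)

lemma add_eq_0 [simp]: "x + y = 0 \<longleftrightarrow> x = (y::'a)"
  using add_eq_0_iff[of x y] by auto

lemma mat_add_self [simp]: "X + X = (0::'a^'n^'m)"
  by (simp add: vec_eq_iff)

lemma mat_add_self_left [simp]: "X + (X + Y) = (Y::'a^'n^'m)"
  by (simp add: add.assoc[symmetric])

lemma mat_diff_eq_add [simp]: "X - Y = X + (Y::'a^'n^'m)"
  by (simp add: vec_eq_iff)

lemma square_eq_iff [simp]: "x * x = y * y \<longleftrightarrow> x = (y::'a)"
proof
  assume "x * x = y * y"
  then have "(x + y) * (x + y) = 0" by (simp add: algebra_simps)
  then show "x = y" by simp
qed simp

text \<open>Squaring is injective in characteristic two, hence bijective on a finite field;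
  \<open>rt\<close> is its inverse.\<close>

definition rt :: "'a \<Rightarrow> 'a" where "rt x = (THE y. y * y = x)"

lemma rt_mult_self [simp]: "rt x * rt x = x"
proof -
  have "inj (\<lambda>y::'a. y * y)" by (rule injI) simp
  then have "surj (\<lambda>y::'a. y * y)" by (simp add: finite_UNIV_inj_surj)
  then obtain y where "y * y = x" unfolding surj_def by metis
  then have "(THE y. y * y = x) = y" by (intro the_equality) (auto simp flip: \<open>y * y = x\<close>)
  then show ?thesis using \<open>y * y = x\<close> by (simp only: rt_def)
qed

lemma rt_eq_0_iff [simp]: "rt x = 0 \<longleftrightarrow> x = 0"
proof
  assume "rt x = 0"
  then show "x = 0" using rt_mult_self[of x] by simp
next
  assume "x = 0"
  then have "rt x * rt x = 0" by simp
  then show "rt x = 0" by (simp del: rt_mult_self)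
qed

lemma rt_mult: "rt (x * y) = rt x * rt y"
proof -
  have "rt (x * y) * rt (x * y) = (rt x * rt x) * (rt y * rt y)" by simp
  also have "\<dots> = (rt x * rt y) * (rt x * rt y)" by (simp only: mult_ac)
  finally show ?thesis by (simp only: square_eq_iff)
qed

lemma det_sm: "det (sm a b c d e f) = a*b*c + a*f*f + b*e*e + c*d*(d::'a)"
  by (simp add: det_3 algebra_simps)

lemma det_outer_add_outer: "det (outer v + outer (w::'a^3)) = 0"
  by (simp add: outer_sm det_sm algebra_simps)

text \<open>The square root of the scalar moves into the vector, so the matrices
  \<open>outer v\<close> already include all their multiples.\<close>

lemma scale_outer: "mat_scale k (outer v) = outer (rt k *s (v::'a^'n))"
proof -
  have "k * (x * y) = rt k * x * (rt k * y)" for x y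
  proof -
    have "rt k * x * (rt k * y) = (rt k * rt k) * (x * y)" by (simp only: mult_ac)
    then show ?thesis by simp
  qed
  then show ?thesis by (simp add: vec_eq_iff mat_scale_def outer_def)
qed

lemma outer_eq_iff [simp]: "outer v = outer w \<longleftrightarrow> v = (w::'a^3)"
  by (auto simp: outer_sm vec_eq_iff forall_3)

lemma outer_eq_0_iff [simp]: "outer v = 0 \<longleftrightarrow> v = (0::'a^3)"
  by (auto simp: outer_sm vec_eq_iff forall_3)

lemma outer_0 [simp]: "outer (0::'a^3) = 0"
  by simp

lemma Sym3_rank_1_iff:
  assumes "X \<in> Sym3"
  shows "rank X \<le> 1 \<longleftrightarrow> (\<exists>v::'a^3. X = outer v)"
proof
  assume "rank X \<le> 1"
  from Sym3_rank_le_1[OF assms this] obtain k v where "X = mat_scale k (outer v)" .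
  then show "\<exists>v. X = outer v" unfolding scale_outer by blast
qed (auto intro: rank_outer_le[simplified])

text \<open>Splitting off \<open>outer\<close> of (r, d/r, e/r) with r^2 = a leaves a 2 x 2 block
  with diagonal s, t and zero determinant, which is the outer square of (\<open>rt s\<close>,
  \<open>rt t\<close>). A nonzero diagonal entry in another place is handled by renaming
  coordinates.\<close>

lemma singular_nonalternating:
  fixes a b c d e f :: 'a
  assumes "det (sm a b c d e f) = 0" and "\<not> (a = 0 \<and> b = 0 \<and> c = 0)"
  obtains v w where "sm a b c d e f = outer v + outer w"
proof -
  have gen: "\<exists>v w v' w' u u'. a = v * v + v' * v' \<and> b = w * w + w' * w' \<and> c = u * u + u' * u' \<and>
      d = v * w + v' * w' \<and> e = v * u + v' * u' \<and> f = w * u + w' * u'"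
    if a: "a \<noteq> 0" and det: "a * b * c + a * f * f + b * e * e + c * d * d = 0" for a b c d e f :: 'a
  proof -
    define r where "r = rt a"
    have r: "r \<noteq> 0" "a = r * r" using a by (simp_all add: r_def)
    define s where "s = b + (d/r)*(d/r)"
    define t where "t = c + (e/r)*(e/r)"
    \<comment> \<open>The determinant of the whole matrix is a times that of the remaining 2 x 2
      block.\<close>
    have "s * t = (f + (d/r)*(e/r)) * (f + (d/r)*(e/r))"
    proof -
      have "a * (s * t + (f + (d/r)*(e/r)) * (f + (d/r)*(e/r))) = a * b * c + a * f * f + b * e * e + c * d * d"
        using r(1) unfolding s_def t_def r(2) by (simp add: field_simps)
      then show ?thesis using a det by simp
    qed
    then have "(rt s * rt t) * (rt s * rt t) = (f + (d/r)*(e/r)) * (f + (d/r)*(e/r))"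
      by (metis rt_mult rt_mult_self)
    then have st: "rt s * rt t = f + (d/r)*(e/r)" by (simp only: square_eq_iff)
    show ?thesis
      by (rule exI[of _ r], rule exI[of _ "d/r"], rule exI[of _ 0], rule exI[of _ "rt s"],
          rule exI[of _ "e/r"], rule exI[of _ "rt t"])
        (use r st in \<open>simp add: s_def t_def add_ac\<close>)
  qed
  have det: "a * b * c + a * f * f + b * e * e + c * d * d = 0" using assms(1) by (simp add: det_sm)
  have "\<exists>v w v' w' u u'. a = v * v + v' * v' \<and> b = w * w + w' * w' \<and> c = u * u + u' * u' \<and>
      d = v * w + v' * w' \<and> e = v * u + v' * u' \<and> f = w * u + w' * u'"
  proof -
    consider "a \<noteq> 0" | "b \<noteq> 0" | "c \<noteq> 0" using assms(2) by blast
    then show ?thesis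
    proof cases
      case 1 then show ?thesis using gen det by blast
    next
      case 2
      have "b * a * c + b * e * e + a * f * f + c * d * d = 0" using det by (simp add: ac_simps)
      from gen[OF 2 this] obtain v w v' w' u u' where "b = v * v + v' * v'" "a = w * w + w' * w'"
        "c = u * u + u' * u'" "d = v * w + v' * w'" "f = v * u + v' * u'" "e = w * u + w' * u'" by blast
      then show ?thesis
        by (intro exI[of _ w] exI[of _ v] exI[of _ w'] exI[of _ v'] exI[of _ u] exI[of _ u'])
          (simp add: mult.commute)
    next
      case 3
      have "c * b * a + c * d * d + b * e * e + a * f * f = 0" using det by (simp add: ac_simps)
      from gen[OF 3 this] obtain v w v' w' u u' where "c = v * v + v' * v'" "b = w * w + w' * w'"
        "a = u * u + u' * u'" "f = v * w + v' * w'" "e = v * u + v' * u'" "d = w * u + w' * u'" by blast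
      then show ?thesis
        by (intro exI[of _ u] exI[of _ w] exI[of _ u'] exI[of _ w'] exI[of _ v] exI[of _ v'])
          (simp add: mult.commute)
    qed
  qed
  then obtain v w v' w' u u' where *: "a = v * v + v' * v'" "b = w * w + w' * w'" "c = u * u + u' * u'"
    "d = v * w + v' * w'" "e = v * u + v' * u'" "f = w * u + w' * u'" by blast
  have "sm a b c d e f = outer (vector [v, w, u]) + outer (vector [v', w', u'])"
    by (simp add: outer_sm *)
  then show thesis by (rule that)
qed

section \<open>Complete codes of minimum distance 2\<close>

text \<open>The differences are the elements of the subspace. Rank at least 2 means not of the form
  \<open>outer v\<close>, and rank at most 2 means zero determinant, so the two conditions say that
  2 is a lower bound and is attained.\<close>

lemma min_distance_subspace:
  fixes C :: "('a^3^3) set"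
  assumes C: "matsp.subspace C" "C \<subseteq> Sym3" "card C \<ge> 2"
  shows "min_distance C = 2 \<longleftrightarrow> (\<forall>v. outer v \<in> C \<longrightarrow> v = 0) \<and> (\<exists>X\<in>C. X \<noteq> 0 \<and> det X = 0)"
proof -
  let ?R = "rank ` (C - {0})"
  have "{rank (X - Y) | X Y. X \<in> C \<and> Y \<in> C \<and> X \<noteq> Y} = ?R"
  proof (intro equalityI subsetI)
    fix n assume "n \<in> {rank (X - Y) | X Y. X \<in> C \<and> Y \<in> C \<and> X \<noteq> Y}"
    then obtain X Y where "n = rank (X - Y)" "X \<in> C" "Y \<in> C" "X \<noteq> Y" by blast
    then show "n \<in> ?R" using matsp.subspace_diff[OF C(1)] by (simp del: mat_diff_eq_add)
  next
    fix n assume "n \<in> ?R"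
    then obtain X where "n = rank (X - 0)" "X \<in> C" "X \<noteq> 0" by auto
    then show "n \<in> {rank (X - Y) | X Y. X \<in> C \<and> Y \<in> C \<and> X \<noteq> Y}"
      using matsp.subspace_0[OF C(1)] by blast
  qed
  then have md: "min_distance C = Min ?R" by (simp add: min_distance_def)
  have "C - {0} \<noteq> {}"
  proof
    assume "C - {0} = {}"
    then have "card C \<le> card {0::'a^3^3}" by (intro card_mono) auto
    then show False using C(3) by simp
  qed
  then have ne: "?R \<noteq> {}" by simp
  have outer: "(\<forall>v. outer v \<in> C \<longrightarrow> v = 0) \<longleftrightarrow> (\<forall>X\<in>C - {0}. rank X \<ge> 2)"
  proof -
    have "rank X \<ge> 2 \<longleftrightarrow> \<not> (\<exists>v. X = outer v)" if "X \<in> C" for X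
      using Sym3_rank_1_iff[of X] that C(2) by force
    then show ?thesis by (metis DiffD1 DiffD2 DiffI outer_eq_0_iff singletonD singletonI)
  qed
  have det: "det X = 0 \<longleftrightarrow> rank X \<le> 2" for X :: "'a^3^3"
    using rank_less_iff_det[of X] by auto
  have "Min ?R = 2 \<longleftrightarrow> (2 \<in> ?R \<and> (\<forall>n\<in>?R. 2 \<le> n))"
    using ne by (simp add: Min_eq_iff)
  then show ?thesis
    unfolding md outer det by (auto simp: image_iff) (metis DiffI le_antisym singletonD)+
qed

text \<open>An extension of \<open>C\<close> keeps its singular element, so its minimum distance
  differs from 2 only if it contains a nonzero \<open>outer v\<close>; applied to the span of
  \<open>C\<close> and \<open>Y\<close> this gives the covering condition. Conversely, an extension
  with a new element \<open>Y\<close> also contains some \<open>Y + outer v\<close> from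
  \<open>C\<close>, hence the forbidden \<open>outer v\<close>.\<close>

lemma csrd_codes_2_iff:
  "(C :: ('a^3^3) set) \<in> csrd_codes 2 \<longleftrightarrow> matsp.subspace C \<and> C \<subseteq> Sym3 \<and>
    (\<forall>v. outer v \<in> C \<longrightarrow> v = 0) \<and> (\<exists>X\<in>C. X \<noteq> 0 \<and> det X = 0) \<and>
    (\<forall>Y\<in>Sym3. \<exists>v. Y + outer v \<in> C)" (is "?L \<longleftrightarrow> ?R")
proof -
  have card2: "card D \<ge> 2" if "matsp.subspace D" "X \<in> D" "X \<noteq> 0" for X and D :: "('a^3^3) set"
  proof -
    have "card {0, X} \<le> card D" using that by (intro card_mono) (auto simp: matsp.subspace_0)
    then show ?thesis using that(3) by simp
  qed
  show ?thesis
  proof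
    assume L: ?L
    then have C: "matsp.subspace C" "C \<subseteq> Sym3" "card C \<ge> 2" and md: "min_distance C = 2"
      and max: "\<And>D. srd_code D \<Longrightarrow> C \<subset> D \<Longrightarrow> min_distance D \<noteq> 2"
      by (auto simp: csrd_codes_def csrd_code_def srd_code_def)
    note * = md[unfolded min_distance_subspace[OF C]]
    have cover: "\<exists>v. Y + outer v \<in> C" if Y: "Y \<in> Sym3" for Y
    proof (cases "Y \<in> C")
      case True
      then show ?thesis by (intro exI[of _ 0]) simp
    next
      case False
      let ?D = "matsp.span (insert Y C)"
      have CD: "C \<subset> ?D" using False matsp.span_superset[of "insert Y C"] by blast
      have D: "matsp.subspace ?D" "?D \<subseteq> Sym3"
        using C(2) Y matsp.span_minimal[OF _ subspace_Sym3, of "insert Y C"] by simp_all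
      obtain X where X: "X \<in> C" "X \<noteq> 0" "det X = 0" using * by blast
      have D2: "card ?D \<ge> 2" using card2[OF D(1)] X CD by blast
      then have "min_distance ?D \<noteq> 2" using max CD D by (simp add: srd_code_def)
      then obtain v where v: "outer v \<in> ?D" "v \<noteq> 0"
        using min_distance_subspace[OF D D2] X CD by blast
      then obtain k where k: "outer v - mat_scale k Y \<in> C"
        unfolding matsp.span_insert matsp.span_eq_iff[THEN iffD2, OF C(1)] by blast
      then have "k \<noteq> 0" using * v(2) by auto
      \<comment> \<open>The coefficient \<open>k\<close> of \<open>Y\<close> is nonzero because
        \<open>C\<close> itself contains no nonzero \<open>outer v\<close>; its inverse is absorbed
        by \<open>rt\<close>.\<close>
      have "mat_scale (inverse k) (outer v + mat_scale k Y) \<in> C"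
        using k matsp.subspace_scale[OF C(1)] by simp
      then have "Y + outer (rt (inverse k) *s v) \<in> C"
        using \<open>k \<noteq> 0\<close> by (simp add: matsp.scale_right_distrib scale_outer add.commute)
      then show ?thesis by blast
    qed
    show ?R by (intro conjI C * ballI cover) (use * in simp_all)
  next
    assume R: ?R
    have C: "matsp.subspace C" "C \<subseteq> Sym3" and "\<exists>X\<in>C. X \<noteq> 0 \<and> det X = 0"
      and cover: "\<And>Y. Y \<in> Sym3 \<Longrightarrow> \<exists>v. Y + outer v \<in> C"
      using R by simp_all
    then obtain X where "X \<in> C" "X \<noteq> 0" by blast
    then have C2: "card C \<ge> 2" by (rule card2[OF C(1)])
    have "min_distance C = 2" using min_distance_subspace[OF C C2] R by simp
    moreover have False if D: "srd_code D" "C \<subset> D" "min_distance D = 2" for D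
    proof -
      have D': "matsp.subspace D" "D \<subseteq> Sym3" "card D \<ge> 2" using D by (auto simp: srd_code_def)
      obtain Y where Y: "Y \<in> D" "Y \<notin> C" using D(2) by blast
      then obtain v where v: "Y + outer v \<in> C" using cover D'(2) by blast
      then have "Y + (Y + outer v) \<in> D" using matsp.subspace_add[OF D'(1)] Y D(2) by blast
      then have "v = 0" using min_distance_subspace[OF D'] D(3) by simp
      then show False using v Y by simp
    qed
    ultimately show ?L using C C2 by (auto simp: csrd_codes_def csrd_code_def srd_code_def)
  qed
qed

lemma congr_csrd_codes_2:
  assumes "invertible A" and C: "(C :: ('a^3^3) set) \<in> csrd_codes 2"
  shows "congr A C \<in> csrd_codes 2"
proof -
  obtain B where AB: "A ** B = mat 1" "B ** A = mat 1"
    using assms(1) unfolding invertible_def by blast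
  have cancel: "A ** (B ** Y ** transpose B) ** transpose A = Y"
    "B ** (A ** Y ** transpose A) ** transpose B = Y" for Y
  proof -
    have "A ** (B ** Y ** transpose B) ** transpose A = (A ** B) ** Y ** transpose (A ** B)"
      "B ** (A ** Y ** transpose A) ** transpose B = (B ** A) ** Y ** transpose (B ** A)"
      by (simp_all only: matrix_mul_assoc matrix_transpose_mul)
    then show "A ** (B ** Y ** transpose B) ** transpose A = Y"
      "B ** (A ** Y ** transpose A) ** transpose B = Y" by (simp_all add: AB transpose_mat)
  qed
  have mem: "Y \<in> congr A C \<longleftrightarrow> B ** Y ** transpose B \<in> C" for Y
  proof
    assume "Y \<in> congr A C"
    then obtain X where "X \<in> C" "Y = A ** X ** transpose A" by (auto simp: congr_def)
    then show "B ** Y ** transpose B \<in> C" by (simp only: cancel)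
  next
    assume m: "B ** Y ** transpose B \<in> C"
    show "Y \<in> congr A C" unfolding congr_def by (rule image_eqI[OF _ m]) (simp only: cancel)
  qed
  have C': "matsp.subspace C" "C \<subseteq> Sym3" "\<And>v. outer v \<in> C \<Longrightarrow> v = 0"
    "\<exists>X\<in>C. X \<noteq> 0 \<and> det X = 0" "\<And>Y. Y \<in> Sym3 \<Longrightarrow> \<exists>v. Y + outer v \<in> C"
    using C by (simp_all add: csrd_codes_2_iff)
  have "v = 0" if "outer v \<in> congr A C" for v
  proof -
    have "B *v v = 0" using that by (intro C'(3)) (simp add: mem congr_outer)
    then have "A *v (B *v v) = 0" by simp
    then show ?thesis by (simp add: matrix_vector_mul_assoc AB)
  qed
  moreover have "\<exists>X\<in>congr A C. X \<noteq> 0 \<and> det X = 0"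
  proof -
    obtain X where X: "X \<in> C" "X \<noteq> 0" "det X = 0" using C'(4) by blast
    then have "A ** X ** transpose A \<noteq> 0" using cancel(2)[of X] by auto
    with X show ?thesis by (intro bexI[of _ "A ** X ** transpose A"]) (auto simp: congr_def det_mul)
  qed
  moreover have "\<exists>v. Y + outer v \<in> congr A C" if "Y \<in> Sym3" for Y
  proof -
    obtain w where "B ** Y ** transpose B + outer w \<in> C" using C'(5)[OF congr_Sym3[OF \<open>Y \<in> Sym3\<close>]] by blast
    then have "B ** (Y + outer (A *v w)) ** transpose B \<in> C"
      by (simp add: congr_add congr_outer matrix_vector_mul_assoc AB)
    then show ?thesis unfolding mem by blast
  qed
  ultimately show ?thesis
    unfolding csrd_codes_2_iff using subspace_congr[OF C'(1)] congr_subset_Sym3[OF C'(2)] by simp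
qed

lemma csrd_code_2_card_ge:
  assumes C: "(C :: ('a^3^3) set) \<in> csrd_codes 2"
  shows "card C \<ge> CARD('a) ^ 3"
proof -
  have "Sym3 \<subseteq> (\<lambda>(X, v). X + outer v) ` (C \<times> UNIV)"
  proof
    fix Y :: "'a^3^3" assume "Y \<in> Sym3"
    moreover have "\<forall>Y\<in>Sym3. \<exists>v. Y + outer v \<in> C" using C unfolding csrd_codes_2_iff by (elim conjE)
    ultimately obtain v where "Y + outer v \<in> C" by blast
    then show "Y \<in> (\<lambda>(X, v). X + outer v) ` (C \<times> UNIV)"
      by (intro image_eqI[of _ _ "(Y + outer v, v)"]) (auto simp: add.assoc)
  qed
  then have "card (Sym3 :: ('a^3^3) set) \<le> card ((\<lambda>(X, v). X + outer v) ` (C \<times> (UNIV :: ('a^3) set)))"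
    by (intro card_mono) auto
  also have "\<dots> \<le> card (C \<times> (UNIV :: ('a^3) set))" by (rule card_image_le) simp
  finally have "CARD('a) ^ 3 * CARD('a) ^ 3 \<le> card C * CARD('a) ^ 3"
    by (simp add: card_Sym3 card_cartesian_product power_add[symmetric])
  then show ?thesis by (rule mult_right_le_imp_le) simp
qed

text \<open>The map (X, v) to X + \<open>outer v\<close> goes between sets of size q^6, so covering
  is injectivity: no \<open>outer v + outer w\<close> with v \<noteq> w lies in \<open>C\<close>. By
  \<open>singular_nonalternating\<close> this bounds the singular elements; for the converse, a zero
  diagonal of such a sum forces v_i^2 = w_i^2.\<close>

lemma csrd_code_2_card_cube_iff:
  assumes C: "matsp.subspace C" "C \<subseteq> Sym3" "card C = CARD('a) ^ 3"
  shows "(C :: ('a^3^3) set) \<in> csrd_codes 2 \<longleftrightarrow>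
    (\<forall>a b c d e f. sm a b c d e f \<in> C \<longrightarrow> det (sm a b c d e f) = 0 \<longrightarrow> a = 0 \<and> b = 0 \<and> c = 0) \<and>
    (\<exists>X\<in>C. X \<noteq> 0 \<and> det X = 0)" (is "?L \<longleftrightarrow> ?R \<and> ?S")
proof -
  let ?g = "\<lambda>(X, v). X + outer (v::'a^3)"
  have card: "card (C \<times> (UNIV :: ('a^3) set)) = card (Sym3 :: ('a^3^3) set)"
    by (simp add: card_Sym3 card_cartesian_product C(3) power_add[symmetric])
  have sub: "?g ` (C \<times> UNIV) \<subseteq> Sym3"
    using C(2) by (auto intro!: matsp.subspace_add[OF subspace_Sym3])
  have cover: "(\<forall>Y\<in>Sym3. \<exists>v. Y + outer v \<in> C) \<longleftrightarrow> ?g ` (C \<times> UNIV) = Sym3"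
  proof -
    have "(\<exists>v. Y + outer v \<in> C) \<longleftrightarrow> Y \<in> ?g ` (C \<times> UNIV)" for Y
    proof
      assume "\<exists>v. Y + outer v \<in> C"
      then obtain v where "Y + outer v \<in> C" by blast
      then show "Y \<in> ?g ` (C \<times> UNIV)"
        by (intro image_eqI[of _ _ "(Y + outer v, v)"]) (auto simp: add.assoc)
    next
      assume "Y \<in> ?g ` (C \<times> UNIV)"
      then obtain X v where "Y = X + outer v" "X \<in> C" by auto
      then show "\<exists>v. Y + outer v \<in> C" by (intro exI[of _ v]) (simp add: add.assoc)
    qed
    then show ?thesis using sub by blast
  qed
  have inj: "?g ` (C \<times> UNIV) = Sym3 \<longleftrightarrow> inj_on ?g (C \<times> UNIV)"
    using sub card by (metis (no_types, lifting) card_image card_subset_eq eq_card_imp_inj_on finite)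
  have inj': "inj_on ?g (C \<times> UNIV) \<longleftrightarrow> (\<forall>v w. outer v + outer w \<in> C \<longrightarrow> v = w)" (is "_ \<longleftrightarrow> ?I")
  proof
    assume i: "inj_on ?g (C \<times> UNIV)"
    show ?I
    proof (intro allI impI)
      fix v w assume "outer v + outer w \<in> C"
      moreover have "?g (outer v + outer w, v) = ?g (0, w)" by (simp add: add_ac)
      ultimately show "v = w" using i matsp.subspace_0[OF C(1)] by (auto simp: inj_on_def)
    qed
  next
    assume I: ?I
    show "inj_on ?g (C \<times> UNIV)"
    proof (rule inj_onI, clarify)
      fix X v X' w assume XX: "X \<in> C" "X' \<in> C" and eq: "X + outer v = X' + outer w"
      have "outer v + outer w = (X + X') + ((X + outer v) + (X' + outer w))"
        by (simp add: add_ac)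
      then have "outer v + outer w = X + X'" by (simp only: eq mat_add_self add_0_right)
      then have "v = w" using I matsp.subspace_add[OF C(1)] XX by metis
      then show "X = X' \<and> v = w" using eq by simp
    qed
  qed
  have I_iff: "?I \<longleftrightarrow> ?R"
  proof
    assume I: ?I
    show ?R
    proof (intro allI impI)
      fix a b c d e f assume mem: "sm a b c d e f \<in> C" and det: "det (sm a b c d e f) = 0"
      show "a = 0 \<and> b = 0 \<and> c = 0"
      proof (rule ccontr)
        assume na: "\<not> ?thesis"
        from singular_nonalternating[OF det na] obtain v w where "sm a b c d e f = outer v + outer w" .
        moreover from this have "v = w" using I mem by metis
        ultimately show False using na by simp
      qed
    qed
  next
    assume R: ?R
    show ?I
    proof (intro allI impI)
      fix v w assume mem: "outer v + outer w \<in> C"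
      have "v $ 1 * v $ 1 + w $ 1 * w $ 1 = 0 \<and> v $ 2 * v $ 2 + w $ 2 * w $ 2 = 0 \<and>
          v $ 3 * v $ 3 + w $ 3 * w $ 3 = 0"
        by (rule R[rule_format, OF mem[unfolded outer_sm sm_add]
              det_outer_add_outer[of v w, unfolded outer_sm sm_add]])
      then show "v = w" by (simp add: vec_eq_iff forall_3)
    qed
  qed
  \<comment> \<open>The absence of rank-one matrices is the special case w = 0 of
    injectivity.\<close>
  have "\<forall>v. outer v \<in> C \<longrightarrow> v = 0" if ?I
    using that[THEN spec, THEN spec, of _ 0] by simp
  then show ?thesis unfolding csrd_codes_2_iff cover inj inj' I_iff using C by auto
qed

end

section \<open>Congruent codes\<close>

definition congruent_codes :: "('a::field^3^3) set \<Rightarrow> ('a^3^3) set \<Rightarrow> bool" where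
  "congruent_codes C D \<longleftrightarrow> (\<exists>A. invertible A \<and> D = congr A C)"

lemma congr_congr: "congr A (congr B C) = congr (A ** B) C"
  unfolding congr_def image_image by (simp add: matrix_mul_assoc matrix_transpose_mul)

lemma congr_mat_1 [simp]: "congr (mat 1) C = C"
  by (simp add: congr_def transpose_mat)

lemma congruent_codes_refl: "congruent_codes C C"
  unfolding congruent_codes_def
  by (intro exI[of _ "mat 1"] conjI invertible_det_nz[THEN iffD2]) simp_all

lemma congruent_codes_trans:
  "congruent_codes C D \<Longrightarrow> congruent_codes D E \<Longrightarrow> congruent_codes C E"
  unfolding congruent_codes_def using invertible_mult congr_congr by metis

lemma congruent_codes_sym:
  assumes "congruent_codes C D" shows "congruent_codes D C"
proof -
  obtain A where A: "invertible A" "D = congr A C"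
    using assms by (auto simp: congruent_codes_def)
  then obtain B where B: "A ** B = mat 1" "B ** A = mat 1" unfolding invertible_def by blast
  then have "invertible B" unfolding invertible_def by blast
  moreover have "C = congr B D" by (simp add: A congr_congr B)
  ultimately show ?thesis unfolding congruent_codes_def by blast
qed

lemma congruent_codes_equivalent: "congruent_codes C D \<Longrightarrow> code_equivalent C D"
  unfolding congruent_codes_def using code_equivalent_congr by blast

lemma congruent_codes_no_outer:
  assumes "congruent_codes C D" and C: "\<And>v. outer v \<in> C \<Longrightarrow> v = 0" and v: "outer v \<in> D"
  shows "v = 0"
proof -
  obtain A where A: "invertible A" "C = congr A D"
    using congruent_codes_sym[OF assms(1)] by (auto simp: congruent_codes_def)
  then obtain B where B: "B ** A = mat 1" unfolding invertible_def by blast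
  have "outer (A *v v) \<in> C"
    unfolding A(2) congr_def by (rule image_eqI[OF _ v]) (simp add: congr_outer)
  then have "A *v v = 0" by (rule C)
  then have "B *v (A *v v) = 0" by simp
  then show ?thesis by (simp add: matrix_vector_mul_assoc B)
qed

section \<open>Quadratic forms and codes of codimension two\<close>

type_synonym 'a qform = "'a \<times> 'a \<times> 'a \<times> 'a \<times> 'a \<times> 'a"

text \<open>The form \<open>a x\<^sup>2 + b y\<^sup>2 + c z\<^sup>2 + d x y + e x z + f y z\<close>, viewed as a linear functional on
  symmetric matrices; its value at \<open>v\<close> is recovered as the value of the functional at
  \<open>v v\<^sup>T\<close>.\<close>

fun lf :: "'a::field qform \<Rightarrow> 'a^3^3 \<Rightarrow> 'a" where
  "lf (a, b, c, d, e, f) X =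
    a * X$1$1 + b * X$2$2 + c * X$3$3 + d * X$1$2 + e * X$1$3 + f * X$2$3"

abbreviation qf :: "'a::field qform \<Rightarrow> 'a^3 \<Rightarrow> 'a" where
  "qf Q v \<equiv> lf Q (outer v)"

definition pencil_code :: "'a::field qform \<Rightarrow> 'a qform \<Rightarrow> ('a^3^3) set" where
  "pencil_code Q R = {X \<in> Sym3. lf Q X = 0 \<and> lf R X = 0}"

lemma lf_add: "lf Q (X + Y) = lf Q X + lf Q Y"
  by (cases Q) (simp add: algebra_simps)

lemma lf_scale: "lf Q (mat_scale r X) = r * lf Q X"
  by (cases Q) (simp add: mat_scale_def algebra_simps)

lemma lf_0 [simp]: "lf Q 0 = 0"
  by (cases Q) simp

lemma subspace_pencil_code: "matsp.subspace (pencil_code Q R)"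
  by (auto simp: matsp.subspace_def pencil_code_def lf_add lf_scale
      matsp.subspace_0[OF subspace_Sym3] matsp.subspace_add[OF subspace_Sym3]
      matsp.subspace_scale[OF subspace_Sym3])

text \<open>Forms are pulled back while matrices are pushed forward: \<open>A\<close> carries the
  code of the substituted forms to the original code, and the claim is the inverse
  congruence.\<close>

lemma pencil_code_congruent:
  assumes "invertible A"
    and "\<And>X. X \<in> Sym3 \<Longrightarrow> lf Q (A ** X ** transpose A) = lf Q' X"
    and "\<And>X. X \<in> Sym3 \<Longrightarrow> lf R (A ** X ** transpose A) = lf R' X"
  shows "congruent_codes (pencil_code Q R) (pencil_code Q' R')"
proof -
  obtain B where AB: "A ** B = mat 1" "B ** A = mat 1"
    using assms(1) unfolding invertible_def by blast
  have cancel: "A ** (B ** Y ** transpose B) ** transpose A = Y" for Y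
  proof -
    have "A ** (B ** Y ** transpose B) ** transpose A = (A ** B) ** Y ** transpose (A ** B)"
      by (simp only: matrix_mul_assoc matrix_transpose_mul)
    then show ?thesis by (simp add: AB transpose_mat)
  qed
  have "pencil_code Q R = congr A (pencil_code Q' R')"
  proof (intro equalityI subsetI)
    fix Y assume Y: "Y \<in> pencil_code Q R"
    then have "B ** Y ** transpose B \<in> Sym3" by (simp add: pencil_code_def congr_Sym3)
    moreover from this have "B ** Y ** transpose B \<in> pencil_code Q' R'"
      using Y by (simp add: pencil_code_def assms(2,3)[symmetric] cancel)
    ultimately show "Y \<in> congr A (pencil_code Q' R')"
      unfolding congr_def by (intro image_eqI[of _ _ "B ** Y ** transpose B"]) (simp_all add: cancel)
  next
    fix Y assume "Y \<in> congr A (pencil_code Q' R')"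
    then show "Y \<in> pencil_code Q R"
      by (auto simp: congr_def pencil_code_def assms(2,3) congr_Sym3)
  qed
  then have "congruent_codes (pencil_code Q' R') (pencil_code Q R)"
    using assms(1) by (auto simp: congruent_codes_def)
  then show ?thesis by (rule congruent_codes_sym)
qed

text \<open>The coefficients of the form v \<mapsto> Q(A v), where A has the rows x, y, z. The
  factors 2 keep \<open>lf_pullback\<close> valid over every field; they vanish in
  \<open>char2_field\<close>.\<close>

fun pullback :: "'a \<Rightarrow> 'a \<Rightarrow> 'a \<Rightarrow> 'a \<Rightarrow> 'a \<Rightarrow> 'a \<Rightarrow> 'a \<Rightarrow> 'a \<Rightarrow> 'a \<Rightarrow> 'a::field qform \<Rightarrow> 'a qform"
  where "pullback x1 x2 x3 y1 y2 y3 z1 z2 z3 (a, b, c, d, e, f) =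
    (a*x1*x1 + b*y1*y1 + c*z1*z1 + d*x1*y1 + e*x1*z1 + f*y1*z1,
     a*x2*x2 + b*y2*y2 + c*z2*z2 + d*x2*y2 + e*x2*z2 + f*y2*z2,
     a*x3*x3 + b*y3*y3 + c*z3*z3 + d*x3*y3 + e*x3*z3 + f*y3*z3,
     2*a*x1*x2 + 2*b*y1*y2 + 2*c*z1*z2 + d*(x1*y2 + x2*y1) + e*(x1*z2 + x2*z1) + f*(y1*z2 + y2*z1),
     2*a*x1*x3 + 2*b*y1*y3 + 2*c*z1*z3 + d*(x1*y3 + x3*y1) + e*(x1*z3 + x3*z1) + f*(y1*z3 + y3*z1),
     2*a*x2*x3 + 2*b*y2*y3 + 2*c*z2*z3 + d*(x2*y3 + x3*y2) + e*(x2*z3 + x3*z2) + f*(y2*z3 + y3*z2))"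

lemma lf_pullback:
  assumes "X \<in> Sym3"
  shows "lf Q (m3 x1 x2 x3 y1 y2 y3 z1 z2 z3 ** X ** transpose (m3 x1 x2 x3 y1 y2 y3 z1 z2 z3))
    = lf (pullback x1 x2 x3 y1 y2 y3 z1 z2 z3 Q) X"
proof -
  obtain a b c d e f where X: "X = sm a b c d e f" using assms by (rule Sym3_cases)
  show ?thesis
    by (cases Q) (simp add: X congr_m3_sm Let_def algebra_simps)
qed

lemma pencil_code_pullback:
  assumes "invertible (m3 x1 x2 x3 y1 y2 y3 z1 z2 z3)"
  shows "congruent_codes (pencil_code Q R) (pencil_code
    (pullback x1 x2 x3 y1 y2 y3 z1 z2 z3 Q) (pullback x1 x2 x3 y1 y2 y3 z1 z2 z3 R))"
  by (rule pencil_code_congruent[OF assms]) (simp_all only: lf_pullback)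

lemma card_zeros_pullback:
  fixes Q :: "'a::{field,finite} qform"
  assumes "invertible (m3 x1 x2 x3 y1 y2 y3 z1 z2 z3)"
  shows "card {v. qf (pullback x1 x2 x3 y1 y2 y3 z1 z2 z3 Q) v = 0} \<le> card {v. qf Q v = 0}"
proof (rule card_inj_on_le)
  let ?A = "m3 x1 x2 x3 y1 y2 y3 z1 z2 z3"
  obtain B where "B ** ?A = mat 1" using assms unfolding invertible_def by blast
  then have "B *v (?A *v v) = v" for v by (simp add: matrix_vector_mul_assoc)
  then show "inj_on (\<lambda>v. ?A *v v) {v. qf (pullback x1 x2 x3 y1 y2 y3 z1 z2 z3 Q) v = 0}"
    by (intro inj_on_inverseI[of _ "\<lambda>v. B *v v"]) simp
qed (auto simp: lf_pullback[symmetric] congr_outer)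

context char2_field
begin

lemma pencil_code_scale_add:
  assumes "k \<noteq> (0::'a)"
  shows "pencil_code (a, b, c, d, e, f) (a', b', c', d', e', f') = pencil_code (a, b, c, d, e, f)
    (k*a' + l*a, k*b' + l*b, k*c' + l*c, k*d' + l*d, k*e' + l*e, k*f' + l*f)"
proof -
  have "lf (k*a' + l*a, k*b' + l*b, k*c' + l*c, k*d' + l*d, k*e' + l*e, k*f' + l*f) X =
      k * lf (a', b', c', d', e', f') X + l * lf (a, b, c, d, e, f) X" for X
    by (simp add: algebra_simps)
  then show ?thesis using assms by (auto simp: pencil_code_def)
qed

lemma pencil_code_swap: "pencil_code Q R = pencil_code R Q"
  by (auto simp: pencil_code_def)

text \<open>The vector (f, e, d) is orthogonal to everything under the polar form, which is
  alternating in three variables and therefore degenerate. In its direction the quadratic form is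
  additive.\<close>

lemma qf_add_nucleus:
  fixes a b c d e f :: 'a
  shows "qf (a, b, c, d, e, f) (v + t *s vector [f, e, d]) =
    qf (a, b, c, d, e, f) v + t * t * qf (a, b, c, d, e, f) (vector [f, e, d])"
  by (simp add: outer_def algebra_simps)

text \<open>Every line v + t u contains a zero, at t = \<open>rt (qf Q v / qf Q u)\<close>.
  Recording that zero together with t is injective in v, so q^3 is at most q times the number of
  zeros.\<close>

lemma card_zeros_ge:
  fixes Q :: "'a qform"
  assumes u: "qf Q u \<noteq> 0" and add: "\<And>v t. qf Q (v + t *s u) = qf Q v + t * t * qf Q u"
  shows "CARD('a) ^ 2 \<le> card {v. qf Q v = 0}"
proof -
  define t where "t v = rt (qf Q v / qf Q u)" for v
  let ?g = "\<lambda>v. (v + t v *s u, t v)"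
  have "inj ?g"
  proof (rule injI)
    fix v w assume "?g v = ?g w"
    then have "v + t v *s u = w + t w *s u" and tt: "t v = t w" by auto
    then have "v + t w *s u = w + t w *s u" by (simp only: tt)
    then show "v = w" by (rule add_right_imp_eq)
  qed
  moreover have "range ?g \<subseteq> {v. qf Q v = 0} \<times> UNIV"
    using u by (auto simp: add t_def)
  ultimately have "CARD('a^3) \<le> card ({v. qf Q v = 0} \<times> (UNIV :: 'a set))"
    by (intro card_inj_on_le) auto
  then have "CARD('a) ^ 2 * CARD('a) \<le> card {v. qf Q v = 0} * CARD('a)"
    by (simp add: card_cartesian_product power2_eq_square power3_eq_cube)
  then show ?thesis by (rule mult_right_le_imp_le) simp
qed

text \<open>If the form did not vanish at the nucleus, \<open>card_zeros_ge\<close> would give q^2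
  zeros. If the nucleus were the vector 0, the form would be additive: a nonzero value again gives
  q^2 zeros, and otherwise all q^3 vectors are zeros.\<close>

lemma nucleus_singular:
  fixes a b c d e f :: 'a
  assumes "card {v. qf (a, b, c, d, e, f) v = 0} < CARD('a) ^ 2"
  shows "vector [f, e, d] \<noteq> (0::'a^3)" and "qf (a, b, c, d, e, f) (vector [f, e, d]) = 0"
proof -
  show *: "qf (a, b, c, d, e, f) (vector [f, e, d]) = 0"
    using card_zeros_ge[OF _ qf_add_nucleus] assms by (meson not_less)
  show "vector [f, e, d] \<noteq> (0::'a^3)"
  proof
    assume "vector [f, e, d] = (0::'a^3)"
    then have z: "f = 0" "e = 0" "d = 0" by (simp_all add: vec_eq_iff forall_3)
    have "qf (a, b, c, d, e, f) u = 0" for u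
    proof (rule ccontr)
      assume "qf (a, b, c, d, e, f) u \<noteq> 0"
      then have "CARD('a) ^ 2 \<le> card {v. qf (a, b, c, d, e, f) v = 0}"
        by (rule card_zeros_ge) (simp add: z outer_def algebra_simps)
      then show False using assms by simp
    qed
    then have "{v. qf (a, b, c, d, e, f) v = 0} = UNIV" by blast
    then have "CARD('a) ^ 3 < CARD('a) ^ 2" using assms by simp
    moreover have "CARD('a) ^ 2 \<le> CARD('a) ^ 3" by (rule power_increasing) (auto simp: Suc_le_eq)
    ultimately show False by simp
  qed
qed

lemma card_ge_2: "CARD('a) \<ge> 2"
proof -
  have "card {0, 1::'a} \<le> CARD('a)" by (intro card_mono) auto
  then show ?thesis by simp
qed

text \<open>With fewer than q^2 zeros the nucleus is a nonzero zero; otherwise there are at least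
  q^2 > 1 zeros.\<close>

lemma qf_isotropic:
  fixes Q :: "'a qform"
  obtains v where "v \<noteq> 0" "qf Q v = 0"
proof -
  obtain a b c d e f where Q: "Q = (a, b, c, d, e, f)" by (cases Q)
  show thesis
  proof (cases "card {v. qf Q v = 0} < CARD('a) ^ 2")
    case True
    then show thesis using nucleus_singular[of a b c d e f] that Q by blast
  next
    case False
    moreover have "2 * 2 \<le> CARD('a) * CARD('a)" using card_ge_2 by (intro mult_mono) auto
    ultimately have "1 < card {v. qf Q v = 0}" by (simp add: power2_eq_square)
    then have "\<not> {v. qf Q v = 0} \<subseteq> {0}" using card_mono[of "{0}" "{v. qf Q v = 0}"] by fastforce
    then show thesis using that by blast
  qed
qed

text \<open>The values of (Q, R) at v must match those at \<open>Y\<close> up to a scalar, since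
  \<open>rt\<close> absorbs scalars. Proportionality is a single quadratic equation, solvable by
  \<open>qf_isotropic\<close>, and the values at v are not both zero by assumption.\<close>

lemma pencil_code_covers:
  fixes Q R :: "'a qform"
  assumes no: "\<And>v. outer v \<in> pencil_code Q R \<Longrightarrow> v = 0" and Y: "Y \<in> Sym3"
  shows "\<exists>v. Y + outer v \<in> pencil_code Q R"
proof (cases "lf Q Y = 0 \<and> lf R Y = 0")
  case True
  then have "Y + outer 0 \<in> pencil_code Q R" using Y by (simp add: pencil_code_def)
  then show ?thesis by blast
next
  case False
  obtain a b c d e f where Q: "Q = (a, b, c, d, e, f)" by (cases Q)
  obtain a' b' c' d' e' f' where R: "R = (a', b', c', d', e', f')" by (cases R)
  define s t where "s = lf Q Y" and "t = lf R Y"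
  \<comment> \<open>The member of the pencil that vanishes on \<open>Y\<close>.\<close>
  define P where "P = (t*a + s*a', t*b + s*b', t*c + s*c', t*d + s*d', t*e + s*e', t*f + s*f')"
  have P: "lf P X = t * lf Q X + s * lf R X" for X
    by (simp add: P_def Q R algebra_simps)
  obtain v where v: "v \<noteq> 0" "qf P v = 0" by (rule qf_isotropic)
  have eq: "t * qf Q v = s * qf R v" using v(2) by (simp add: P)
  have nz: "\<not> (qf Q v = 0 \<and> qf R v = 0)" using no[of v] v(1) by (auto simp: pencil_code_def)
  have "\<exists>l. l \<noteq> 0 \<and> qf Q v = l * s \<and> qf R v = l * t"
  proof (cases "s = 0")
    case True
    then have "t \<noteq> 0" using False by (simp add: s_def t_def)
    with True eq nz show ?thesis by (intro exI[of _ "qf R v / t"]) simp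
  next
    case False
    with eq nz have "qf Q v \<noteq> 0" by auto
    with False eq show ?thesis by (intro exI[of _ "qf Q v / s"]) (simp add: field_simps)
  qed
  then obtain l where l: "l \<noteq> 0" "qf Q v = l * s" "qf R v = l * t" by blast
  have "lf Q (Y + mat_scale (1/l) (outer v)) = 0" "lf R (Y + mat_scale (1/l) (outer v)) = 0"
    using l by (simp_all add: lf_add lf_scale s_def t_def)
  then have "Y + outer (rt (1/l) *s v) \<in> pencil_code Q R"
    using matsp.subspace_add[OF subspace_Sym3 Y outer_in_Sym3]
    by (simp add: pencil_code_def scale_outer)
  then show ?thesis by blast
qed

text \<open>For a fixed \<open>Y\<close> outside \<open>D\<close>, the scalar \<open>l X\<close>
  with \<open>X + mat_scale (l X) Y\<close> in \<open>D\<close> is unique, hence linear in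
  \<open>X\<close>, and it vanishes exactly on \<open>D\<close>.\<close>

lemma hyperplane_eq_kernel:
  fixes D :: "('a^3^3) set"
  assumes D: "matsp.subspace D" "D \<subseteq> Sym3" "card D = CARD('a) ^ 5"
  obtains Q where "D = {X \<in> Sym3. lf Q X = 0}"
proof -
  have "CARD('a) ^ 5 < CARD('a) ^ 6" using card_ge_2 by (intro power_strict_increasing) auto
  then obtain Y where Y: "Y \<in> Sym3" "Y \<notin> D" using D(2,3) card_Sym3[where 'a='a] by (metis less_irrefl subset_antisym subsetI)
  have "matsp.span (insert Y D) \<subseteq> Sym3"
    using matsp.span_minimal[OF _ subspace_Sym3, of "insert Y D"] Y D by simp
  moreover have "card (matsp.span (insert Y D)) = card (Sym3 :: ('a^3^3) set)"
    using card_span_insert[OF D(1) Y(2)] D(3) by (simp add: card_Sym3 eval_nat_numeral)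
  ultimately have span: "matsp.span (insert Y D) = Sym3" by (intro card_subset_eq) auto
  have "\<exists>k. X + mat_scale k Y \<in> D" if "X \<in> Sym3" for X
  proof -
    have "X \<in> matsp.span (insert Y D)" using that span by simp
    then show ?thesis
      unfolding matsp.span_insert matsp.span_eq_iff[THEN iffD2, OF D(1)] by auto
  qed
  then obtain l where l: "\<And>X. X \<in> Sym3 \<Longrightarrow> X + mat_scale (l X) Y \<in> D" by metis
  have uniq: "k = l X" if X: "X \<in> Sym3" and k: "X + mat_scale k Y \<in> D" for X k
  proof (rule ccontr)
    assume ne: "k \<noteq> l X"
    have "(X + mat_scale k Y) + (X + mat_scale (l X) Y) \<in> D"
      using matsp.subspace_add[OF D(1) k l[OF X]] .
    moreover have "(X + mat_scale k Y) + (X + mat_scale (l X) Y) = mat_scale (k + l X) Y"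
      by (simp add: matsp.scale_left_distrib add_ac)
    ultimately have "mat_scale (1 / (k + l X)) (mat_scale (k + l X) Y) \<in> D"
      using matsp.subspace_scale[OF D(1)] by metis
    then show False using ne Y(2) by simp
  qed
  have l_add: "l (X + X') = l X + l X'" if "X \<in> Sym3" "X' \<in> Sym3" for X X'
  proof (rule uniq[symmetric])
    have "(X + mat_scale (l X) Y) + (X' + mat_scale (l X') Y) \<in> D"
      using matsp.subspace_add[OF D(1) l[OF that(1)] l[OF that(2)]] .
    then show "X + X' + mat_scale (l X + l X') Y \<in> D"
      by (simp add: matsp.scale_left_distrib add_ac)
  qed (use that matsp.subspace_add[OF subspace_Sym3] in blast)
  have l_scale: "l (mat_scale r X) = r * l X" if "X \<in> Sym3" for r X
  proof (rule uniq[symmetric])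
    have "mat_scale r (X + mat_scale (l X) Y) \<in> D"
      using matsp.subspace_scale[OF D(1) l[OF that]] .
    then show "mat_scale r X + mat_scale (r * l X) Y \<in> D"
      by (simp add: matsp.scale_right_distrib)
  qed (use that matsp.subspace_scale[OF subspace_Sym3] in blast)
  define Q where "Q = (l (sm 1 0 0 0 0 0), l (sm 0 1 0 0 0 0), l (sm 0 0 1 0 0 0),
    l (sm 0 0 0 1 0 0), l (sm 0 0 0 0 1 0), l (sm 0 0 0 0 0 1))"
  have lf: "lf Q X = l X" if "X \<in> Sym3" for X
  proof -
    obtain a b c d e f where X: "X = sm a b c d e f" using \<open>X \<in> Sym3\<close> by (rule Sym3_cases)
    have X': "X = mat_scale a (sm 1 0 0 0 0 0) + (mat_scale b (sm 0 1 0 0 0 0) +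
       (mat_scale c (sm 0 0 1 0 0 0) + (mat_scale d (sm 0 0 0 1 0 0) +
       (mat_scale e (sm 0 0 0 0 1 0) + mat_scale f (sm 0 0 0 0 0 1)))))"
      by (simp add: X)
    have "l X = a * l (sm 1 0 0 0 0 0) + (b * l (sm 0 1 0 0 0 0) + (c * l (sm 0 0 1 0 0 0) +
       (d * l (sm 0 0 0 1 0 0) + (e * l (sm 0 0 0 0 1 0) + f * l (sm 0 0 0 0 0 1)))))"
      unfolding X' by (simp only: l_add l_scale sm_in_Sym3
          matsp.subspace_add[OF subspace_Sym3] matsp.subspace_scale[OF subspace_Sym3])
    then show ?thesis by (simp add: Q_def X mult.commute add_ac)
  qed
  have "D = {X \<in> Sym3. lf Q X = 0}"
  proof (intro equalityI subsetI)
    fix X assume X: "X \<in> D"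
    then have "0 = l X" using D(2) by (intro uniq) auto
    then show "X \<in> {X \<in> Sym3. lf Q X = 0}" using X D(2) lf by auto
  next
    fix X assume "X \<in> {X \<in> Sym3. lf Q X = 0}"
    then show "X \<in> D" using l[of X] lf[of X] by simp
  qed
  then show thesis by (rule that)
qed

text \<open>\<open>C\<close> is the intersection of the hyperplanes spanned by \<open>C\<close> with
  \<open>Y\<close> and by \<open>C\<close> with \<open>Z\<close>, where \<open>Z\<close> avoids the
  first of them.\<close>

lemma subspace_card_4_eq_pencil_code:
  fixes C :: "('a^3^3) set"
  assumes C: "matsp.subspace C" "C \<subseteq> Sym3" "card C = CARD('a) ^ 4"
  obtains Q R where "C = pencil_code Q R"
proof -
  have lt: "CARD('a) ^ 4 < CARD('a) ^ 6" "CARD('a) ^ 5 < CARD('a) ^ 6"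
    using card_ge_2 by (auto intro!: power_strict_increasing)
  then have "C \<noteq> Sym3" using C(3) card_Sym3[where 'a='a] by auto
  then obtain Y where Y: "Y \<in> Sym3" "Y \<notin> C" using C(2) by blast
  let ?D = "matsp.span (insert Y C)"
  have D: "matsp.subspace ?D" "?D \<subseteq> Sym3" "card ?D = CARD('a) ^ 5"
    using matsp.span_minimal[OF _ subspace_Sym3, of "insert Y C"] Y C card_span_insert[OF C(1) Y(2)]
    by (simp_all add: eval_nat_numeral)
  then have "?D \<noteq> Sym3" using lt card_Sym3[where 'a='a] by auto
  then obtain Z where Z: "Z \<in> Sym3" "Z \<notin> ?D" using D(2) by blast
  have CD: "C \<subseteq> ?D" using matsp.span_superset[of "insert Y C"] by blast
  then have ZC: "Z \<notin> C" using Z by blast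
  let ?E = "matsp.span (insert Z C)"
  have E: "matsp.subspace ?E" "?E \<subseteq> Sym3" "card ?E = CARD('a) ^ 5"
    using matsp.span_minimal[OF _ subspace_Sym3, of "insert Z C"] Z C card_span_insert[OF C(1) ZC]
    by (simp_all add: eval_nat_numeral)
  have CE: "C \<subseteq> ?E" using matsp.span_superset[of "insert Z C"] by blast
  have "X \<in> C" if X: "X \<in> ?D" "X \<in> ?E" for X
  proof -
    obtain k where k: "X + mat_scale k Z \<in> C"
      using X(2) unfolding matsp.span_insert[of Z] matsp.span_eq_iff[THEN iffD2, OF C(1)] by auto
    then have "X + (X + mat_scale k Z) \<in> ?D" using matsp.subspace_add[OF D(1) X(1)] CD by blast
    then have kZ: "mat_scale k Z \<in> ?D" by simp
    have "k = 0"
    proof (rule ccontr)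
      assume "k \<noteq> 0"
      then have "mat_scale (1/k) (mat_scale k Z) = Z" by simp
      then show False using matsp.subspace_scale[OF D(1) kZ] Z(2) by metis
    qed
    then show ?thesis using k by simp
  qed
  then have CDE: "C = ?D \<inter> ?E" using CD CE by blast
  obtain Q where Q: "?D = {X \<in> Sym3. lf Q X = 0}" by (rule hyperplane_eq_kernel[OF D])
  obtain R where R: "?E = {X \<in> Sym3. lf R X = 0}" by (rule hyperplane_eq_kernel[OF E])
  have "?D \<inter> ?E = pencil_code Q R" unfolding Q R pencil_code_def by blast
  with CDE have "C = pencil_code Q R" by (rule trans)
  then show thesis by (rule that)
qed

section \<open>Classification of the codes of dimension 4\<close>

text \<open>The map u^2 + u takes the value 0 at both 0 and 1; not being injective on a finite set,
  it misses a value.\<close>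

lemma artin_schreier_nonempty: obtains c :: 'a where "\<And>u. u * u + u \<noteq> c"
proof -
  have "\<not> inj (\<lambda>u::'a. u * u + u)"
  proof
    assume "inj (\<lambda>u::'a. u * u + u)"
    then have "(0::'a) = 1" by (rule injD) simp
    then show False by simp
  qed
  then have "\<not> surj (\<lambda>u::'a. u * u + u)" using finite_UNIV_surj_inj[of "\<lambda>u::'a. u * u + u"] by auto
  then obtain c :: 'a where "c \<notin> range (\<lambda>u. u * u + u)" by blast
  then have "u * u + u \<noteq> c" for u by blast
  then show thesis by (rule that)
qed

text \<open>The additive map u^2 + u has kernel {0, 1}, so its image \<open>S\<close> contains at
  least half of the field. If c + c' were outside \<open>S\<close>, the cosets of 0, c and c' would
  be disjoint, and three times the size of \<open>S\<close> would fit into the field.\<close>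

lemma artin_schreier_index_2:
  fixes c c' :: 'a
  assumes c: "\<And>u. u * u + u \<noteq> c" and c': "\<And>u. u * u + u \<noteq> c'"
  obtains u where "u * u + u = c + c'"
proof (rule ccontr)
  assume "\<not> thesis"
  then have cc: "u * u + u \<noteq> c + c'" for u using that by blast
  define P where "P u = u * u + u" for u :: 'a
  define S where "S = range P"
  have P_add: "P (u + v) = P u + P v" for u v by (simp add: P_def algebra_simps)
  have P_neq: "P u \<noteq> c" "P u \<noteq> c'" "P u \<noteq> c + c'" for u
    using c c' cc by (auto simp: P_def)
  define g where "g = inv_into UNIV P"
  have g: "P (g s) = s" if "s \<in> S" for s
    using that by (simp add: S_def g_def f_inv_into_f)
  have "UNIV \<subseteq> g ` S \<union> (\<lambda>s. g s + 1) ` S"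
  proof
    fix u :: 'a
    have "P (u + g (P u)) = 0" using g[of "P u"] by (simp add: P_add S_def)
    then have "(u + g (P u)) * (u + g (P u) + 1) = 0" by (simp add: P_def algebra_simps)
    then have "u = g (P u) \<or> u + g (P u) + 1 = 0" by simp
    then have "u = g (P u) \<or> u = g (P u) + 1" by (simp add: add.assoc)
    moreover have "P u \<in> S" by (simp add: S_def)
    ultimately show "u \<in> g ` S \<union> (\<lambda>s. g s + 1) ` S" by blast
  qed
  then have "CARD('a) \<le> card (g ` S \<union> (\<lambda>s. g s + 1) ` S)" by (intro card_mono) auto
  also have "\<dots> \<le> card (g ` S) + card ((\<lambda>s. g s + 1) ` S)" by (rule card_Un_le)
  also have "\<dots> \<le> card S + card S" by (intro add_mono card_image_le) auto
  finally have le: "CARD('a) \<le> card S + card S" .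
  have cosets: "card ((+) k ` S) = card S" for k by (intro card_image) auto
  have d: "k + P u \<noteq> k' + P v" if "\<And>w. P w \<noteq> k + k'" for k k' u v
  proof
    assume "k + P u = k' + P v"
    moreover have "P u + P v = (k + k') + ((k + P u) + (k' + P v))" by (simp add: add_ac)
    ultimately have "P u + P v = k + k'" by (simp only: add_self add_0_right)
    then show False using that[of "u + v"] by (simp add: P_add)
  qed
  have disj: "S \<inter> (+) c ` S = {}" "(S \<union> (+) c ` S) \<inter> (+) c' ` S = {}"
    using d[of 0 c] d[of c' 0] d[of c' c] P_neq by (auto simp: S_def add.commute)
  have "card (S \<union> (+) c ` S \<union> (+) c' ` S) = card S + card S + card S"
    using disj by (simp add: card_Un_disjoint cosets)
  then have "card S + card S + card S \<le> CARD('a)"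
    by (metis card_mono finite subset_UNIV)
  moreover have "card S > 0" by (simp add: S_def card_gt_0_iff)
  ultimately show False using le by simp
qed

text \<open>Two of the q + 1 members share only the zero vector. If each had at least q^2 zeros,
  there would be (q + 1)(q^2 - 1) nonzero vectors, more than q^3 - 1.\<close>

lemma pencil_has_small_member:
  fixes f g :: "'a^3 \<Rightarrow> 'a"
  assumes zero: "f 0 = 0" "g 0 = 0" and no: "\<And>v. f v = 0 \<Longrightarrow> g v = 0 \<Longrightarrow> v = 0"
  shows "(\<exists>t. card {v. f v + t * g v = 0} < CARD('a) ^ 2) \<or> card {v. g v = 0} < CARD('a) ^ 2"
proof (rule ccontr)
  assume neg: "\<not> ?thesis"
  define q where "q = CARD('a)"
  have q: "q \<ge> 2" using card_ge_2 by (simp add: q_def)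
  \<comment> \<open>\<open>n\<close> is q^2 - 1, the lower bound after removing the vector 0; the
    successor equation avoids truncated subtraction.\<close>
  obtain n where n: "q * q = Suc n" using q by (metis mult_is_0 not0_implies_Suc not_numeral_le_zero)
  define Z where "Z t = {v. f v + t * g v = 0} - {0}" for t
  define Z' where "Z' = {v. g v = 0} - {0}"
  have Z: "n \<le> card (Z t)" for t
  proof -
    have "q * q \<le> card {v. f v + t * g v = 0}" using neg by (simp add: q_def power2_eq_square not_less)
    moreover have "card (Z t) = card {v. f v + t * g v = 0} - 1"
      unfolding Z_def by (rule card_Diff_singleton) (simp add: zero)
    ultimately show ?thesis using n by simp
  qed
  have Z': "n \<le> card Z'"
  proof -
    have "q * q \<le> card {v. g v = 0}" using neg by (simp add: q_def power2_eq_square not_less)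
    moreover have "card Z' = card {v. g v = 0} - 1"
      unfolding Z'_def by (rule card_Diff_singleton) (simp add: zero)
    ultimately show ?thesis using n by simp
  qed
  have "card (\<Union>t. Z t) = (\<Sum>t\<in>UNIV. card (Z t))"
  proof (rule card_UN_disjoint)
    have "s = t" if v: "v \<in> Z s" "v \<in> Z t" for s t v
    proof (rule ccontr)
      assume "s \<noteq> t"
      have "f v = s * g v" "f v = t * g v" and nz: "v \<noteq> 0" using v by (auto simp: Z_def)
      then have "g v = 0" using \<open>s \<noteq> t\<close> by auto
      then show False using no[of v] nz \<open>f v = s * g v\<close> by simp
    qed
    then show "\<forall>s\<in>UNIV. \<forall>t\<in>UNIV. s \<noteq> t \<longrightarrow> Z s \<inter> Z t = {}" by blast
  qed auto
  also have "\<dots> \<ge> (\<Sum>t\<in>(UNIV::'a set). n)" by (intro sum_mono Z)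
  finally have "q * n \<le> card (\<Union>t. Z t)" by (simp add: q_def)
  moreover have "(\<Union>t. Z t) \<inter> Z' = {}"
    using no by (auto simp: Z_def Z'_def)
  moreover have "card ((\<Union>t. Z t) \<union> Z') \<le> card ((UNIV :: ('a^3) set) - {0})"
    by (intro card_mono) (auto simp: Z_def Z'_def)
  ultimately have "q * n + n \<le> q * (q * q) - 1"
    using Z' by (simp add: card_Un_disjoint q_def power3_eq_cube card_Diff_singleton)
  then have "q * n + n \<le> q * n + q - 1" using n by simp
  then have "Suc n \<le> q" using q by simp
  moreover have "2 * q \<le> q * q" using q by (intro mult_right_mono) auto
  ultimately show False using n q by simp
qed

text \<open>A nonzero zero (x, y) would produce the q^2 zeros (t x, t y, z), so the form is
  anisotropic in two variables. Then a \<noteq> 0, and d \<noteq> 0 because otherwise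
  (\<open>rt b\<close>, \<open>rt a\<close>) is a zero; rescaling both variables makes these
  coefficients 1.\<close>

lemma pencil_code_binary:
  fixes a b d :: 'a
  assumes small: "card {v. qf (a, b, 0, d, 0, 0) v = 0} < CARD('a) ^ 2"
  shows "\<exists>c R'. (\<forall>u. u * u + u \<noteq> c) \<and>
    congruent_codes (pencil_code (a, b, 0, d, 0, 0) R) (pencil_code (1, c, 0, 1, 0, 0) R')"
proof -
  have aniso: "x = 0 \<and> y = 0" if eq: "a * x * x + b * y * y + d * x * y = 0" for x y
  proof (rule ccontr)
    assume ne: "\<not> (x = 0 \<and> y = 0)"
    let ?g = "\<lambda>(t, z). vector [t * x, t * y, z] :: 'a^3"
    have "inj ?g"
      by (rule injI) (use ne in \<open>auto simp: vec_eq_iff forall_3\<close>)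
    moreover have "range ?g \<subseteq> {v. qf (a, b, 0, d, 0, 0) v = 0}"
    proof -
      have "qf (a, b, 0, d, 0, 0) (vector [t * x, t * y, z]) = t * t * (a * x * x + b * y * y + d * x * y)" for t z
        by (simp add: outer_def algebra_simps)
      then show ?thesis using eq by auto
    qed
    ultimately have "CARD('a \<times> 'a) \<le> card {v. qf (a, b, 0, d, 0, 0) v = 0}"
      by (intro card_inj_on_le) auto
    then show False using small by (simp add: power2_eq_square)
  qed
  have a: "a \<noteq> 0" using aniso[of 1 0] by auto
  have d: "d \<noteq> 0"
  proof
    assume "d = 0"
    moreover have "a * rt b * rt b + b * rt a * rt a = a * (rt b * rt b) + b * (rt a * rt a)"
      by (simp only: mult.assoc)
    ultimately have "rt b = 0 \<and> rt a = 0" by (intro aniso) (simp add: mult.commute)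
    then show False using a by simp
  qed
  define r where "r = rt a"
  have r: "r \<noteq> 0" "a = r * r" using a by (simp_all add: r_def)
  define c where "c = b * (r / d) * (r / d)"
  have "u * u + u \<noteq> c" for u
  proof
    assume "u * u + u = c"
    moreover have "a * (u / r) * (u / r) + b * (r / d) * (r / d) + d * (u / r) * (r / d) = u * u + u + c"
      using r(1) d unfolding r(2) c_def by (simp add: field_simps)
    ultimately have "u / r = 0 \<and> r / d = 0" by (intro aniso) simp
    then show False using r d by simp
  qed
  moreover have "congruent_codes (pencil_code (a, b, 0, d, 0, 0) R)
     (pencil_code (pullback (1/r) 0 0 0 (r/d) 0 0 0 1 (a, b, 0, d, 0, 0))
       (pullback (1/r) 0 0 0 (r/d) 0 0 0 1 R))"
    by (rule pencil_code_pullback) (use r d in \<open>simp add: invertible_m3\<close>)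
  moreover have "pullback (1/r) 0 0 0 (r/d) 0 0 0 1 (a, b, 0, d, 0, 0) = (1, c, 0, 1, 0, 0)"
    using r(1) d unfolding r(2) c_def by simp
  ultimately show ?thesis by metis
qed

text \<open>In a basis whose third vector is the nucleus the third variable disappears: the nucleus
  is a zero of the form and orthogonal to the other basis vectors.\<close>

lemma pencil_code_small:
  fixes Q :: "'a qform"
  assumes small: "card {v. qf Q v = 0} < CARD('a) ^ 2"
  shows "\<exists>c R'. (\<forall>u. u * u + u \<noteq> c) \<and>
    congruent_codes (pencil_code Q R) (pencil_code (1, c, 0, 1, 0, 0) R')"
proof -
  obtain a b c d e f where Q: "Q = (a, b, c, d, e, f)" by (cases Q)
  have n: "vector [f, e, d] \<noteq> (0::'a^3)" "qf (a, b, c, d, e, f) (vector [f, e, d]) = 0"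
    using nucleus_singular small unfolding Q by blast+
  have n1: "\<not> (f = 0 \<and> e = 0 \<and> d = 0)" using n(1) by (auto simp: vec_eq_iff forall_3)
  have n2: "a*f*f + b*e*e + c*d*d + d*f*e + e*f*d + f*e*d = 0"
    using n(2) by (simp add: outer_def mult.assoc)
  \<comment> \<open>The nucleus (f, e, d) is completed to a basis as the third column.\<close>
  have "\<exists>x1 x2 y1 y2 z1 z2. invertible (m3 x1 x2 f y1 y2 e z1 z2 d)"
  proof -
    consider "f \<noteq> 0" | "e \<noteq> 0" | "d \<noteq> 0" using n1 by blast
    then show ?thesis
    proof cases
      case 1 then show ?thesis
        by (intro exI[of _ 0] exI[of _ 0] exI[of _ 1] exI[of _ 0] exI[of _ 0] exI[of _ 1])
          (simp add: invertible_m3)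
    next
      case 2 then show ?thesis
        by (intro exI[of _ 1] exI[of _ 0] exI[of _ 0] exI[of _ 0] exI[of _ 0] exI[of _ 1])
          (simp add: invertible_m3)
    next
      case 3 then show ?thesis
        by (intro exI[of _ 1] exI[of _ 0] exI[of _ 0] exI[of _ 1] exI[of _ 0] exI[of _ 0])
          (simp add: invertible_m3)
    qed
  qed
  then obtain x1 x2 y1 y2 z1 z2 where inv: "invertible (m3 x1 x2 f y1 y2 e z1 z2 d)" by blast
  let ?Q = "pullback x1 x2 f y1 y2 e z1 z2 d Q"
  have "\<exists>a' b' d'. ?Q = (a', b', 0, d', 0, 0)"
    using n2 by (simp add: Q algebra_simps)
  then obtain a' b' d' where Q': "?Q = (a', b', 0, d', 0, 0)" by blast
  have "card {v. qf (a', b', 0, d', 0, 0) v = 0} < CARD('a) ^ 2"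
    using card_zeros_pullback[OF inv, of Q] small unfolding Q' by simp
  then obtain c' R' where c': "\<forall>u. u * u + u \<noteq> c'"
    and "congruent_codes (pencil_code (a', b', 0, d', 0, 0) (pullback x1 x2 f y1 y2 e z1 z2 d R))
      (pencil_code (1, c', 0, 1, 0, 0) R')" using pencil_code_binary by blast
  moreover have "congruent_codes (pencil_code Q R)
      (pencil_code (a', b', 0, d', 0, 0) (pullback x1 x2 f y1 y2 e z1 z2 d R))"
    using pencil_code_pullback[OF inv, of Q R] unfolding Q' .
  ultimately show ?thesis using congruent_codes_trans by blast
qed

lemma pencil_code_elliptic_member:
  fixes Q R :: "'a qform"
  assumes no: "\<And>v. outer v \<in> pencil_code Q R \<Longrightarrow> v = 0" and c: "\<And>u. u * u + u \<noteq> c"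
  shows "\<exists>R'. congruent_codes (pencil_code Q R) (pencil_code (1, c, 0, 1, 0, 0) R')"
proof -
  obtain a1 b1 c1 d1 e1 f1 where Q: "Q = (a1, b1, c1, d1, e1, f1)" by (cases Q)
  obtain a2 b2 c2 d2 e2 f2 where R: "R = (a2, b2, c2, d2, e2, f2)" by (cases R)
  have "\<exists>P P'. pencil_code Q R = pencil_code P P' \<and> card {v. qf P v = 0} < CARD('a) ^ 2"
  proof -
    have "(\<exists>t. card {v. qf Q v + t * qf R v = 0} < CARD('a) ^ 2) \<or> card {v. qf R v = 0} < CARD('a) ^ 2"
      by (rule pencil_has_small_member) (use no in \<open>auto simp: pencil_code_def\<close>)
    then show ?thesis
    proof
      assume "\<exists>t. card {v. qf Q v + t * qf R v = 0} < CARD('a) ^ 2"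
      then obtain t where t: "card {v. qf Q v + t * qf R v = 0} < CARD('a) ^ 2" by blast
      let ?P = "(1*a1 + t*a2, 1*b1 + t*b2, 1*c1 + t*c2, 1*d1 + t*d2, 1*e1 + t*e2, 1*f1 + t*f2)"
      have "pencil_code Q R = pencil_code ?P R"
        using pencil_code_scale_add[of 1 a2 b2 c2 d2 e2 f2 a1 b1 c1 d1 e1 f1 t]
        unfolding Q R pencil_code_swap[of "(a1, _)"] pencil_code_swap[of "(1 * a1 + _, _)"] by simp
      moreover have "qf ?P v = qf Q v + t * qf R v" for v by (simp add: Q R algebra_simps)
      ultimately show ?thesis using t by (intro exI[of _ ?P] exI[of _ R]) simp
    next
      assume "card {v. qf R v = 0} < CARD('a) ^ 2"
      then show ?thesis using pencil_code_swap by blast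
    qed
  qed
  then obtain P P' where P: "pencil_code Q R = pencil_code P P'" "card {v. qf P v = 0} < CARD('a) ^ 2"
    by blast
  obtain c' R' where c': "\<forall>u. u * u + u \<noteq> c'"
    and cong: "congruent_codes (pencil_code Q R) (pencil_code (1, c', 0, 1, 0, 0) R')"
    using pencil_code_small[OF P(2), of P'] unfolding P(1)[symmetric] by blast
  \<comment> \<open>The substitution of x + u y for x adds u^2 + u to the coefficient of y^2, so the
    coefficient can be made the prescribed c.\<close>
  obtain u where u: "u * u + u = c + c'" using artin_schreier_index_2[OF c] c' by blast
  have "congruent_codes (pencil_code (1, c', 0, 1, 0, 0) R')
     (pencil_code (pullback 1 u 0 0 1 0 0 0 1 (1, c', 0, 1, 0, 0)) (pullback 1 u 0 0 1 0 0 0 1 R'))"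
    by (rule pencil_code_pullback) (simp add: invertible_m3)
  moreover have "pullback 1 u 0 0 1 0 0 0 1 (1, c', 0, 1, 0, 0) = (1, c, 0, 1, 0, 0)"
  proof -
    have "u * u + c' + u = c" using u by (metis add.commute add.left_commute add_self_left)
    then show ?thesis by simp
  qed
  ultimately have "congruent_codes (pencil_code (1, c', 0, 1, 0, 0) R')
      (pencil_code (1, c, 0, 1, 0, 0) (pullback 1 u 0 0 1 0 0 0 1 R'))" by (simp only:)
  from congruent_codes_trans[OF cong this] show ?thesis by blast
qed

text \<open>The vector (0, 0, 1) is a zero of the elliptic form, so the second form has a z^2 term.
  Its xy term is removed by a multiple of the elliptic form. The remaining mixed part z (e x + f y)
  is either zero or can be rotated to y z, after which shears in z adjust the coefficients of x^2
  and y^2.\<close>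

lemma pencil_code_normal_form:
  fixes Q R :: "'a qform"
  assumes no: "\<And>v. outer v \<in> pencil_code Q R \<Longrightarrow> v = 0" and c: "\<And>u. u * u + u \<noteq> c"
  shows "\<exists>R'\<in>{(0, 0, 1, 0, 0, 0), (0, 0, 1, 0, 0, 1), (c, 0, 1, 0, 0, 1)}.
    congruent_codes (pencil_code Q R) (pencil_code (1, c, 0, 1, 0, 0) R')"
proof -
  let ?N = "(1, c, 0, 1, 0, 0) :: 'a qform"
  obtain R0 where R0: "congruent_codes (pencil_code Q R) (pencil_code ?N R0)"
    using pencil_code_elliptic_member[OF no c] by blast
  obtain a0 b0 c0 d0 e0 f0 where R0': "R0 = (a0, b0, c0, d0, e0, f0)" by (cases R0)
  have "c0 \<noteq> 0"
  proof
    assume "c0 = 0"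
    then have "outer (vector [0, 0, 1]) \<in> pencil_code ?N R0"
      by (simp add: pencil_code_def R0' outer_sm)
    then have "vector [0, 0, 1] = (0::'a^3)" using congruent_codes_no_outer[OF R0 no] by blast
    then show False by (simp add: vec_eq_iff forall_3)
  qed
  define a b e f where "a = a0/c0 + d0/c0" and "b = b0/c0 + d0/c0*c" and "e = e0/c0" and "f = f0/c0"
  have R1: "pencil_code ?N R0 = pencil_code ?N (a, b, 1, 0, e, f)"
    using pencil_code_scale_add[of "1/c0" 1 c 0 1 0 0 a0 b0 c0 d0 e0 f0 "d0/c0"] \<open>c0 \<noteq> 0\<close>
    by (simp add: R0' a_def b_def e_def f_def)
  show ?thesis
  proof (cases "e = 0 \<and> f = 0")
    case True
    \<comment> \<open>Without mixed terms the second form is the square of \<open>rt a\<close> x +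
      \<open>rt b\<close> y + z, which becomes the new third variable.\<close>
    have "congruent_codes (pencil_code ?N (a, b, 1, 0, e, f)) (pencil_code
        (pullback 1 0 0 0 1 0 (rt a) (rt b) 1 ?N) (pullback 1 0 0 0 1 0 (rt a) (rt b) 1 (a, b, 1, 0, e, f)))"
      by (rule pencil_code_pullback) (simp add: invertible_m3)
    then have "congruent_codes (pencil_code ?N (a, b, 1, 0, e, f)) (pencil_code ?N (0, 0, 1, 0, 0, 0))"
      using True by simp
    then show ?thesis using R0 R1 congruent_codes_trans by (intro bexI[of _ "(0, 0, 1, 0, 0, 0)"]) auto
  next
    case False
    define n where "n = f * f + f * e + c * e * e"
    have n: "n \<noteq> 0"
    proof
      assume n0: "n = 0"
      show False
      proof (cases "e = 0")
        case True
        then show False using n0 False by (simp add: n_def)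
      next
        case e: False
        have "(f / e) * (f / e) + f / e = c"
        proof -
          have "((f / e) * (f / e) + f / e + c) * (e * e) = n"
            using e by (simp add: n_def field_simps)
          then show ?thesis using n0 e by simp
        qed
        then show False using c by blast
      qed
    qed
    have det: "f * (f + e) * n + e * c * e * n = n * n" by (simp add: n_def algebra_simps)
    \<comment> \<open>\<open>(x, y)\<close> is identified with \<open>x + y \<omega>\<close>, where \<open>\<omega>\<^sup>2 = \<omega> + c\<close>, so that the first form is the norm;
      the substitution is multiplication by \<open>f + e \<omega>\<close>, a similitude.\<close>
    have "congruent_codes (pencil_code ?N (a, b, 1, 0, e, f)) (pencil_code
        (pullback f (e*c) 0 e (f+e) 0 0 0 n ?N) (pullback f (e*c) 0 e (f+e) 0 0 0 n (a, b, 1, 0, e, f)))"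
      by (rule pencil_code_pullback) (use n det in \<open>simp add: invertible_m3 del: add_eq_0\<close>)
    moreover have "pullback f (e*c) 0 e (f+e) 0 0 0 n ?N = (n, n*c, 0, n, 0, 0)"
      by (simp add: n_def algebra_simps)
    moreover have "\<exists>a' b' d'. pullback f (e*c) 0 e (f+e) 0 0 0 n (a, b, 1, 0, e, f) = (a', b', n*n, d', 0, n*n)"
    proof -
      have "e * (f * n) + f * (e * n) = 0" by (simp add: algebra_simps)
      moreover have "e * (e * c * n) + f * ((f + e) * n) = n * n" by (simp add: n_def algebra_simps)
      ultimately show ?thesis by simp
    qed
    ultimately obtain a' b' d' where R2: "congruent_codes (pencil_code ?N (a, b, 1, 0, e, f))
        (pencil_code (n, n*c, 0, n, 0, 0) (a', b', n*n, d', 0, n*n))" by auto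
    define a3 b3 where "a3 = a'/(n*n) + d'/(n*n)" and "b3 = b'/(n*n) + d'/(n*n)*c"
    have "pencil_code (n, n*c, 0, n, 0, 0) (a', b', n*n, d', 0, n*n) =
        pencil_code ?N (a', b', n*n, d', 0, n*n)"
      using pencil_code_scale_add[of "1/n" a' b' "n*n" d' 0 "n*n" n "n*c" 0 n 0 0 0] n
      by (simp add: pencil_code_swap[of _ "(a', _)"])
    also have "\<dots> = pencil_code ?N (a3, b3, 1, 0, 0, 1)"
      using pencil_code_scale_add[of "1/(n*n)" 1 c 0 1 0 0 a' b' "n*n" d' 0 "n*n" "d'/(n*n)"] n
      by (simp add: a3_def b3_def)
    finally have R3: "congruent_codes (pencil_code Q R) (pencil_code ?N (a3, b3, 1, 0, 0, 1))"
      using congruent_codes_trans[OF R0[unfolded R1] R2] by (simp only:)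
    \<comment> \<open>Replacing z by z + l x + m y turns y z into y z + l x y + m y^2; adding l
      times the elliptic form removes the new xy term at the cost of l in the first coefficient and
      c l in the second.\<close>
    have shift: "congruent_codes (pencil_code ?N (a3, b3, 1, 0, 0, 1))
        (pencil_code ?N (a3 + (l*l + l), b3 + c*l + (m*m + m), 1, 0, 0, 1))" for l m
    proof -
      have "congruent_codes (pencil_code ?N (a3, b3, 1, 0, 0, 1)) (pencil_code
        (pullback 1 0 0 0 1 0 l m 1 ?N) (pullback 1 0 0 0 1 0 l m 1 (a3, b3, 1, 0, 0, 1)))"
        by (rule pencil_code_pullback) (simp add: invertible_m3)
      also have "pullback 1 0 0 0 1 0 l m 1 ?N = ?N" by simp
      also have "pullback 1 0 0 0 1 0 l m 1 (a3, b3, 1, 0, 0, 1) = (a3 + l*l, b3 + m*m + m, 1, l, 0, 1)"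
        by simp
      also have "pencil_code ?N (a3 + l*l, b3 + m*m + m, 1, l, 0, 1) =
          pencil_code ?N (a3 + (l*l + l), b3 + c*l + (m*m + m), 1, 0, 0, 1)"
        using pencil_code_scale_add[of 1 1 c 0 1 0 0 "a3 + l*l" "b3 + m*m + m" 1 l 0 1 l]
        by (simp add: ac_simps)
      finally show ?thesis .
    qed
    have split: "\<exists>u. u * u + u = x \<or> u * u + u = x + c" for x
    proof (cases "\<exists>u. u * u + u = x")
      case False
      then show ?thesis using artin_schreier_index_2[of x c] c by blast
    qed blast
    obtain l0 where l0: "l0 * l0 + l0 = a3 \<or> l0 * l0 + l0 = a3 + c" using split by blast
    obtain m where m: "m * m + m = b3 + c * l0 \<or> m * m + m = b3 + c * l0 + c" using split by blast
    \<comment> \<open>\<open>l0\<close> and \<open>l0 + 1\<close> have the same value of l^2 + l,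
      while c l changes by c. This freedom moves the second coefficient into the image of m^2 + m,
      so only the first one can remain equal to c.\<close>
    define l where "l = (if m * m + m = b3 + c * l0 then l0 else l0 + 1)"
    have "l * l + l = l0 * l0 + l0" by (simp add: l_def algebra_simps)
    then have "a3 + (l*l + l) = 0 \<or> a3 + (l*l + l) = c" using l0 by auto
    moreover have "b3 + c*l + (m*m + m) = 0" 
      using m unfolding add_eq_0 l_def by (cases "m * m + m = b3 + c * l0") (simp_all add: distrib_left add.assoc)
    ultimately have "congruent_codes (pencil_code Q R) (pencil_code ?N (0, 0, 1, 0, 0, 1)) \<or>
        congruent_codes (pencil_code Q R) (pencil_code ?N (c, 0, 1, 0, 0, 1))"
      using congruent_codes_trans[OF R3 shift[of l m]] by auto
    then show ?thesis by auto
  qed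
qed

end

section \<open>Binary cubic forms without zeros\<close>

definition cubic :: "'a::field \<Rightarrow> 'a \<Rightarrow> 'a \<Rightarrow> 'a \<Rightarrow> 'a \<Rightarrow> 'a \<Rightarrow> 'a" where
  "cubic p0 p1 p2 p3 x y = p0*x*x*x + p1*x*x*y + p2*x*y*y + p3*y*y*y"

context char2_field
begin

lemma ac_add_self [simp]: "x + x = (0::'a alg_closure)"
proof -
  have "x + x = x * (to_ac 1 + to_ac 1)" by (simp only: distrib_left mult_1_right to_ac_1)
  also have "to_ac 1 + to_ac (1::'a) = 0" by (simp only: to_ac_add[symmetric] add_self to_ac_0)
  finally show ?thesis by simp
qed

lemma ac_add_self_left [simp]: "x + (x + y) = (y::'a alg_closure)"
  by (simp add: add.assoc[symmetric])

lemma ac_uminus_eq [simp]: "- x = (x::'a alg_closure)"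
  using ac_add_self[of x] by (simp only: add_eq_0_iff)

lemma ac_diff_eq_add [simp]: "x - y = x + (y::'a alg_closure)"
  by (simp only: diff_conv_add_uminus ac_uminus_eq)

lemma ac_add_eq_0 [simp]: "x + y = 0 \<longleftrightarrow> x = (y::'a alg_closure)"
  using add_eq_0_iff[of x y] by auto

section \<open>The Frobenius map of the base field on its algebraic closure\<close>

definition frob :: "'a alg_closure \<Rightarrow> 'a alg_closure" where "frob x = x ^ CARD('a)"

lemma frob_mult: "frob (x * y) = frob x * frob y"
  by (simp add: frob_def power_mult_distrib)

lemma frob_to_ac [simp]: "frob (to_ac x) = to_ac x"
proof (cases "x = 0")
  case True
  then show ?thesis by (simp add: frob_def)
next
  case False
  let ?U = "UNIV - {0::'a}"
  have "bij_betw ((*) x) ?U ?U"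
    using False by (intro bij_betwI[of _ _ _ "\<lambda>y. y / x"]) auto
  then have "(\<Prod>y\<in>?U. x * y) = (\<Prod>y\<in>?U. y)"
    by (rule prod.reindex_bij_betw)
  then have "x ^ card ?U * (\<Prod>y\<in>?U. y) = (\<Prod>y\<in>?U. y)" by (simp add: prod.distrib)
  moreover have "(\<Prod>y\<in>?U. y) \<noteq> 0" by simp
  ultimately have "x ^ card ?U = 1" by simp
  then have "x ^ (CARD('a) - 1) = 1" by (simp add: card_Diff_singleton)
  then have "x ^ CARD('a) = x" by (metis mult.right_neutral power_eq_if zero_less_card_finite less_irrefl)
  then show ?thesis unfolding frob_def to_ac_power[symmetric] by simp
qed

text \<open>The polynomial X^q - X has at most q roots, and the q elements of the base field are
  already roots.\<close>

lemma frob_eq_self: "frob x = x \<Longrightarrow> x \<in> range to_ac"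
proof -
  let ?p = "Polynomial.monom 1 CARD('a) - [:0, 1:] :: 'a alg_closure poly"
  have "Polynomial.coeff ?p CARD('a) = 1" using card_ge_2 by (simp add: coeff_pCons split: nat.split)
  then have "?p \<noteq> 0" by (metis Polynomial.coeff_0 zero_neq_one)
  have deg: "Polynomial.degree ?p \<le> CARD('a)"
    using card_ge_2 by (intro degree_diff_le) (auto simp: degree_monom_eq)
  have p: "poly ?p x = frob x + x" for x by (simp add: poly_monom frob_def)
  have "card {x. poly ?p x = 0} \<le> CARD('a)"
    using card_poly_roots_bound[OF \<open>?p \<noteq> 0\<close>] deg by simp
  moreover have "range to_ac \<subseteq> {x. poly ?p x = 0}" unfolding p by auto
  moreover have "card (range (to_ac :: 'a \<Rightarrow> _)) = CARD('a)" by (simp add: card_image inj_to_ac)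
  ultimately have "range to_ac = {x. poly ?p x = 0}"
    using poly_roots_finite[OF \<open>?p \<noteq> 0\<close>] by (intro card_seteq) (simp_all only:)
  then show "frob x = x \<Longrightarrow> x \<in> range to_ac" unfolding p by simp
qed

text \<open>The elements in question are the roots of X^(q^3) - X. An upper bound for their number
  suffices for the later pigeonhole argument.\<close>

lemma card_frob_cube: "finite {x. frob (frob (frob x)) = x}"
  "card {x. frob (frob (frob x)) = x} \<le> CARD('a) ^ 3"
proof -
  let ?p = "Polynomial.monom 1 (CARD('a) ^ 3) - [:0, 1:] :: 'a alg_closure poly"
  have q3: "CARD('a) ^ 3 > 1" using card_ge_2 by (intro one_less_power) auto
  then have "Polynomial.coeff ?p (CARD('a) ^ 3) = 1"
    using card_ge_2 by (simp add: coeff_pCons split: nat.split)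
  then have "?p \<noteq> 0" by (metis Polynomial.coeff_0 zero_neq_one)
  have deg: "Polynomial.degree ?p \<le> CARD('a) ^ 3"
    using q3 by (intro degree_diff_le) (auto simp: degree_monom_eq)
  have p: "{x. frob (frob (frob x)) = x} = {x. poly ?p x = 0}"
    by (simp add: poly_monom frob_def power_mult[symmetric] power3_eq_cube)
  show "finite {x. frob (frob (frob x)) = x}" unfolding p by (rule poly_roots_finite[OF \<open>?p \<noteq> 0\<close>])
  show "card {x. frob (frob (frob x)) = x} \<le> CARD('a) ^ 3"
    unfolding p using card_poly_roots_bound[OF \<open>?p \<noteq> 0\<close>] deg by simp
qed

section \<open>Roots of binary cubic forms without zeros\<close>

context
  fixes h :: nat assumes card: "CARD('a) = 2 ^ h"
begin

lemma frob_add: "frob (x + y) = frob x + frob y"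
proof -
  have "(x + y) ^ (2 ^ n) = x ^ (2 ^ n) + y ^ (2 ^ n)" for n
  proof (induction n)
    case (Suc n)
    have "(x + y) ^ (2 ^ Suc n) = (x ^ (2 ^ n) + y ^ (2 ^ n)) * (x ^ (2 ^ n) + y ^ (2 ^ n))"
      by (simp only: power_Suc mult_2 power_add Suc)
    also have "\<dots> = x ^ (2 ^ n) * x ^ (2 ^ n) + y ^ (2 ^ n) * y ^ (2 ^ n)"
      by (simp add: algebra_simps)
    also have "\<dots> = x ^ (2 ^ Suc n) + y ^ (2 ^ Suc n)" by (simp only: power_Suc mult_2 power_add)
    finally show ?case .
  qed simp
  then show ?thesis by (simp add: frob_def card)
qed

lemma frob_eq_iff [simp]: "frob x = frob y \<longleftrightarrow> x = y"
proof
  assume "frob x = frob y"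
  then have "frob (x + y) = 0" by (simp add: frob_add)
  then have "x + y = 0" by (simp add: frob_def del: ac_add_eq_0)
  then show "x = y" by simp
qed simp

text \<open>Division of the cubic by its two known linear factors; the first displayed quantity is
  the divided difference at x and y, which vanishes because both are roots.\<close>

lemma third_root:
  fixes p0 p1 p2 p3 x y z :: "'a alg_closure"
  assumes "cubic p0 p1 p2 p3 x 1 = 0" "cubic p0 p1 p2 p3 y 1 = 0" "x \<noteq> y"
  shows "cubic p0 p1 p2 p3 z 1 = (z + x) * (z + y) * (p0 * (x + y + z) + p1)"
proof -
  have "(x + y) * (p0 * (x*x + x*y + y*y) + p1 * (x + y) + p2) =
      cubic p0 p1 p2 p3 x 1 + cubic p0 p1 p2 p3 y 1"
    by (simp add: cubic_def algebra_simps)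
  then have 1: "p0 * (x*x + x*y + y*y) + p1 * (x + y) + p2 = 0" using assms by simp
  have "cubic p0 p1 p2 p3 z 1 = cubic p0 p1 p2 p3 x 1 +
      (z + x) * (p0 * (x*x + x*y + y*y) + p1 * (x + y) + p2) +
      (z + x) * (z + y) * (p0 * (x + y + z) + p1)"
    by (simp add: cubic_def algebra_simps)
  then show ?thesis unfolding 1 assms(1) by simp
qed

text \<open>Frobenius permutes the roots, none of which lies in the base field. A root of period two
  would leave a rational third root. Otherwise, if the period were not three, both
  \<open>frob (frob x)\<close> and its image would be the third root, so x would be fixed.\<close>

lemma cubic_root_frob:
  fixes p0 p1 p2 p3 :: 'a
  assumes free: "\<And>a b. cubic p0 p1 p2 p3 a b = 0 \<Longrightarrow> a = 0 \<and> b = 0"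
    and x: "cubic (to_ac p0) (to_ac p1) (to_ac p2) (to_ac p3) x 1 = 0"
  shows "frob x \<noteq> x" "frob (frob x) \<noteq> x" "frob (frob (frob x)) = x"
proof -
  let ?c = "\<lambda>z. cubic (to_ac p0) (to_ac p1) (to_ac p2) (to_ac p3) z 1"
  have p0: "p0 \<noteq> 0" using free[of 1 0] by (auto simp: cubic_def)
  have root: "?c (frob z) = 0" if "?c z = 0" for z
  proof -
    have "frob 1 = 1" by (simp add: frob_def)
    then have "?c (frob z) = frob (?c z)" by (simp add: cubic_def frob_add frob_mult)
    then show ?thesis using that by (simp add: frob_def)
  qed
  have rat: "?c (to_ac a) \<noteq> 0" for a
  proof -
    have "?c (to_ac a) = to_ac (cubic p0 p1 p2 p3 a 1)" by (simp add: cubic_def)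
    then show ?thesis using free[of a 1] by auto
  qed
  show ne: "frob x \<noteq> x" using rat x frob_eq_self[of x] by auto
  note third = third_root[OF x root[OF x] ne[symmetric]]
  show ne2: "frob (frob x) \<noteq> x"
  proof
    assume *: "frob (frob x) = x"
    have "frob (x + frob x) = x + frob x" by (simp add: frob_add * add.commute)
    then obtain s where s: "x + frob x = to_ac s" using frob_eq_self by blast
    \<comment> \<open>The zero of the remaining linear factor p0 (s + z) + p1.\<close>
    have "?c (to_ac (s + p1 / p0)) = 0"
      unfolding third s using p0 by (simp add: algebra_simps)
    then show False using rat by blast
  qed
  have z: "z = x + frob x + to_ac p1 / to_ac p0" if "?c z = 0" "z \<noteq> x" "z \<noteq> frob x" for z
  proof -
    have "to_ac p0 * (x + frob x + z) + to_ac p1 = 0" using that third[of z] by simp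
    then have "to_ac p0 * (x + frob x + z) = to_ac p1" by simp
    then have "x + frob x + z = to_ac p1 / to_ac p0" using p0 by (simp add: field_simps)
    then show ?thesis by (metis ac_add_self_left)
  qed
  show "frob (frob (frob x)) = x"
  proof (rule ccontr)
    assume ne3: "frob (frob (frob x)) \<noteq> x"
    have "frob (frob x) = x + frob x + to_ac p1 / to_ac p0"
      using root x ne ne2 by (intro z) auto
    moreover have "frob (frob (frob x)) = x + frob x + to_ac p1 / to_ac p0"
      using root x ne2 ne3 by (intro z) auto
    ultimately have "frob (frob (frob x)) = frob (frob x)" by simp
    then show False using ne by simp
  qed
qed

text \<open>A quadratic polynomial over the base field that vanishes at x also vanishes at its two
  further conjugates. Comparing the sums of two pairs of roots kills the leading
  coefficient.\<close>

lemma cubic_root_independent: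
  fixes u v w :: 'a
  assumes x: "frob x \<noteq> x" "frob (frob x) \<noteq> x" and eq: "to_ac u + to_ac v * x + to_ac w * x * x = 0"
  shows "u = 0 \<and> v = 0 \<and> w = 0"
proof -
  let ?g = "\<lambda>z. to_ac u + to_ac v * z + to_ac w * z * z"
  have g: "?g (frob z) = 0" if "?g z = 0" for z
  proof -
    have "?g (frob z) = frob (?g z)" by (simp add: frob_add frob_mult)
    then show ?thesis using that by (simp add: frob_def)
  qed
  have step: "to_ac w * (y + z) = to_ac v" if "?g y = 0" "?g z = 0" "y \<noteq> z" for y z
  proof -
    have "(y + z) * (to_ac w * (y + z) + to_ac v) = ?g y + ?g z" by (simp add: algebra_simps)
    then show ?thesis using that by simp
  qed
  have g1: "?g (frob x) = 0" by (rule g[OF eq])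
  have g2: "?g (frob (frob x)) = 0" by (rule g[OF g1])
  have s1: "to_ac w * (x + frob x) = to_ac v" by (rule step[OF eq g1]) (use x in simp)
  have s2: "to_ac w * (frob x + frob (frob x)) = to_ac v" by (rule step[OF g1 g2]) (use x in simp)
  have "to_ac w * (x + frob x) = to_ac w * (frob x + frob (frob x))" by (simp only: s1 s2)
  then have "to_ac w * (x + frob (frob x)) = 0" by (simp add: algebra_simps)
  then have w: "w = 0" using x by simp
  then have v: "v = 0" using s1 by simp
  show ?thesis using eq w v by simp
qed

text \<open>A fractional linear map over the base field takes the root x of p to the root y of r.
  Substituting it into r gives a cubic with root x, which is proportional to p because 1, x, x^2 are
  independent.\<close>

lemma cubic_equivalent:
  fixes p0 p1 p2 p3 r0 r1 r2 r3 :: 'a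
  assumes p: "\<And>a b. cubic p0 p1 p2 p3 a b = 0 \<Longrightarrow> a = 0 \<and> b = 0"
    and r: "\<And>a b. cubic r0 r1 r2 r3 a b = 0 \<Longrightarrow> a = 0 \<and> b = 0"
  obtains a b c d s where "a * d + b * c \<noteq> 0" "s \<noteq> 0"
    "\<And>x y. cubic r0 r1 r2 r3 (a*x + b*y) (c*x + d*y) = s * cubic p0 p1 p2 p3 x y"
proof -
  have ex: "\<exists>x. cubic (to_ac t0) (to_ac t1) (to_ac t2) (to_ac t3) x 1 = 0"
    if t: "\<And>a b. cubic t0 t1 t2 t3 a b = 0 \<Longrightarrow> a = 0 \<and> b = 0" for t0 t1 t2 t3 :: 'a
  proof -
    have "t0 \<noteq> 0" using t[of 1 0] by (auto simp: cubic_def)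
    then have "Polynomial.degree [:to_ac t3, to_ac t2, to_ac t1, to_ac t0:] > 0" by simp
    then obtain x where "poly [:to_ac t3, to_ac t2, to_ac t1, to_ac t0:] x = 0"
      using alg_closed_imp_poly_has_root by blast
    then show ?thesis by (intro exI[of _ x]) (simp add: cubic_def algebra_simps)
  qed
  obtain x where x: "cubic (to_ac p0) (to_ac p1) (to_ac p2) (to_ac p3) x 1 = 0" using ex[OF p] by blast
  obtain y where y: "cubic (to_ac r0) (to_ac r1) (to_ac r2) (to_ac r3) y 1 = 0" using ex[OF r] by blast
  have xf: "frob x \<noteq> x" "frob (frob x) \<noteq> x" "frob (frob (frob x)) = x"
    using cubic_root_frob[of p0 p1 p2 p3 x] p x by blast+
  have yf: "frob y \<noteq> y" "frob (frob (frob y)) = y"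
    using cubic_root_frob[of r0 r1 r2 r3 y] r y by blast+
  \<comment> \<open>Both roots lie in the field with \<open>q\<^sup>3\<close> elements, so by the pigeonhole principle they are related
    by a fractional linear map \<open>y = (a x + b) / (c x + d)\<close>.\<close>
  let ?K = "{z. frob (frob (frob z)) = z}"
  let ?g = "\<lambda>(a, b, c, d). to_ac a * x + to_ac b + y * (to_ac c * x + to_ac d)"
  have "\<not> inj ?g"
  proof
    assume inj: "inj ?g"
    have "range ?g \<subseteq> ?K" using xf(3) yf(2) by (auto simp: frob_add frob_mult)
    then have "CARD('a \<times> 'a \<times> 'a \<times> 'a) \<le> card ?K"
      using inj card_frob_cube(1) by (intro card_inj_on_le)
    also have "\<dots> \<le> CARD('a) ^ 3" by (rule card_frob_cube)
    finally have "CARD('a) ^ 4 \<le> CARD('a) ^ 3" by (simp add: eval_nat_numeral)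
    moreover have "CARD('a) ^ 3 < CARD('a) ^ 4" using card_ge_2 by (intro power_strict_increasing) auto
    ultimately show False by simp
  qed
  then obtain m n where mn: "m \<noteq> n" "?g m = ?g n" unfolding inj_def by blast
  obtain a1 b1 c1 d1 where m: "m = (a1, b1, c1, d1)" by (cases m)
  obtain a2 b2 c2 d2 where n: "n = (a2, b2, c2, d2)" by (cases n)
  note ne = mn(1)[unfolded m n] and eq = mn(2)[unfolded m n]
  define a b c d where "a = a1 + a2" and "b = b1 + b2" and "c = c1 + c2" and "d = d1 + d2"
  have ne': "\<not> (a = 0 \<and> b = 0 \<and> c = 0 \<and> d = 0)" using ne by (simp add: a_def b_def c_def d_def)
  have "?g (a, b, c, d) = ?g (a1, b1, c1, d1) + ?g (a2, b2, c2, d2)"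
    by (simp add: a_def b_def c_def d_def algebra_simps)
  then have "?g (a, b, c, d) = 0" unfolding eq by (simp only: ac_add_self)
  then have ab: "to_ac a * x + to_ac b = y * (to_ac c * x + to_ac d)" by simp
  have indep1: "u = 0 \<and> v = 0" if "to_ac v * x + to_ac u = 0" for u v
  proof -
    have "to_ac u + to_ac v * x + to_ac 0 * x * x = 0" using that by (simp add: add.commute)
    from cubic_root_independent[OF xf(1,2) this] show ?thesis by simp
  qed
  have cd: "\<not> (c = 0 \<and> d = 0)"
  proof
    assume cd: "c = 0 \<and> d = 0"
    then have "to_ac a * x + to_ac b = 0" using ab by simp
    then show False using indep1 ne' cd by blast
  qed
  have y0: "to_ac c * x + to_ac d \<noteq> 0" using indep1[of c d] cd by blast
  \<comment> \<open>If the determinant vanished, the fractional linear map would be constant and y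
    would lie in the base field.\<close>
  have det: "a * d + b * c \<noteq> 0"
  proof
    assume "a * d + b * c = 0"
    then have adbc: "a * d = b * c" by simp
    have "\<exists>k. a = k * c \<and> b = k * d"
    proof (cases "c = 0")
      case True
      then show ?thesis using adbc cd by (intro exI[of _ "b / d"]) auto
    next
      case False
      then show ?thesis using adbc by (intro exI[of _ "a / c"]) (simp add: field_simps)
    qed
    then obtain k where k: "a = k * c" "b = k * d" by blast
    have "to_ac k * (to_ac c * x + to_ac d) = y * (to_ac c * x + to_ac d)"
      using ab unfolding k by (simp add: algebra_simps)
    then have "y = to_ac k" using y0 by simp
    then show False using yf(1) by simp
  qed
  \<comment> \<open>The coefficients of the substituted cubic, expanded with 3 = 1 in characteristic
    two.\<close>
  define t0 where "t0 = r0*a*a*a + r1*a*a*c + r2*a*c*c + r3*c*c*c"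
  define t1 where "t1 = r0*a*a*b + r1*a*a*d + r2*b*c*c + r3*c*c*d"
  define t2 where "t2 = r0*a*b*b + r1*b*b*c + r2*a*d*d + r3*c*d*d"
  define t3 where "t3 = r0*b*b*b + r1*b*b*d + r2*b*d*d + r3*d*d*d"
  note t_defs = t0_def t1_def t2_def t3_def
  have exp: "cubic r0 r1 r2 r3 (a*x + b*y) (c*x + d*y) = cubic t0 t1 t2 t3 x y" for x y
    by (simp add: cubic_def t_defs algebra_simps)
  have "cubic (to_ac t0) (to_ac t1) (to_ac t2) (to_ac t3) x 1 = cubic (to_ac r0) (to_ac r1) (to_ac r2)
      (to_ac r3) (to_ac a * x + to_ac b) (to_ac c * x + to_ac d)"
    by (simp add: cubic_def t_defs algebra_simps)
  also have "\<dots> = (let z = to_ac c * x + to_ac d in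
      z * z * z * cubic (to_ac r0) (to_ac r1) (to_ac r2) (to_ac r3) y 1)"
    unfolding ab by (simp add: cubic_def Let_def algebra_simps)
  finally have tx: "cubic (to_ac t0) (to_ac t1) (to_ac t2) (to_ac t3) x 1 = 0" using y by simp
  \<comment> \<open>The combination cancels the terms in x^3 and leaves a quadratic relation for
    x.\<close>
  have "to_ac (p0*t3 + t0*p3) + to_ac (p0*t2 + t0*p2) * x + to_ac (p0*t1 + t0*p1) * x * x =
      to_ac p0 * cubic (to_ac t0) (to_ac t1) (to_ac t2) (to_ac t3) x 1 +
      to_ac t0 * cubic (to_ac p0) (to_ac p1) (to_ac p2) (to_ac p3) x 1"
    by (simp add: cubic_def algebra_simps)
  then have proportional: "p0*t3 = t0*p3 \<and> p0*t2 = t0*p2 \<and> p0*t1 = t0*p1"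
    using cubic_root_independent[OF xf(1,2), of "p0*t3 + t0*p3" "p0*t2 + t0*p2" "p0*t1 + t0*p1"]
    unfolding tx x by simp
  have p0: "p0 \<noteq> 0" using p[of 1 0] by (auto simp: cubic_def)
  have t: "t0 = t0 / p0 * p0" "t1 = t0 / p0 * p1" "t2 = t0 / p0 * p2" "t3 = t0 / p0 * p3"
    using proportional p0 by (simp_all add: field_simps)
  have "t0 \<noteq> 0"
  proof
    assume "t0 = 0"
    then have "cubic r0 r1 r2 r3 a c = 0" by (simp add: cubic_def t0_def)
    then have "a = 0 \<and> c = 0" by (rule r)
    then show False using det by simp
  qed
  then have s: "t0 / p0 \<noteq> 0" using p0 by simp
  have "cubic t0 t1 t2 t3 x y = t0 / p0 * cubic p0 p1 p2 p3 x y" for x y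
  proof -
    have "cubic (k*p0) (k*p1) (k*p2) (k*p3) x y = k * cubic p0 p1 p2 p3 x y" for k
      by (simp add: cubic_def algebra_simps)
    then show ?thesis using t by metis
  qed
  then show thesis using that[OF det s] exp by simp
qed

end

end

section \<open>Classification of the codes of dimension 3\<close>

definition alt_code :: "('a::field^3^3) set" where
  "alt_code = range (\<lambda>(d, e, f). sm 0 0 0 d e f)"

text \<open>The determinant of the parametrised matrix is x^3, so the singular elements are the
  alternating ones.\<close>

definition pointed_code :: "('a::field^3^3) set" where
  "pointed_code = range (\<lambda>(x, d, e). sm x 0 0 d e x)"

text \<open>The determinant is the binary cubic form in a, b with coefficients f1^2, e1^2, f2^2,
  e2^2. Since every element is a square, all binary cubic forms arise.\<close>

definition cubic_code :: "'a \<Rightarrow> 'a \<Rightarrow> 'a \<Rightarrow> 'a \<Rightarrow> ('a::field^3^3) set" where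
  "cubic_code e1 e2 f1 f2 = range (\<lambda>(a, b, d). sm a b 0 d (e1*a + e2*b) (f1*a + f2*b))"

lemma card_param3:
  assumes "inj (g :: 'a::finite \<times> 'a \<times> 'a \<Rightarrow> 'b)"
  shows "card (range g) = CARD('a) ^ 3"
  using assms by (simp add: card_image power3_eq_cube)

lemma card_alt_code: "card (alt_code :: ('a::{field,finite}^3^3) set) = CARD('a) ^ 3"
  unfolding alt_code_def by (rule card_param3) (auto intro: injI)

lemma card_pointed_code: "card (pointed_code :: ('a::{field,finite}^3^3) set) = CARD('a) ^ 3"
  unfolding pointed_code_def by (rule card_param3) (auto intro: injI)

lemma card_cubic_code: "card (cubic_code e1 e2 f1 f2 :: ('a::{field,finite}^3^3) set) = CARD('a) ^ 3"
  unfolding cubic_code_def by (rule card_param3) (auto intro: injI)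

lemma subspace_alt_code: "matsp.subspace alt_code"
  unfolding matsp.subspace_def alt_code_def image_iff by (auto simp: sm_zero)

lemma subspace_pointed_code: "matsp.subspace pointed_code"
  unfolding matsp.subspace_def pointed_code_def image_iff by (auto simp: sm_zero)

lemma subspace_cubic_code: "matsp.subspace (cubic_code e1 e2 f1 f2)"
  unfolding matsp.subspace_def cubic_code_def image_iff by (auto simp: sm_zero algebra_simps)

context char2_field
begin

text \<open>Adding k times the alternating matrix changes the determinant by k^2 times the displayed
  expression, the terms linear in k having a factor 2. Were the expression nonzero, some k would
  give a singular element with nonzero diagonal.\<close>

lemma alternating_orthogonal:
  fixes C :: "('a^3^3) set"
  assumes C: "matsp.subspace C"
    and sing: "\<And>a b c d e f. sm a b c d e f \<in> C \<Longrightarrow> det (sm a b c d e f) = 0 \<Longrightarrow> a = 0 \<and> b = 0 \<and> c = 0"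
    and A: "sm 0 0 0 d e f \<in> C" and X: "sm a b c d' e' f' \<in> C"
  shows "a*f*f + b*e*e + c*d*d = 0"
proof (rule ccontr)
  let ?w = "a*f*f + b*e*e + c*d*d"
  assume w: "?w \<noteq> 0"
  define k where "k = rt (det (sm a b c d' e' f') / ?w)"
  have mem: "sm a b c (d' + k*d) (e' + k*e) (f' + k*f) \<in> C"
    using matsp.subspace_add[OF C X matsp.subspace_scale[OF C A, of k]] by simp
  have "det (sm a b c (d' + k*d) (e' + k*e) (f' + k*f)) = det (sm a b c d' e' f') + k * k * ?w"
    by (simp add: det_sm algebra_simps)
  also have "k * k * ?w = det (sm a b c d' e' f')"
    unfolding k_def rt_mult_self using w by (simp only: nonzero_eq_divide_eq divide_self_if times_divide_eq_left mult.commute) simp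
  finally have "det (sm a b c (d' + k*d) (e' + k*e) (f' + k*f)) = 0" by simp
  from sing[OF mem this] show False using w by simp
qed

lemma congr_memI:
  assumes "sm a b c d e f \<in> C"
    and "m3 x1 x2 x3 y1 y2 y3 z1 z2 z3 ** sm a b c d e f ** transpose (m3 x1 x2 x3 y1 y2 y3 z1 z2 z3) = Y"
  shows "Y \<in> congr (m3 x1 x2 x3 y1 y2 y3 z1 z2 z3) C"
  using assms unfolding congr_def by blast

lemma congr_csrd_card:
  fixes C :: "('a^3^3) set"
  assumes "C \<in> csrd_codes 2" "card C = CARD('a) ^ 3" "invertible A"
  shows "congruent_codes C (congr A C)" "congr A C \<in> csrd_codes 2" "card (congr A C) = CARD('a) ^ 3"
  using assms congr_csrd_codes_2[OF assms(3,1)] card_congr[OF assms(3), of C]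
  by (auto simp: congruent_codes_def)

lemma csrd_card_cube_facts:
  fixes C :: "('a^3^3) set"
  assumes "C \<in> csrd_codes 2" "card C = CARD('a) ^ 3"
  shows "matsp.subspace C" "C \<subseteq> Sym3"
    "sm a b c d e f \<in> C \<Longrightarrow> det (sm a b c d e f) = 0 \<Longrightarrow> a = 0 \<and> b = 0 \<and> c = 0"
    "\<exists>X\<in>C. X \<noteq> 0 \<and> det X = 0"
proof -
  show C: "matsp.subspace C" "C \<subseteq> Sym3" using assms(1) by (simp_all add: csrd_codes_2_iff)
  note * = assms(1)[unfolded csrd_code_2_card_cube_iff[OF C assms(2)]]
  show "sm a b c d e f \<in> C \<Longrightarrow> det (sm a b c d e f) = 0 \<Longrightarrow> a = 0 \<and> b = 0 \<and> c = 0"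
    using * by simp
  show "\<exists>X\<in>C. X \<noteq> 0 \<and> det X = 0" using * by simp
qed

text \<open>The nonzero singular element is alternating. A permutation makes its (1,2) entry
  nonzero, and a shear of the third coordinate clears the other two.\<close>

lemma csrd_card_cube_has_alternating:
  fixes C :: "('a^3^3) set"
  assumes C: "C \<in> csrd_codes 2" "card C = CARD('a) ^ 3"
  obtains D where "congruent_codes C D" "D \<in> csrd_codes 2" "card D = CARD('a) ^ 3" "sm 0 0 0 1 0 0 \<in> D"
proof -
  note goal = that
  have last: thesis if CD: "congruent_codes C D" "D \<in> csrd_codes 2" "card D = CARD('a) ^ 3"
    and mem: "sm 0 0 0 d e f \<in> D" and d: "d \<noteq> 0" for D d e f
  proof -
    let ?A = "m3 1 0 0 0 1 0 (f/d) (e/d) 1 :: 'a^3^3"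
    have inv: "invertible ?A" by (simp add: invertible_m3)
    have "mat_scale (1/d) (sm 0 0 0 d e f) \<in> D"
      using matsp.subspace_scale[OF csrd_card_cube_facts(1)[OF CD(2,3)] mem] .
    then have mem': "sm 0 0 0 1 (e/d) (f/d) \<in> D" using d by simp
    have "sm 0 0 0 1 0 0 \<in> congr ?A D"
      by (rule congr_memI[OF mem']) (simp add: congr_m3_sm Let_def)
    then show thesis
      using goal[of "congr ?A D"] congr_csrd_card[OF CD(2,3) inv] congruent_codes_trans[OF CD(1)] by blast
  qed
  obtain X where X: "X \<in> C" "X \<noteq> 0" "det X = 0" using csrd_card_cube_facts(4)[OF C] by blast
  then obtain a b c d e f where Xs: "X = sm a b c d e f"
    using csrd_card_cube_facts(2)[OF C] Sym3_cases by blast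
  have "a = 0 \<and> b = 0 \<and> c = 0" using csrd_card_cube_facts(3)[OF C] X Xs by blast
  then have mem: "sm 0 0 0 d e f \<in> C" and ne: "d \<noteq> 0 \<or> e \<noteq> 0 \<or> f \<noteq> 0" using X Xs by auto
  show thesis
  proof (cases "d = 0")
    case False
    then show thesis using last[OF congruent_codes_refl C mem] by blast
  next
    case d: True
    show thesis
    proof (cases "e = 0")
      case False
      let ?A = "m3 1 0 0 0 0 1 0 1 0 :: 'a^3^3"
      have inv: "invertible ?A" by (simp add: invertible_m3)
      have "sm 0 0 0 e d f \<in> congr ?A C"
        by (rule congr_memI[OF mem]) (simp add: congr_m3_sm Let_def)
      then show thesis using last[OF congr_csrd_card[OF C inv]] False by blast
    next
      case True
      then have "f \<noteq> 0" using ne d by simp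
      let ?A = "m3 0 0 1 0 1 0 1 0 0 :: 'a^3^3"
      have inv: "invertible ?A" by (simp add: invertible_m3)
      have "sm 0 0 0 f e d \<in> congr ?A C"
        by (rule congr_memI[OF mem]) (simp add: congr_m3_sm Let_def)
      then show thesis using last[OF congr_csrd_card[OF C inv]] \<open>f \<noteq> 0\<close> by blast
    qed
  qed
qed

text \<open>A multiple of the first generator clears d; after a possible swap of the first two
  coordinates a shear in them clears f and fixes the first generator.\<close>

lemma two_alternating:
  fixes C :: "('a^3^3) set"
  assumes C: "C \<in> csrd_codes 2" "card C = CARD('a) ^ 3"
    and mem1: "sm 0 0 0 1 0 0 \<in> C" and mem2: "sm 0 0 0 d e f \<in> C" and ef: "e \<noteq> 0 \<or> f \<noteq> 0"
  obtains D where "congruent_codes C D" "D \<in> csrd_codes 2" "card D = CARD('a) ^ 3"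
    "sm 0 0 0 1 0 0 \<in> D" "sm 0 0 0 0 1 0 \<in> D"
proof -
  note goal = that
  have last: thesis if CD: "congruent_codes C D" "D \<in> csrd_codes 2" "card D = CARD('a) ^ 3"
    and m1: "sm 0 0 0 1 0 0 \<in> D" and m2: "sm 0 0 0 0 e f \<in> D" and e: "e \<noteq> 0" for D e f
  proof -
    let ?A = "m3 1 0 0 (f/e) 1 0 0 0 1 :: 'a^3^3"
    have inv: "invertible ?A" by (simp add: invertible_m3)
    have "mat_scale (1/e) (sm 0 0 0 0 e f) \<in> D"
      using matsp.subspace_scale[OF csrd_card_cube_facts(1)[OF CD(2,3)] m2] .
    then have m2': "sm 0 0 0 0 1 (f/e) \<in> D" using e by simp
    have "sm 0 0 0 0 1 0 \<in> congr ?A D"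
      by (rule congr_memI[OF m2']) (simp add: congr_m3_sm Let_def)
    moreover have "sm 0 0 0 1 0 0 \<in> congr ?A D"
      by (rule congr_memI[OF m1]) (simp add: congr_m3_sm Let_def)
    ultimately show thesis
      using goal[of "congr ?A D"] congr_csrd_card[OF CD(2,3) inv] congruent_codes_trans[OF CD(1)] by blast
  qed
  have sub: "matsp.subspace C" by (rule csrd_card_cube_facts(1)[OF C])
  have mem: "sm 0 0 0 0 e f \<in> C"
    using matsp.subspace_add[OF sub mem2 matsp.subspace_scale[OF sub mem1, of d]] by simp
  show thesis
  proof (cases "e = 0")
    case False
    then show thesis using last[OF congruent_codes_refl C mem1 mem] by blast
  next
    case True
    then have f: "f \<noteq> 0" using ef by simp
    let ?A = "m3 0 1 0 1 0 0 0 0 1 :: 'a^3^3"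
    have inv: "invertible ?A" by (simp add: invertible_m3)
    have "sm 0 0 0 0 f e \<in> congr ?A C" "sm 0 0 0 1 0 0 \<in> congr ?A C"
      by (rule congr_memI[OF mem], simp add: congr_m3_sm Let_def)
        (rule congr_memI[OF mem1], simp add: congr_m3_sm Let_def)
    then show thesis using last[OF congr_csrd_card[OF C inv]] f by blast
  qed
qed

text \<open>Orthogonality to the two alternating generators forces b = c = 0, and a third generator
  has the form \<open>sm a 0 0 0 0 f\<close>. If a = 0 everything is alternating; otherwise the
  determinant a f^2 must be nonzero, and rescaling the first coordinate equalises a and f.\<close>

lemma csrd_two_alternating_cases:
  fixes C :: "('a^3^3) set"
  assumes C: "C \<in> csrd_codes 2" "card C = CARD('a) ^ 3"
    and mem1: "sm 0 0 0 1 0 0 \<in> C" and mem2: "sm 0 0 0 0 1 0 \<in> C"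
  shows "C = alt_code \<or> congruent_codes C pointed_code"
proof -
  note facts = csrd_card_cube_facts[OF C]
  have span: "sm 0 0 0 d e 0 \<in> C" for d e
    using matsp.subspace_add[OF facts(1) matsp.subspace_scale[OF facts(1) mem1, of d]
        matsp.subspace_scale[OF facts(1) mem2, of e]] by simp
  have bc: "b = 0 \<and> c = 0" if "sm a b c d e f \<in> C" for a b c d e f
    using alternating_orthogonal[OF facts(1) facts(3) mem1 that]
      alternating_orthogonal[OF facts(1) facts(3) mem2 that] by simp
  have "\<exists>a d e f. sm a 0 0 d e f \<in> C \<and> (a \<noteq> 0 \<or> f \<noteq> 0)"
  proof (rule ccontr)
    assume neg: "\<not> ?thesis"
    have "C \<subseteq> range (\<lambda>(d, e). sm 0 0 0 d e 0)"
    proof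
      fix X assume X: "X \<in> C"
      then obtain a b c d e f where Xs: "X = sm a b c d e f" using facts(2) Sym3_cases by blast
      then have "a = 0 \<and> b = 0 \<and> c = 0 \<and> f = 0" using bc[of a b c d e f] neg X by metis
      then show "X \<in> range (\<lambda>(d, e). sm 0 0 0 d e 0)" using Xs by auto
    qed
    then have "card C \<le> card (range (\<lambda>(d::'a, e). sm 0 0 0 d e 0))" by (intro card_mono) auto
    also have "\<dots> \<le> CARD('a \<times> 'a)" by (intro card_image_le) simp
    finally have "CARD('a) * CARD('a) * CARD('a) \<le> CARD('a) * CARD('a) * 1"
      using C(2) by (simp add: power3_eq_cube)
    then show False using card_ge_2 by simp
  qed
  then obtain a d e f where afm: "sm a 0 0 d e f \<in> C" and af: "a \<noteq> 0 \<or> f \<noteq> 0" by blast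
  have mem3: "sm a 0 0 0 0 f \<in> C"
    using matsp.subspace_add[OF facts(1) afm span[of d e]] by simp
  have gen: "sm (x*a) 0 0 d e (x*f) \<in> C" for x d e
    using matsp.subspace_add[OF facts(1) matsp.subspace_scale[OF facts(1) mem3, of x] span[of d e]] by simp
  show ?thesis
  proof (cases "a = 0")
    case True
    then have f: "f \<noteq> 0" using af by simp
    have "alt_code \<subseteq> C"
      unfolding alt_code_def using gen[of "_ / f"] True f by auto
    then have "alt_code = C" using C(2) card_alt_code[where 'a='a] by (intro card_subset_eq) auto
    then show ?thesis by simp
  next
    case a: False
    have f: "f \<noteq> 0" using facts(3)[OF mem3] a by (auto simp: det_sm)
    define r where "r = rt (f / a)"
    have r: "r \<noteq> 0" "r * r = f / a" using a f by (simp_all add: r_def)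
    let ?A = "m3 r 0 0 0 1 0 0 0 1 :: 'a^3^3"
    have inv: "invertible ?A" using r by (simp add: invertible_m3)
    have "pointed_code \<subseteq> congr ?A C"
    proof
      fix Y assume "Y \<in> (pointed_code :: ('a^3^3) set)"
      then obtain x d e where Y: "Y = sm x 0 0 d e x" by (auto simp: pointed_code_def)
      have "x / f * a * r * r = x" using r(2) a f by (simp add: mult.assoc)
      then show "Y \<in> congr ?A C"
        by (intro congr_memI[OF gen[of "x / f" "d / r" "e / r"]])
          (use a f r(1) in \<open>simp add: congr_m3_sm Let_def Y\<close>)
    qed
    then have "pointed_code = congr ?A C"
      using card_pointed_code[where 'a='a] congr_csrd_card(3)[OF C inv] by (intro card_subset_eq) auto
    then show ?thesis using congr_csrd_card(1)[OF C inv] by simp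
  qed
qed

text \<open>Orthogonality gives c = 0. Two elements with equal a, b, d differ by an alternating
  matrix outside the line of the given one, so by counting the projection to (a, b, d) is bijective
  and e, f are linear functions of a, b.\<close>

lemma csrd_one_alternating:
  fixes C :: "('a^3^3) set"
  assumes C: "C \<in> csrd_codes 2" "card C = CARD('a) ^ 3"
    and mem1: "sm 0 0 0 1 0 0 \<in> C"
    and one: "\<not> (\<exists>d e f. sm 0 0 0 d e f \<in> C \<and> (e \<noteq> 0 \<or> f \<noteq> 0))"
  obtains e1 e2 f1 f2 where "C = cubic_code e1 e2 f1 f2"
    "\<And>a b. cubic (f1*f1) (e1*e1) (f2*f2) (e2*e2) a b = 0 \<Longrightarrow> a = 0 \<and> b = 0"
proof -
  note facts = csrd_card_cube_facts[OF C]
  have c0: "c = 0" if "sm a b c d e f \<in> C" for a b c d e f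
    using alternating_orthogonal[OF facts(1) facts(3) mem1 that] by simp
  let ?g = "\<lambda>X::'a^3^3. (X$1$1, X$2$2, X$1$2) :: 'a \<times> 'a \<times> 'a"
  have "inj_on ?g C"
  proof (rule inj_onI)
    fix X Y assume X: "X \<in> C" and Y: "Y \<in> C" and eq: "?g X = ?g Y"
    obtain a b c d e f where Xs: "X = sm a b c d e f" using X facts(2) Sym3_cases by blast
    obtain a' b' c' d' e' f' where Ys: "Y = sm a' b' c' d' e' f'" using Y facts(2) Sym3_cases by blast
    have eqs: "a' = a" "b' = b" "d' = d" using eq by (simp_all add: Xs Ys)
    have cs: "c = 0" "c' = 0" using c0 X Y Xs Ys by blast+
    have "sm 0 0 0 0 (e + e') (f + f') \<in> C"
      using matsp.subspace_add[OF facts(1) X Y] by (simp add: Xs Ys eqs cs)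
    then have "e + e' = 0 \<and> f + f' = 0" using one by blast
    then show "X = Y" by (simp add: Xs Ys eqs cs)
  qed
  then have "card (?g ` C) = CARD('a \<times> 'a \<times> 'a)" using C(2) by (simp add: card_image power3_eq_cube)
  then have surj: "?g ` C = UNIV" by (rule card_subset_eq[OF finite subset_UNIV])
  have ex: "\<exists>e f. sm a b 0 d e f \<in> C" for a b d
  proof -
    have "(a, b, d) \<in> ?g ` C" using surj by blast
    then obtain X where X: "X \<in> C" "(a, b, d) = ?g X" by (rule imageE)
    obtain a' b' c' d' e' f' where Xs: "X = sm a' b' c' d' e' f'" using X facts(2) Sym3_cases by blast
    have "a' = a" "b' = b" "d' = d" using X(2) by (simp_all add: Xs)
    moreover have "c' = 0" using X(1) c0 unfolding Xs by blast
    moreover note X(1)[unfolded Xs]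
    ultimately show ?thesis by blast
  qed
  obtain e1 f1 where m1: "sm 1 0 0 0 e1 f1 \<in> C" using ex by blast
  obtain e2 f2 where m2: "sm 0 1 0 0 e2 f2 \<in> C" using ex by blast
  have gen: "sm a b 0 d (e1*a + e2*b) (f1*a + f2*b) \<in> C" for a b d
    using matsp.subspace_add[OF facts(1) matsp.subspace_scale[OF facts(1) mem1, of d]
        matsp.subspace_add[OF facts(1) matsp.subspace_scale[OF facts(1) m1, of a]
          matsp.subspace_scale[OF facts(1) m2, of b]]] by (simp add: mult.commute)
  then have "cubic_code e1 e2 f1 f2 \<subseteq> C" by (auto simp: cubic_code_def)
  then have "cubic_code e1 e2 f1 f2 = C"
    using C(2) card_cubic_code[of e1 e2 f1 f2] by (intro card_subset_eq) auto
  moreover have "a = 0 \<and> b = 0" if "cubic (f1*f1) (e1*e1) (f2*f2) (e2*e2) a b = 0" for a b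
  proof -
    have "det (sm a b 0 0 (e1*a + e2*b) (f1*a + f2*b)) = cubic (f1*f1) (e1*e1) (f2*f2) (e2*e2) a b"
      by (simp add: det_sm cubic_def algebra_simps)
    then show ?thesis using facts(3)[OF gen[of a b 0]] that by simp
  qed
  ultimately show thesis using that by blast
qed

lemma linear_form_in_basis:
  fixes u v a b c d :: 'a
  assumes "a * d + b * c \<noteq> 0"
  obtains s t where "\<And>x y. u * x + v * y = s * (a * x + b * y) + t * (c * x + d * y)"
proof -
  let ?D = "a * d + b * c"
  have "u * x + v * y = (u * d + v * c) / ?D * (a * x + b * y) + (u * b + v * a) / ?D * (c * x + d * y)" for x y
  proof -
    have "(u * d + v * c) * (a * x + b * y) + (u * b + v * a) * (c * x + d * y) = (u * x + v * y) * ?D"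
      by (simp add: algebra_simps)
    moreover have "(u * d + v * c) / ?D * (a * x + b * y) + (u * b + v * a) / ?D * (c * x + d * y) =
        ((u * d + v * c) * (a * x + b * y) + (u * b + v * a) * (c * x + d * y)) / ?D"
      by (simp only: times_divide_eq_left add_divide_distrib[symmetric])
    ultimately show ?thesis using assms by simp
  qed
  then show thesis by (rule that)
qed

text \<open>The values at (1, 1) and at (x, 1) with x different from 0 and 1 separate the middle
  coefficients. Such an x is essential: over two elements x^2 y and x y^2 are the same
  function.\<close>

lemma cubic_coeffs_eq:
  fixes p0 p1 p2 p3 r0 r1 r2 r3 :: 'a
  assumes q: "CARD('a) \<ge> 3" and eq: "\<And>x y. cubic p0 p1 p2 p3 x y = cubic r0 r1 r2 r3 x y"
  shows "p0 = r0 \<and> p1 = r1 \<and> p2 = r2 \<and> p3 = r3"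
proof -
  have 0: "p0 = r0" using eq[of 1 0] by (simp add: cubic_def)
  have 3: "p3 = r3" using eq[of 0 1] by (simp add: cubic_def)
  obtain x :: 'a where x: "x \<noteq> 0" "x \<noteq> 1"
  proof -
    have "{0, 1::'a} \<noteq> UNIV"
    proof
      assume "{0, 1::'a} = UNIV"
      then have "CARD('a) = card {0, 1::'a}" by (simp only:)
      then show False using q by simp
    qed
    then show thesis using that by blast
  qed
  have 1: "p1 + p2 = r1 + r2" using eq[of 1 1] by (simp add: cubic_def 0 3 add.assoc)
  have "x * (p1 * x + p2) = x * (r1 * x + r2)"
    using eq[of x 1] by (simp add: cubic_def 0 3 algebra_simps)
  then have 2: "p1 * x + p2 = r1 * x + r2" using x by simp
  have "(p1 + r1) * (x + 1) = (p1 * x + p2) + (r1 * x + r2) + ((p1 + p2) + (r1 + r2))"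
    by (simp add: algebra_simps)
  also have "\<dots> = 0" unfolding 1 2 by simp
  finally have "p1 = r1" using x by simp
  then show ?thesis using 0 1 3 by simp
qed

text \<open>Since c = 0 and 2 = 0, a block congruence acts on the diagonal entries (a, b) through
  the squares of the entries of its 2 x 2 block. That block is therefore the entrywise square root
  of the substitution relating the two cubics.\<close>

lemma cubic_code_congruent:
  fixes e1 e2 f1 f2 e1' e2' f1' f2' :: 'a
  assumes card: "CARD('a) = 2 ^ h" and q: "CARD('a) \<ge> 3"
    and p: "\<And>a b. cubic (f1*f1) (e1*e1) (f2*f2) (e2*e2) a b = 0 \<Longrightarrow> a = 0 \<and> b = 0"
    and r: "\<And>a b. cubic (f1'*f1') (e1'*e1') (f2'*f2') (e2'*e2') a b = 0 \<Longrightarrow> a = 0 \<and> b = 0"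
  shows "congruent_codes (cubic_code e1 e2 f1 f2) (cubic_code e1' e2' f1' f2')"
proof -
  obtain a0 b0 c0 d0 s0 where det0: "a0 * d0 + b0 * c0 \<noteq> 0" and s0: "s0 \<noteq> 0"
    and eq0: "\<And>x y. cubic (f1'*f1') (e1'*e1') (f2'*f2') (e2'*e2') (a0*x + b0*y) (c0*x + d0*y) =
      s0 * cubic (f1*f1) (e1*e1) (f2*f2) (e2*e2) x y"
    using cubic_equivalent[OF card, of "f1*f1" "e1*e1" "f2*f2" "e2*e2" "f1'*f1'" "e1'*e1'" "f2'*f2'" "e2'*e2'"]
      p r by (metis (no_types, lifting))
  define al be ga de where "al = rt a0" and "be = rt b0" and "ga = rt c0" and "de = rt d0"
  have sq: "a0 = al * al" "b0 = be * be" "c0 = ga * ga" "d0 = de * de"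
    by (simp_all add: al_def be_def ga_def de_def)
  define n where "n = al * de + be * ga"
  have n2: "n * n = a0 * d0 + b0 * c0" by (simp add: n_def sq algebra_simps)
  then have n: "n \<noteq> 0" using det0 by auto
  \<comment> \<open>The congruence multiplies determinants by (s n)^2, which has to be the factor s0
    between the cubics.\<close>
  define s where "s = rt s0 / n"
  have s: "s \<noteq> 0" "s * n * (s * n) = s0" using n s0 by (simp_all add: s_def)
  obtain E1 E2 where E: "\<And>x y. s * (al * e1 + be * f1) * x + s * (al * e2 + be * f2) * y =
      E1 * (a0*x + b0*y) + E2 * (c0*x + d0*y)" using linear_form_in_basis[OF det0] by blast
  obtain F1 F2 where F: "\<And>x y. s * (ga * e1 + de * f1) * x + s * (ga * e2 + de * f2) * y =
      F1 * (a0*x + b0*y) + F2 * (c0*x + d0*y)" using linear_form_in_basis[OF det0] by blast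
  have solve: "\<exists>x y. a0*x + b0*y = x' \<and> c0*x + d0*y = y'" for x' y'
  proof -
    let ?D = "a0 * d0 + b0 * c0"
    have "a0 * ((d0*x' + b0*y') / ?D) + b0 * ((c0*x' + a0*y') / ?D) = x' * ?D / ?D"
      "c0 * ((d0*x' + b0*y') / ?D) + d0 * ((c0*x' + a0*y') / ?D) = y' * ?D / ?D"
      by (simp_all add: add_divide_distrib[symmetric] algebra_simps)
    then show ?thesis using det0 by (metis nonzero_mult_div_cancel_right)
  qed
  have "cubic (F1*F1) (E1*E1) (F2*F2) (E2*E2) x' y' = cubic (f1'*f1') (e1'*e1') (f2'*f2') (e2'*e2') x' y'" for x' y'
  proof -
    obtain x y where xy: "a0*x + b0*y = x'" "c0*x + d0*y = y'" using solve by blast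
    let ?e = "e1*x + e2*y" and ?f = "f1*x + f2*y"
    have e': "E1 * x' + E2 * y' = s * (al * ?e + be * ?f)" using E[of x y] by (simp add: xy algebra_simps)
    have f': "F1 * x' + F2 * y' = s * (ga * ?e + de * ?f)" using F[of x y] by (simp add: xy algebra_simps)
    have "cubic (F1*F1) (E1*E1) (F2*F2) (E2*E2) x' y' =
        x' * ((F1 * x' + F2 * y') * (F1 * x' + F2 * y')) + y' * ((E1 * x' + E2 * y') * (E1 * x' + E2 * y'))"
      by (simp add: cubic_def algebra_simps)
    also have "\<dots> = s * n * (s * n) * (x * (?f * ?f) + y * (?e * ?e))"
    proof -
      have "(al*al*x + be*be*y) * ((s * (ga*e + de*f)) * (s * (ga*e + de*f))) +
          (ga*ga*x + de*de*y) * ((s * (al*e + be*f)) * (s * (al*e + be*f))) =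
          s * n * (s * n) * (x * (f * f) + y * (e * e))" for e f
        by (simp add: n_def algebra_simps)
      then show ?thesis unfolding e' f' unfolding xy[symmetric] sq .
    qed
    also have "\<dots> = s0 * cubic (f1*f1) (e1*e1) (f2*f2) (e2*e2) x y"
      unfolding s(2) by (simp add: cubic_def algebra_simps)
    also have "\<dots> = cubic (f1'*f1') (e1'*e1') (f2'*f2') (e2'*e2') x' y'"
      using eq0[of x y] by (simp add: xy)
    finally show ?thesis .
  qed
  \<comment> \<open>The determinants agree as cubic forms; their coefficients are squares, so the
    linear forms for the entries e and f agree too.\<close>
  from cubic_coeffs_eq[OF q this] have EF: "F1 = f1'" "E1 = e1'" "F2 = f2'" "E2 = e2'" by simp_all
  let ?A = "m3 al be 0 ga de 0 0 0 s"
  have inv: "invertible ?A"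
  proof -
    have "n * s \<noteq> 0" using n s by simp
    then show ?thesis by (simp add: invertible_m3 n_def distrib_right)
  qed
  have "congr ?A (cubic_code e1 e2 f1 f2) \<subseteq> cubic_code e1' e2' f1' f2'"
  proof
    fix Y assume "Y \<in> congr ?A (cubic_code e1 e2 f1 f2)"
    then obtain a b d where Y: "Y = ?A ** sm a b 0 d (e1*a + e2*b) (f1*a + f2*b) ** transpose ?A"
      by (auto simp: congr_def cubic_code_def)
    have "\<exists>d'. Y = sm (a0*a + b0*b) (c0*a + d0*b) 0 d'
        (s * (al * e1 + be * f1) * a + s * (al * e2 + be * f2) * b)
        (s * (ga * e1 + de * f1) * a + s * (ga * e2 + de * f2) * b)"
      unfolding Y congr_m3_sm Let_def by (simp add: sq algebra_simps)
    then obtain d' where "Y = sm (a0*a + b0*b) (c0*a + d0*b) 0 d'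
        (e1' * (a0*a + b0*b) + e2' * (c0*a + d0*b)) (f1' * (a0*a + b0*b) + f2' * (c0*a + d0*b))"
      unfolding E F EF by blast
    then show "Y \<in> cubic_code e1' e2' f1' f2'"
      unfolding cubic_code_def by (intro image_eqI[of _ _ "(a0*a + b0*b, c0*a + d0*b, d')"]) simp_all
  qed
  then have "congr ?A (cubic_code e1 e2 f1 f2) = cubic_code e1' e2' f1' f2'"
    using card_congr[OF inv, of "cubic_code e1 e2 f1 f2"] card_cubic_code[of e1 e2 f1 f2]
      card_cubic_code[of e1' e2' f1' f2'] by (intro card_subset_eq) auto
  then show ?thesis using inv unfolding congruent_codes_def by metis
qed

end

section \<open>The six representatives\<close>

context char2_field
begin

text \<open>The map x^3 + x takes the value 0 twice and so misses some t; then x^3 + x y^2 + t y^3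
  has no zeros. The coefficients are written as products to match the shape required for
  \<open>cubic_code 0 s 1 1\<close>.\<close>

lemma exists_zero_free_cubic:
  obtains s :: 'a where "\<And>a b. cubic (1*1) (0*0) (1*1) (s * s) a b = 0 \<Longrightarrow> a = 0 \<and> b = 0"
proof -
  let ?p = "\<lambda>x::'a. x * x * x + x"
  have "\<not> inj ?p"
  proof
    assume "inj ?p"
    then have "(0::'a) = 1" by (rule injD) simp
    then show False by simp
  qed
  then have "\<not> surj ?p" using finite_UNIV_surj_inj[of ?p] by auto
  then obtain t where t: "t \<notin> range ?p" by blast
  have "a = 0 \<and> b = 0" if eq: "cubic (1*1) (0*0) (1*1) (rt t * rt t) a b = 0" for a b
  proof (cases "b = 0")
    case True
    then show ?thesis using eq by (simp add: cubic_def)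
  next
    case False
    have "(?p (a / b) + t) * (b * b * b) = cubic (1*1) (0*0) (1*1) (rt t * rt t) a b"
      using False by (simp add: cubic_def field_simps)
    then have "?p (a / b) = t" using eq False by simp
    then show ?thesis using t by blast
  qed
  then show thesis by (rule that)
qed

lemma alt_code_csrd: "(alt_code :: ('a^3^3) set) \<in> csrd_codes 2"
proof -
  have sub: "(alt_code :: ('a^3^3) set) \<subseteq> Sym3" by (auto simp: alt_code_def)
  have mem: "sm 0 0 0 1 0 0 \<in> (alt_code :: ('a^3^3) set)"
    unfolding alt_code_def by (rule image_eqI[of _ _ "(1, 0, 0)"]) simp_all
  have "\<exists>X\<in>alt_code. X \<noteq> 0 \<and> det X = (0::'a)"
    by (rule bexI[OF _ mem]) (simp add: det_sm)
  then show ?thesis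
    unfolding csrd_code_2_card_cube_iff[OF subspace_alt_code sub card_alt_code]
    by (auto simp: alt_code_def)
qed

lemma pointed_code_csrd: "(pointed_code :: ('a^3^3) set) \<in> csrd_codes 2"
proof -
  have sub: "(pointed_code :: ('a^3^3) set) \<subseteq> Sym3" by (auto simp: pointed_code_def)
  have mem: "sm 0 0 0 1 0 0 \<in> (pointed_code :: ('a^3^3) set)"
    unfolding pointed_code_def by (rule image_eqI[of _ _ "(0, 1, 0)"]) simp_all
  have "\<exists>X\<in>pointed_code. X \<noteq> 0 \<and> det X = (0::'a)"
    by (rule bexI[OF _ mem]) (simp add: det_sm)
  then show ?thesis
    unfolding csrd_code_2_card_cube_iff[OF subspace_pointed_code sub card_pointed_code]
    by (auto simp: pointed_code_def det_sm)
qed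

lemma det_cubic_code:
  "det (sm a b 0 d (e1*a + e2*b) (f1*a + f2*b)) = cubic (f1*f1) (e1*e1) (f2*f2) (e2*e2) a (b::'a)"
  by (simp add: det_sm cubic_def algebra_simps)

lemma cubic_code_csrd:
  fixes e1 e2 f1 f2 :: 'a
  assumes p: "\<And>a b. cubic (f1*f1) (e1*e1) (f2*f2) (e2*e2) a b = 0 \<Longrightarrow> a = 0 \<and> b = 0"
  shows "cubic_code e1 e2 f1 f2 \<in> csrd_codes 2"
proof -
  have sub: "cubic_code e1 e2 f1 f2 \<subseteq> Sym3" by (auto simp: cubic_code_def)
  have mem: "sm 0 0 0 1 0 0 \<in> cubic_code e1 e2 f1 f2"
    unfolding cubic_code_def by (rule image_eqI[of _ _ "(0, 0, 1)"]) simp_all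
  have 1: "\<exists>X\<in>cubic_code e1 e2 f1 f2. X \<noteq> 0 \<and> det X = 0"
    by (rule bexI[OF _ mem]) (simp add: det_sm)
  have 2: "a = 0 \<and> b = 0 \<and> c = 0"
    if m: "sm a b c d e f \<in> cubic_code e1 e2 f1 f2" and det: "det (sm a b c d e f) = 0" for a b c d e f
  proof -
    have eqs: "c = 0" "e = e1*a + e2*b" "f = f1*a + f2*b" using m by (auto simp: cubic_code_def)
    have "cubic (f1*f1) (e1*e1) (f2*f2) (e2*e2) a b = 0"
      using det unfolding eqs det_cubic_code .
    then have "a = 0 \<and> b = 0" by (rule p)
    then show ?thesis using eqs by simp
  qed
  show ?thesis
    unfolding csrd_code_2_card_cube_iff[OF subspace_cubic_code sub card_cubic_code]
    using 1 2 by simp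
qed

section \<open>Numbers of singular matrices in the representatives\<close>

lemma singular_alt_code: "card {X \<in> (alt_code :: ('a^3^3) set). det X = 0} = CARD('a) ^ 3"
proof -
  have "det X = 0" if "X \<in> alt_code" for X :: "'a^3^3"
    using that by (auto simp: alt_code_def det_sm)
  then have "{X \<in> (alt_code :: ('a^3^3) set). det X = 0} = alt_code" by blast
  then show ?thesis by (simp add: card_alt_code)
qed

lemma singular_pointed_code: "card {X \<in> (pointed_code :: ('a^3^3) set). det X = 0} = CARD('a) ^ 2"
proof -
  have "{X \<in> (pointed_code :: ('a^3^3) set). det X = 0} = range (\<lambda>(d, e). sm 0 0 0 d e 0)"
    by (auto simp: pointed_code_def det_sm image_iff)
  moreover have "inj (\<lambda>(d::'a, e). sm 0 0 0 d e 0)" by (auto intro: injI)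
  ultimately show ?thesis by (simp add: card_image power2_eq_square)
qed

lemma singular_cubic_code:
  fixes e1 e2 f1 f2 :: 'a
  assumes p: "\<And>a b. cubic (f1*f1) (e1*e1) (f2*f2) (e2*e2) a b = 0 \<Longrightarrow> a = 0 \<and> b = 0"
  shows "card {X \<in> cubic_code e1 e2 f1 f2. det X = 0} = CARD('a)"
proof -
  have "{X \<in> cubic_code e1 e2 f1 f2. det X = 0} = range (\<lambda>d. sm 0 0 0 d 0 0)"
  proof (intro equalityI subsetI)
    fix X assume "X \<in> {X \<in> cubic_code e1 e2 f1 f2. det X = 0}"
    then obtain a b d where X: "X = sm a b 0 d (e1*a + e2*b) (f1*a + f2*b)" and "det X = 0"
      by (auto simp: cubic_code_def)
    then have "cubic (f1*f1) (e1*e1) (f2*f2) (e2*e2) a b = 0" by (simp only: det_cubic_code)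
    then have "a = 0 \<and> b = 0" by (rule p)
    then show "X \<in> range (\<lambda>d. sm 0 0 0 d 0 0)" by (simp add: X)
  next
    fix X assume "X \<in> range (\<lambda>d::'a. sm 0 0 0 d 0 0)"
    then obtain d where X: "X = sm 0 0 0 d 0 0" by blast
    then show "X \<in> {X \<in> cubic_code e1 e2 f1 f2. det X = 0}"
      unfolding cubic_code_def by (auto simp: det_sm intro!: image_eqI[of _ _ "(0, 0, d)"])
  qed
  moreover have "inj (\<lambda>d::'a. sm 0 0 0 d 0 0)" by (auto intro: injI)
  ultimately show ?thesis by (simp add: card_image)
qed

abbreviation elliptic_code :: "'a \<Rightarrow> 'a \<Rightarrow> 'a \<Rightarrow> ('a^3^3) set" where
  "elliptic_code c r k \<equiv> pencil_code (1, c, 0, 1, 0, 0) (r, 0, 1, 0, 0, k)"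

lemma elliptic_code_eq:
  "elliptic_code c r k = range (\<lambda>(a, b, e, f). sm a b (r*a + k*f) (a + c*b) e f)"
proof (intro equalityI subsetI)
  fix X assume X: "X \<in> elliptic_code c r k"
  then obtain a b g d e f where Xs: "X = sm a b g d e f"
    by (auto simp: pencil_code_def elim: Sym3_cases)
  have d: "a + c*b + d = 0" and g: "r*a + g + k*f = 0" using X by (simp_all add: pencil_code_def Xs)
  have "g = r*a + k*f + (r*a + g + k*f)" by (simp add: add_ac)
  then have "g = r*a + k*f" unfolding g by simp
  moreover have "d = a + c*b" using d by simp
  ultimately show "X \<in> range (\<lambda>(a, b, e, f). sm a b (r*a + k*f) (a + c*b) e f)"
    unfolding Xs by (intro image_eqI[of _ _ "(a, b, e, f)"]) simp_all
next
  fix X assume "X \<in> range (\<lambda>(a, b, e, f). sm a b (r*a + k*f) (a + c*b) e f)"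
  then obtain a b e f where "X = sm a b (r*a + k*f) (a + c*b) e f" by auto
  then show "X \<in> elliptic_code c r k" by (simp add: pencil_code_def add_ac)
qed

lemma inj_elliptic_param: "inj (\<lambda>(a::'a, b, e, f). sm a b (r*a + k*f) (a + c*b) e f)"
  by (auto intro: injI)

lemma card_elliptic_code: "card (elliptic_code c r k) = CARD('a) ^ 4"
  unfolding elliptic_code_eq using inj_elliptic_param by (simp add: card_image eval_nat_numeral)

lemma elliptic_form_anisotropic:
  fixes c x y :: 'a
  assumes c: "\<And>u. u * u + u \<noteq> c" and eq: "x*x + x*y + c*y*y = 0"
  shows "x = 0 \<and> y = 0"
proof (cases "y = 0")
  case True
  then show ?thesis using eq by simp
next
  case False
  have "((x / y) * (x / y) + x / y + c) * (y * y) = x*x + x*y + c*y*y"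
    using False by (simp add: field_simps)
  then have "(x / y) * (x / y) + x / y = c" using eq False by simp
  then show ?thesis using c by blast
qed

lemma elliptic_code_csrd:
  assumes c: "\<And>u. u * u + u \<noteq> c"
  shows "elliptic_code c r k \<in> csrd_codes 2"
proof -
  have no: "v = 0" if v: "outer v \<in> elliptic_code c r k" for v
  proof -
    have "v$1 * v$1 + v$1 * v$2 + c * v$2 * v$2 = 0"
      using v by (simp add: pencil_code_def outer_sm algebra_simps)
    then have "v$1 = 0 \<and> v$2 = 0" by (rule elliptic_form_anisotropic[OF c])
    moreover from this have "v$3 = 0" using v by (simp add: pencil_code_def outer_sm)
    ultimately show ?thesis by (simp add: vec_eq_iff forall_3)
  qed
  have mem: "sm 0 0 0 0 1 0 \<in> elliptic_code c r k" by (simp add: pencil_code_def)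
  have "\<exists>X\<in>elliptic_code c r k. X \<noteq> 0 \<and> det X = 0"
    by (rule bexI[OF _ mem]) (simp add: det_sm)
  moreover have "elliptic_code c r k \<subseteq> Sym3" by (auto simp: pencil_code_def)
  ultimately show ?thesis
    unfolding csrd_codes_2_iff using no subspace_pencil_code pencil_code_covers[OF no] by simp
qed

text \<open>The variable e occurs only in b e^2: for b \<noteq> 0 it is determined by a square root,
  and for b = 0 it is free.\<close>

lemma card_zeros_square_linear:
  fixes G :: "'a \<Rightarrow> 'a \<Rightarrow> 'a \<Rightarrow> 'a"
  shows "card {(a, b, e, f). G a b f + b*e*e = 0} =
    CARD('a) * ((CARD('a) - 1) * CARD('a)) + card {(a, f). G a 0 f = 0} * CARD('a)"
proof -
  let ?g = "\<lambda>(a, b, f). (a, b, rt (G a b f / b), f)"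
  let ?h = "\<lambda>((a, f), e). (a, 0::'a, e::'a, f)"
  let ?A = "(UNIV :: 'a set) \<times> (UNIV - {0::'a}) \<times> (UNIV :: 'a set)"
  let ?B = "{(a, f). G a 0 f = 0} \<times> (UNIV :: 'a set)"
  have "{(a, b, e, f). G a b f + b*e*e = 0} = ?g ` ?A \<union> ?h ` ?B"
  proof (intro equalityI subsetI)
    fix z assume "z \<in> {(a, b, e, f). G a b f + b*e*e = 0}"
    then obtain a b e f where z: "z = (a, b, e, f)" and eq: "G a b f = b*e*e" by auto
    show "z \<in> ?g ` ?A \<union> ?h ` ?B"
    proof (cases "b = 0")
      case True
      then show ?thesis using eq z by (intro UnI2 image_eqI[of _ _ "((a, f), e)"]) auto
    next
      case False
      then have "rt (G a b f / b) * rt (G a b f / b) = e * e" using eq by simp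
      then have "e = rt (G a b f / b)" by (simp only: square_eq_iff)
      then show ?thesis using z False by (intro UnI1 image_eqI[of _ _ "(a, b, f)"]) auto
    qed
  next
    fix z assume "z \<in> ?g ` ?A \<union> ?h ` ?B"
    then show "z \<in> {(a, b, e, f). G a b f + b*e*e = 0}"
    proof
      assume "z \<in> ?g ` ?A"
      then obtain a b f where z: "z = (a, b, rt (G a b f / b), f)" and b: "b \<noteq> 0" by auto
      have "b * rt (G a b f / b) * rt (G a b f / b) = G a b f"
        unfolding mult.assoc rt_mult_self using b by simp
      then show ?thesis unfolding z by simp
    qed auto
  qed
  moreover have "card (?g ` ?A) = CARD('a) * ((CARD('a) - 1) * CARD('a))"
    by (subst card_image) (auto simp: inj_on_def card_cartesian_product card_Diff_singleton)
  moreover have "card (?h ` ?B) = card {(a, f). G a 0 f = 0} * CARD('a)"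
    by (subst card_image) (auto simp: inj_on_def card_cartesian_product)
  moreover have "?g ` ?A \<inter> ?h ` ?B = {}" by auto
  ultimately show ?thesis by (simp add: card_Un_disjoint)
qed

lemma singular_elliptic_code:
  "card {X \<in> elliptic_code c r k. det X = 0} = CARD('a) * ((CARD('a) - 1) * CARD('a)) +
    card {(a, f). a*f*f + (r*a + k*f)*a*a = 0} * CARD('a)"
proof -
  let ?s = "\<lambda>(a, b, e, f). sm a b (r*a + k*f) (a + c*b) e f"
  let ?G = "\<lambda>a b f. a*b*(r*a + k*f) + a*f*f + (r*a + k*f)*(a + c*b)*(a + c*b)"
  have det: "det (?s (a, b, e, f)) = ?G a b f + b*e*e" for a b e f
    by (simp add: det_sm add_ac)
  have "{X \<in> elliptic_code c r k. det X = 0} = ?s ` {(a, b, e, f). ?G a b f + b*e*e = 0}"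
    unfolding elliptic_code_eq
  proof (intro equalityI subsetI)
    fix X assume "X \<in> {X \<in> range ?s. det X = 0}"
    then obtain a b e f where X: "X = ?s (a, b, e, f)" and "det X = 0" by auto
    then have "?G a b f + b*e*e = 0" by (simp only: det)
    then show "X \<in> ?s ` {(a, b, e, f). ?G a b f + b*e*e = 0}"
      unfolding X by (intro imageI) simp
  next
    fix X assume "X \<in> ?s ` {(a, b, e, f). ?G a b f + b*e*e = 0}"
    then obtain a b e f where X: "X = ?s (a, b, e, f)" and "?G a b f + b*e*e = 0" by auto
    then have "det X = 0" by (simp only: det)
    then show "X \<in> {X \<in> range ?s. det X = 0}" using X by blast
  qed
  then have "card {X \<in> elliptic_code c r k. det X = 0} = card {(a, b, e, f). ?G a b f + b*e*e = 0}"
    by (simp only: card_image[OF inj_on_subset[OF inj_elliptic_param subset_UNIV]])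
  also have "\<dots> = CARD('a) * ((CARD('a) - 1) * CARD('a)) + card {(a, f). ?G a 0 f = 0} * CARD('a)"
    by (rule card_zeros_square_linear)
  finally show ?thesis by simp
qed

text \<open>At b = 0 the three determinants are a (f^2 + f a + c a^2), a f^2 and a f (f + a) in the
  (a, f) plane; their zeros form one, two and three lines through the origin.\<close>

lemma singular_elliptic_codes_distinct:
  assumes c: "\<And>u. u * u + u \<noteq> c"
  shows "card {X \<in> elliptic_code c c 1. det X = 0} < card {X \<in> elliptic_code c 0 0. det X = 0}"
    and "card {X \<in> elliptic_code c 0 0. det X = 0} < card {X \<in> elliptic_code c 0 1. det X = 0}"
proof -
  let ?M = "\<lambda>r k. {(a::'a, f). a*f*f + (r*a + k*f)*a*a = 0}"
  have q: "CARD('a) > 0" by simp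
  have "?M c 1 \<subset> ?M 0 0"
  proof -
    have "a = 0" if "a*f*f + (c*a + 1*f)*a*a = 0" for a f
    proof (rule ccontr)
      assume a: "a \<noteq> 0"
      have "a * (f*f + f*a + c*a*a) = a*f*f + (c*a + 1*f)*a*a" by (simp add: algebra_simps)
      then have "a * (f*f + f*a + c*a*a) = 0" by (simp only: that)
      then have "f*f + f*a + c*a*a = 0" using a by (simp only: mult_eq_0_iff) simp
      then show False using elliptic_form_anisotropic[OF c] a by blast
    qed
    then have "?M c 1 \<subseteq> ?M 0 0" by auto
    moreover have "(1, 0) \<in> ?M 0 0" by simp
    moreover have "(1, 0) \<notin> ?M c 1" using c[of 0] by auto
    ultimately show ?thesis by blast
  qed
  then have "card (?M c 1) < card (?M 0 0)" by (intro psubset_card_mono) auto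
  then show "card {X \<in> elliptic_code c c 1. det X = 0} < card {X \<in> elliptic_code c 0 0. det X = 0}"
    unfolding singular_elliptic_code using q by simp
  have "?M 0 0 \<subset> ?M 0 1"
  proof -
    have "?M 0 0 \<subseteq> ?M 0 1" by auto
    moreover have "(1, 1) \<in> ?M 0 1" by simp
    moreover have "(1, 1) \<notin> ?M 0 0" by simp
    ultimately show ?thesis by blast
  qed
  then have "card (?M 0 0) < card (?M 0 1)" by (intro psubset_card_mono) auto
  then show "card {X \<in> elliptic_code c 0 0. det X = 0} < card {X \<in> elliptic_code c 0 1. det X = 0}"
    unfolding singular_elliptic_code using q by simp
qed

text \<open>The size is a power of q, so below q^4 only q^3 remains. From q^4 on, a subspace
  \<open>T\<close> of size q^4 covers everything; X and \<open>X + outer v\<close> both in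
  \<open>C\<close> force v = 0, so X lies in \<open>T\<close>.\<close>

lemma csrd_code_2_card_cases:
  assumes C: "(C :: ('a^3^3) set) \<in> csrd_codes 2"
  shows "card C = CARD('a) ^ 3 \<or> (\<exists>Q R. C = pencil_code Q R)"
proof (cases "CARD('a) ^ 4 \<le> card C")
  case False
  have "matsp.subspace C" using C by (simp add: csrd_codes_2_iff)
  then have "card C = CARD('a) ^ matsp.dim C" by (rule card_subspace)
  moreover have "CARD('a) ^ 3 \<le> card C" by (rule csrd_code_2_card_ge[OF C])
  ultimately have "CARD('a) ^ 3 \<le> CARD('a) ^ matsp.dim C" "CARD('a) ^ matsp.dim C < CARD('a) ^ 4"
    using False by simp_all
  then have "3 \<le> matsp.dim C" "matsp.dim C < 4"
    using card_ge_2 by (simp_all add: power_increasing_iff power_strict_increasing_iff)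
  then have "matsp.dim C = 3" by simp
  then show ?thesis using \<open>card C = CARD('a) ^ matsp.dim C\<close> by simp
next
  case True
  have C': "matsp.subspace C" "C \<subseteq> Sym3" "\<And>v. outer v \<in> C \<Longrightarrow> v = 0"
    using C by (simp_all add: csrd_codes_2_iff)
  obtain T where T: "T \<subseteq> C" "matsp.subspace T" "card T = CARD('a) ^ 4"
    using subspace_with_card[OF C'(1) True] card_ge_2 by auto
  have "T \<subseteq> Sym3" using T C' by blast
  from subspace_card_4_eq_pencil_code[OF T(2) this T(3)] obtain Q R where QR: "T = pencil_code Q R" .
  have no: "v = 0" if "outer v \<in> pencil_code Q R" for v using that C'(3) T(1) QR by blast
  have "X \<in> T" if X: "X \<in> C" for X
  proof -
    have "X \<in> Sym3" using X C'(2) by blast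
    then obtain v where v: "X + outer v \<in> T" using pencil_code_covers[OF no] QR by blast
    then have "X + (X + outer v) \<in> C" using matsp.subspace_add[OF C'(1) X] T(1) by blast
    then have "v = 0" using C'(3) by simp
    then show ?thesis using v by simp
  qed
  then have "C = T" using T(1) by blast
  then show ?thesis using QR by blast
qed

lemma csrd_code_2_classification:
  fixes C :: "('a^3^3) set"
  assumes card: "CARD('a) = 2 ^ h" and q: "CARD('a) \<ge> 3" and c: "\<And>u. u * u + u \<noteq> c"
    and s: "\<And>a b. cubic (1*1) (0*0) (1*1) (s * s) a b = 0 \<Longrightarrow> a = 0 \<and> b = 0"
    and C: "C \<in> csrd_codes 2"
  shows "\<exists>R\<in>{alt_code, pointed_code, cubic_code 0 s 1 1,
    elliptic_code c 0 0, elliptic_code c 0 1, elliptic_code c c 1}. congruent_codes C R"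
  using csrd_code_2_card_cases[OF C]
proof
  assume C3: "card C = CARD('a) ^ 3"
  obtain D where D: "congruent_codes C D" "D \<in> csrd_codes 2" "card D = CARD('a) ^ 3" "sm 0 0 0 1 0 0 \<in> D"
    by (rule csrd_card_cube_has_alternating[OF C C3])
  show ?thesis
  proof (cases "\<exists>d e f. sm 0 0 0 d e f \<in> D \<and> (e \<noteq> 0 \<or> f \<noteq> 0)")
    case True
    then obtain d e f where m: "sm 0 0 0 d e f \<in> D" "e \<noteq> 0 \<or> f \<noteq> 0" by blast
    obtain E where E: "congruent_codes D E" "E \<in> csrd_codes 2" "card E = CARD('a) ^ 3"
        "sm 0 0 0 1 0 0 \<in> E" "sm 0 0 0 0 1 0 \<in> E"
      by (rule two_alternating[OF D(2-4) m])
    have "congruent_codes C E" by (rule congruent_codes_trans[OF D(1) E(1)])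
    moreover have "E = alt_code \<or> congruent_codes E pointed_code"
      by (rule csrd_two_alternating_cases[OF E(2-5)])
    ultimately have "congruent_codes C alt_code \<or> congruent_codes C pointed_code"
      using congruent_codes_trans[of C E pointed_code] by auto
    then show ?thesis by blast
  next
    case False
    obtain e1 e2 f1 f2 where Dc: "D = cubic_code e1 e2 f1 f2"
      and p: "\<And>a b. cubic (f1*f1) (e1*e1) (f2*f2) (e2*e2) a b = 0 \<Longrightarrow> a = 0 \<and> b = 0"
      using csrd_one_alternating[OF D(2-4) False] by blast
    have "congruent_codes D (cubic_code 0 s 1 1)"
      unfolding Dc by (rule cubic_code_congruent[OF card q]) (use p s in blast)+
    then have "congruent_codes C (cubic_code 0 s 1 1)" by (rule congruent_codes_trans[OF D(1)])
    then show ?thesis by blast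
  qed
next
  assume "\<exists>Q R. C = pencil_code Q R"
  then obtain Q R where QR: "C = pencil_code Q R" by blast
  have no: "v = 0" if "outer v \<in> pencil_code Q R" for v
    using that C unfolding QR by (simp add: csrd_codes_2_iff)
  have "\<exists>R'\<in>{(0, 0, 1, 0, 0, 0), (0, 0, 1, 0, 0, 1), (c, 0, 1, 0, 0, 1)}.
      congruent_codes C (pencil_code (1, c, 0, 1, 0, 0) R')"
    unfolding QR by (rule pencil_code_normal_form[OF no c])
  then show ?thesis by auto
qed

lemma msrd_code_dist2_iff_card:
  assumes C: "(C :: ('a^3^3) set) \<in> csrd_codes 2"
  shows "msrd_code_dist2 C \<longleftrightarrow> card C = CARD('a) ^ 4"
proof -
  have "srd_code C" "min_distance C = 2" using C by (auto simp: csrd_codes_def csrd_code_def)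
  moreover from this have "card C = CARD('a) ^ matsp.dim C" by (auto simp: srd_code_def intro: card_subspace)
  ultimately show ?thesis using card_ge_2 by (simp add: msrd_code_dist2_def)
qed

end

section \<open>Counting classes by representatives and an invariant\<close>

lemma quotient_eq_image_representatives:
  assumes r: "equiv A r" and P: "P \<subseteq> A" and ex: "\<And>x. x \<in> A \<Longrightarrow> \<exists>y\<in>P. (x, y) \<in> r"
  shows "A // r = (\<lambda>x. r `` {x}) ` P"
proof (intro equalityI subsetI)
  fix K assume "K \<in> A // r"
  then obtain x where x: "x \<in> A" "K = r `` {x}" by (auto elim: quotientE)
  then obtain y where "y \<in> P" "(x, y) \<in> r" using ex by blast
  then show "K \<in> (\<lambda>x. r `` {x}) ` P" using x equiv_class_eq[OF r] by blast
next
  fix K assume "K \<in> (\<lambda>x. r `` {x}) ` P"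
  then show "K \<in> A // r" using P by (auto intro: quotientI)
qed

lemma inj_on_classes_of_invariant:
  assumes r: "equiv A r" and P: "P \<subseteq> A" and inv: "\<And>x y. (x, y) \<in> r \<Longrightarrow> f x = f y" and inj: "inj_on f P"
  shows "inj_on (\<lambda>x. r `` {x}) P"
proof (rule inj_onI)
  fix x y assume xy: "x \<in> P" "y \<in> P" and eq: "r `` {x} = r `` {y}"
  have "(x, y) \<in> r" using eq_equiv_class[OF eq r] xy P by blast
  then show "x = y" using inv inj xy by (meson inj_onD)
qed

text \<open>Translation by 1 permutes the field, so comparing the sums of all elements gives q * 1 =
  0, a power of 2 that vanishes.\<close>

lemma one_add_one_eq_0_of_card_power_2:
  assumes "CARD('a::{field,finite}) = 2 ^ h"
  shows "(1::'a) + 1 = 0"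
proof -
  have "(\<Sum>x\<in>(UNIV :: 'a set). x + 1) = (\<Sum>x\<in>(UNIV :: 'a set). x)"
    by (rule sum.reindex_bij_betw[of "\<lambda>x. x + 1"]) (intro bij_betwI[of _ _ _ "\<lambda>x. x - 1"], auto)
  then have "(of_nat CARD('a) :: 'a) = 0" by (simp add: sum.distrib)
  then have "(2::'a) ^ h = 0" by (simp add: assms)
  then have "(2::'a) = 0" by simp
  then show ?thesis by (simp only: one_add_one)
qed

theorem theorem1p3:
  fixes q :: nat
  assumes "CARD('a::{field,finite}) = q"
    and "\<exists>h. q = 2 ^ h"
    and "q \<ge> 4"
  shows "card ((csrd_codes 2 :: ('a^3^3) set set) // csrd_equiv 2) = 6 \<and>
    card {K \<in> (csrd_codes 2 :: ('a^3^3) set set) // csrd_equiv 2. \<forall>C\<in>K. msrd_code_dist2 C} = 3"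
proof -
  obtain h where h: "CARD('a) = 2 ^ h" using assms by auto
  have q: "CARD('a) \<ge> 3" "q > 1" using assms by auto
  interpret char2_field "TYPE('a)"
    by unfold_locales (rule one_add_one_eq_0_of_card_power_2[OF h])
  obtain c :: 'a where c: "\<And>u. u * u + u \<noteq> c" using artin_schreier_nonempty by blast
  obtain s :: 'a where s: "\<And>a b. cubic (1*1) (0*0) (1*1) (s * s) a b = 0 \<Longrightarrow> a = 0 \<and> b = 0"
    using exists_zero_free_cubic by blast
  define P3 where "P3 = {alt_code, pointed_code, cubic_code 0 s 1 1}"
  define P4 where "P4 = {elliptic_code c 0 0, elliptic_code c 0 1, elliptic_code c c 1}"
  let ?A = "csrd_codes 2 :: ('a^3^3) set set" and ?r = "csrd_equiv 2 :: (('a^3^3) set \<times> ('a^3^3) set) set"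
  define sing where "sing C = card {X \<in> C. det X = 0}" for C :: "('a^3^3) set"
  define f where "f C = (card C, sing C)" for C :: "('a^3^3) set"
  let ?cl = "\<lambda>C. ?r `` {C}"
  have cubic_csrd: "cubic_code 0 s 1 1 \<in> ?A" by (rule cubic_code_csrd) (use s in blast)
  have sub: "P3 \<union> P4 \<subseteq> ?A"
    unfolding P3_def P4_def using alt_code_csrd pointed_code_csrd cubic_csrd elliptic_code_csrd[OF c] by simp
  have eqv: "equiv ?A ?r" by (rule equiv_csrd_equiv)
  have inv: "f C = f D" if "(C, D) \<in> ?r" for C D
    using that code_equivalent_card[of C D] by (auto simp: csrd_equiv_def f_def sing_def)
  have ex: "\<exists>D\<in>P3 \<union> P4. (C, D) \<in> ?r" if C: "C \<in> ?A" for C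
  proof -
    have "\<exists>D\<in>P3 \<union> P4. congruent_codes C D"
      using csrd_code_2_classification[OF h q(1) c s C] unfolding P3_def P4_def by blast
    then obtain D where "D \<in> P3 \<union> P4" "congruent_codes C D" by blast
    then show ?thesis
      using C sub congruent_codes_equivalent by (intro bexI[of _ D]) (auto simp: csrd_equiv_def)
  qed
  have cards3: "card D = CARD('a) ^ 3" if "D \<in> P3" for D
    using that card_alt_code[where 'a='a] card_pointed_code[where 'a='a] card_cubic_code[of 0 s 1 1]
    by (auto simp: P3_def)
  have cards4: "card D = CARD('a) ^ 4" if "D \<in> P4" for D
    using that card_elliptic_code by (auto simp: P4_def)
  have q34: "CARD('a) ^ 3 \<noteq> CARD('a) ^ 4" using card_ge_2 by simp
  have sing3: "sing alt_code = q ^ 3" "sing pointed_code = q ^ 2" "sing (cubic_code 0 s 1 1) = q ^ 1"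
    unfolding sing_def assms(1)[symmetric] power_one_right
    by (rule singular_alt_code, rule singular_pointed_code, rule singular_cubic_code) (use s in blast)
  have ne3: "q ^ 3 \<noteq> q ^ 2" "q ^ 3 \<noteq> q ^ 1" "q ^ 2 \<noteq> q ^ 1"
    using q(2) by (simp_all only: power_inject_exp)
  have sing4: "sing (elliptic_code c c 1) < sing (elliptic_code c 0 0)"
    "sing (elliptic_code c 0 0) < sing (elliptic_code c 0 1)"
    unfolding sing_def by (rule singular_elliptic_codes_distinct[OF c])+
  have d3: "alt_code \<noteq> (pointed_code :: ('a^3^3) set)" "alt_code \<noteq> cubic_code 0 s 1 1"
    "pointed_code \<noteq> cubic_code 0 s 1 1"
    using sing3 ne3 by (metis, metis, metis)
  have ne4: "sing (elliptic_code c 0 0) \<noteq> sing (elliptic_code c 0 1)"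
    "sing (elliptic_code c 0 0) \<noteq> sing (elliptic_code c c 1)"
    "sing (elliptic_code c 0 1) \<noteq> sing (elliptic_code c c 1)"
    using sing4 by linarith+
  have d4: "elliptic_code c 0 0 \<noteq> elliptic_code c 0 1" "elliptic_code c 0 0 \<noteq> elliptic_code c c 1"
    "elliptic_code c 0 1 \<noteq> elliptic_code c c 1"
    using ne4 by (metis, metis, metis)
  have c3: "card P3 = 3" unfolding P3_def using d3 by simp
  have c4: "card P4 = 3" unfolding P4_def using d4 by simp
  have disj: "P3 \<inter> P4 = {}" using cards3 cards4 q34 by force
  have inj3: "inj_on sing P3" unfolding P3_def using sing3 ne3 by (simp add: inj_on_def)
  have inj4: "inj_on sing P4" unfolding P4_def using sing4 by (auto simp: inj_on_def)
  have inj_f: "inj_on f (P3 \<union> P4)"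
  proof (rule inj_onI)
    fix C D assume CD: "C \<in> P3 \<union> P4" "D \<in> P3 \<union> P4" and "f C = f D"
    then have eq: "card C = card D" "sing C = sing D" by (simp_all add: f_def)
    then have "C \<in> P3 \<and> D \<in> P3 \<or> C \<in> P4 \<and> D \<in> P4" using CD cards3 cards4 q34 by (metis UnE)
    then show "C = D" using eq(2) inj3 inj4 by (auto dest: inj_onD)
  qed
  have inj: "inj_on ?cl (P3 \<union> P4)"
    by (rule inj_on_classes_of_invariant[OF eqv sub _ inj_f]) (rule inv)
  have quot: "?A // ?r = ?cl ` (P3 \<union> P4)" by (rule quotient_eq_image_representatives[OF eqv sub]) (rule ex)
  have fin: "finite P3" "finite P4" by (simp_all add: P3_def P4_def)
  have six: "card (?A // ?r) = 6"
    unfolding quot card_image[OF inj] using disj fin c3 c4 by (simp add: card_Un_disjoint)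
  \<comment> \<open>Size is constant on each class, so whether its members have dimension 4 can be
    read off the representative.\<close>
  have all: "(\<forall>C\<in>?cl D. msrd_code_dist2 C) \<longleftrightarrow> D \<in> P4" if D: "D \<in> P3 \<union> P4" for D
  proof -
    have msrd: "msrd_code_dist2 C \<longleftrightarrow> card D = CARD('a) ^ 4" if "C \<in> ?cl D" for C
    proof -
      have CD: "(D, C) \<in> ?r" using that by simp
      then have "C \<in> ?A" by (simp add: csrd_equiv_def)
      then have "msrd_code_dist2 C \<longleftrightarrow> card C = CARD('a) ^ 4" by (rule msrd_code_dist2_iff_card)
      moreover have "card D = card C" using inv[OF CD] by (simp add: f_def)
      ultimately show ?thesis by simp
    qed
    have "D \<in> ?cl D" using equiv_class_self[OF eqv] D sub by blast
    then have "(\<forall>C\<in>?cl D. msrd_code_dist2 C) \<longleftrightarrow> card D = CARD('a) ^ 4" using msrd by blast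
    also have "\<dots> \<longleftrightarrow> D \<in> P4" using D cards3 cards4 q34 by auto
    finally show ?thesis .
  qed
  let ?M = "{K \<in> ?A // ?r. \<forall>C\<in>K. msrd_code_dist2 C}"
  have "?M = ?cl ` P4"
  proof (intro equalityI subsetI)
    fix L assume "L \<in> ?M"
    then have "L \<in> ?cl ` (P3 \<union> P4)" and L: "\<forall>C\<in>L. msrd_code_dist2 C" unfolding quot by simp_all
    then obtain D where D: "D \<in> P3 \<union> P4" "L = ?cl D" by (elim imageE)
    then have "D \<in> P4" using all[OF D(1)] L by (simp only:)
    then show "L \<in> ?cl ` P4" using D(2) by (rule rev_image_eqI)
  next
    fix L assume "L \<in> ?cl ` P4"
    then obtain D where D: "D \<in> P4" "L = ?cl D" by (elim imageE)
    then have D': "D \<in> P3 \<union> P4" by simp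
    have "\<forall>C\<in>L. msrd_code_dist2 C" using all[OF D'] D by (simp only:)
    moreover have "L \<in> ?A // ?r" unfolding quot using D' D(2) by (rule rev_image_eqI)
    ultimately show "L \<in> ?M" by simp
  qed
  moreover have "inj_on ?cl P4" using inj by (rule inj_on_subset) simp
  ultimately have "card ?M = 3" using c4 by (simp add: card_image)
  with six show ?thesis by blast
qed

end
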